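(* Fix $A>0$ and $p>1$. If $\{e_n\}_{n=1}^{\infty}\subset L^2(\mathbb{R})$ satisfies $\|e_n\|_2=1$ for all $n$ and $$\forall n\in\mathbb{N},\quad |\mu_p(e_n)|\leq A,\quad |\Delta_p(e_n)|\leq A,\quad\text{and}\quad |\Delta_2(\widehat{e_n})|\leq A,$$ then $\{e_n\}_{n=1}^{\infty}$ cannot be a Schauder basis for $L^2(\mathbb{R})$.
   Context: The Fourier transform on $L^2(\mathbb{R})$ is normalized by $\widehat{f}(\xi)=\int f(t)e^{-2\pi i t\xi}\,dt$. For $p>1$ and $h\in L^2(\mathbb{R})$ with $\|h\|_2=1$, the $p$-dispersion of $h$ is $\Delta_p(h)=\min_{a\in\mathbb{R}}\left(\int|t-a|^p|h(t)|^2\,dt\right)^{1/2}$ (equal to $\infty$ if $\int|t|^p|h(t)|^2\,dt=\infty$). When $\Delta_p(h)$ is finite, the $p$-mean $\mu_p(h)$ is the unique $a\in\mathbb{R}$ attaining this minimum (uniqueness holds by strict convexity since $p>1$). A bound such as $|\mu_p(h)|\le A$ or $\Delta_p(h)\le A$ includes the requirement that the quantity be defined and finite. A system $\{e_n\}_{n=1}^\infty$ is a Schauder basis for a Hilbert space $H$ if for every $f\in H$ there exists a unique scalar sequence $\{c_n\}_{n=1}^\infty\subset\mathbb{C}$ such that $\lim_{N\to\infty}\|f-\sum_{n=1}^N c_ne_n\|=0$. *)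

theory Defs
  imports "HOL-Analysis.Analysis"
begin

text \<open>
  Elements of \<open>L\<^sup>2(\<real>)\<close> are represented by Borel functions; functions that agree almost everywhere
  represent the same element, so \<open>norm_L2\<close> is only a seminorm on the set \<open>L2\<close> of representatives.
\<close>

definition L2 :: "(real \<Rightarrow> complex) set" where
  "L2 = {f \<in> borel_measurable lborel. integrable lborel (\<lambda>t. (cmod (f t))\<^sup>2)}"

definition norm_L2 :: "(real \<Rightarrow> complex) \<Rightarrow> real" where
  "norm_L2 f = sqrt (\<integral>t. (cmod (f t))\<^sup>2 \<partial>lborel)"

text \<open>
  The integral defining the Fourier transform need not converge for \<open>f \<in> L2\<close>. As usual, the
  transform is the limit in \<open>L\<^sup>2\<close> of the transforms of the truncations of \<open>f\<close> to \<open>{-N..N}\<close> (which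
  lie in \<open>L\<^sup>1 \<inter> L\<^sup>2\<close>). The limit exists by Plancherel's theorem and is unique up to a null set;
  the choice operator picks one representative.
\<close>

definition fourier_truncated :: "nat \<Rightarrow> (real \<Rightarrow> complex) \<Rightarrow> real \<Rightarrow> complex" where
  "fourier_truncated N f \<xi> =
     (LINT t:{- real N..real N}|lborel. f t * exp (- 2 * of_real pi * \<i> * of_real t * of_real \<xi>))"

definition fourier_L2 :: "(real \<Rightarrow> complex) \<Rightarrow> real \<Rightarrow> complex" where
  "fourier_L2 f =
     (SOME g. g \<in> L2 \<and> (\<lambda>N. norm_L2 (\<lambda>\<xi>. g \<xi> - fourier_truncated N f \<xi>)) \<longlonglongrightarrow> 0)"

definition p_moment :: "real \<Rightarrow> (real \<Rightarrow> complex) \<Rightarrow> real \<Rightarrow> ennreal" where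
  "p_moment p h a = (\<integral>\<^sup>+ t. ennreal (\<bar>t - a\<bar> powr p * (cmod (h t))\<^sup>2) \<partial>lborel)"

text \<open>
  For \<open>h \<in> L2\<close> with \<open>norm_L2 h = 1\<close> and \<open>p > 1\<close>, if the moment about \<open>0\<close> is finite, then so are all
  others, and the infimum is a minimum, attained at exactly one point. The case distinction is
  needed because \<open>enn2real \<infinity> = 0\<close>.
\<close>

definition p_dispersion :: "real \<Rightarrow> (real \<Rightarrow> complex) \<Rightarrow> ereal" where
  "p_dispersion p h =
     (if p_moment p h 0 = \<infinity> then \<infinity>
      else ereal (sqrt (enn2real (INF a. p_moment p h a))))"

text \<open>The following is meaningful only if \<open>p_dispersion p h\<close> is finite.\<close>

definition p_mean :: "real \<Rightarrow> (real \<Rightarrow> complex) \<Rightarrow> real" where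
  "p_mean p h = (THE a. \<forall>b. p_moment p h a \<le> p_moment p h b)"

text \<open>Systems are indexed from \<open>0\<close>: \<open>e n\<close> is the \<open>(n+1)\<close>-st element.\<close>

definition schauder_basis_L2 :: "(nat \<Rightarrow> real \<Rightarrow> complex) \<Rightarrow> bool" where
  "schauder_basis_L2 e \<longleftrightarrow>
     (\<forall>n. e n \<in> L2) \<and>
     (\<forall>f\<in>L2. \<exists>!c :: nat \<Rightarrow> complex.
        (\<lambda>N. norm_L2 (\<lambda>t. f t - (\<Sum>n<N. c n * e n t))) \<longlonglongrightarrow> 0)"

end

theory Submission
  imports Defs "HOL-Probability.Characteristic_Functions"
begin

text \<open>
  The hypotheses say that the \<open>e n\<close> are concentrated, uniformly in \<open>n\<close>, near the origin in time and
  near some frequency \<open>b n\<close>; the \<open>b n\<close> are arbitrary. A unit vector \<open>f\<close> that lives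
  far from the origin in time and near the origin in frequency is then almost orthogonal to every
  single \<open>e n\<close>: \<open>\<langle>e n, f\<rangle>\<close> is uniformly small because of the concentration in time, and it
  is \<open>O(1 / (1 + \<bar>b n\<bar>))\<close> because of the concentration in frequency. If \<open>e\<close> were a basis with
  coefficient functionals \<open>c n\<close>, expanding \<open>f\<close> would give \<open>1 = \<langle>f, f\<rangle> = (\<Sum>n. c n f * \<langle>e n, f\<rangle>)\<close>,
  and the proof shows that the right side is small.

  Two ingredients make the sum small. The first one is a count: only boundedly many of the \<open>b n\<close>
  lie in an interval of length 2, so at most \<open>O(2 ^ j)\<close> indices satisfy \<open>1 + \<bar>b n\<bar> < 2 ^ j\<close>.
  Together with \<open>\<bar>c n f\<bar> = O(1)\<close> this only just fails, since the dyadic shells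
  contribute \<open>O(1)\<close> each. The second one repairs this with an improvement that is due
  to the geometry of the Hilbert norm (a weak form of the theorem of Gurarii and Gurarii):
  \<open>(\<Sum>n\<in>F. \<bar>c n f\<bar>) \<le> B * r ^ k * \<parallel>f\<parallel>\<close> whenever \<open>F\<close> has at most \<open>2 ^ k\<close> elements, with a constant
  \<open>r < 2\<close> (\<open>sum_cmod_coef_le\<close>). The shells now contribute \<open>O((r / 2) ^ j)\<close>, a convergent
  series, and the finitely many remaining terms vanish as \<open>f\<close> moves to infinity
  (\<open>not_uniformly_localized\<close>).

  The same estimate yields the count. After demodulation, all \<open>e n\<close> with \<open>b n\<close> in a fixed
  interval are close to one space of step functions of a dimension \<open>d\<close> that is independent of the interval.
  Since \<open>c n (e n) = 1\<close>, summing over \<open>2 ^ m\<close> such indices gives \<open>2 ^ m \<le> C * d * r ^ m\<close>, which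
  bounds \<open>m\<close> (\<open>window_card_le\<close>).

  Concentration in frequency enters only through translations: by Plancherel's theorem,
  \<open>\<parallel>f(\<cdot> + h) - exp(2 \<pi> \<i> b h) f\<parallel> \<le> 2 \<pi> B \<bar>h\<bar>\<close> if the second moment of the Fourier transform
  of \<open>f\<close> about \<open>b\<close> is at most \<open>B\<^sup>2\<close> (\<open>translate_close_to_modulation\<close>). Concentration in time
  requires that \<open>p_mean\<close> really is a minimizer of the moment (\<open>p_mean_minimizes\<close>).
\<close>

section \<open>The seminormed space of square integrable functions\<close>

lemma L2_D: assumes "f \<in> L2" shows L2_measurable: "f \<in> borel_measurable borel"
  and L2_integrable: "integrable lborel (\<lambda>t. (cmod (f t))\<^sup>2)"
  using assms by (auto simp: L2_def)

lemma L2_I: "f \<in> borel_measurable borel \<Longrightarrow> integrable lborel (\<lambda>t. (cmod (f t))\<^sup>2) \<Longrightarrow> f \<in> L2"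
  by (auto simp: L2_def)

lemma norm_L2_nonneg [simp]: "0 \<le> norm_L2 f"
  by (simp add: norm_L2_def)

lemma norm_L2_power2: "(norm_L2 f)\<^sup>2 = (\<integral>t. (cmod (f t))\<^sup>2 \<partial>lborel)"
  by (simp add: norm_L2_def)

lemma cmod_add_power2_le: "(cmod (a + b))\<^sup>2 \<le> 2 * ((cmod a)\<^sup>2 + (cmod b)\<^sup>2)"
proof -
  have "(cmod (a + b))\<^sup>2 \<le> (cmod a + cmod b)\<^sup>2"
    by (intro power_mono norm_triangle_ineq) auto
  also have "\<dots> \<le> 2 * ((cmod a)\<^sup>2 + (cmod b)\<^sup>2)"
    using sum_squares_ge_zero[of "cmod a - cmod b" 0] by (simp add: power2_eq_square algebra_simps)
  finally show ?thesis .
qed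

lemma L2_zero [simp]: "(\<lambda>t. 0) \<in> L2"
  by (auto simp: L2_def)

lemma norm_L2_zero [simp]: "norm_L2 (\<lambda>t. 0) = 0"
  by (simp add: norm_L2_def)

lemma L2_dominated:
  assumes "f \<in> L2" "g \<in> borel_measurable borel" "\<And>t. cmod (g t) \<le> C * cmod (f t)"
  shows "g \<in> L2"
proof (rule L2_I)
  show "integrable lborel (\<lambda>t. (cmod (g t))\<^sup>2)"
  proof (rule Bochner_Integration.integrable_bound)
    show "integrable lborel (\<lambda>t. C\<^sup>2 * (cmod (f t))\<^sup>2)"
      using L2_integrable[OF assms(1)] by simp
    show "(\<lambda>t. (cmod (g t))\<^sup>2) \<in> borel_measurable lborel"
      using assms(2) by simp
    show "AE t in lborel. norm ((cmod (g t))\<^sup>2) \<le> norm (C\<^sup>2 * (cmod (f t))\<^sup>2)"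
      using assms(3) by (auto simp flip: power_mult_distrib intro!: power_mono)
  qed
qed fact

lemma L2_cmult [intro]: "f \<in> L2 \<Longrightarrow> (\<lambda>t. c * f t) \<in> L2"
  by (rule L2_dominated[where C="cmod c"]) (auto dest: L2_measurable simp: norm_mult)

lemma L2_add [intro]:
  assumes "f \<in> L2" "g \<in> L2"
  shows "(\<lambda>t. f t + g t) \<in> L2"
proof (rule L2_I)
  have [measurable]: "f \<in> borel_measurable borel" "g \<in> borel_measurable borel"
    using assms by (auto dest: L2_measurable)
  show "(\<lambda>t. f t + g t) \<in> borel_measurable borel" by measurable
  show "integrable lborel (\<lambda>t. (cmod (f t + g t))\<^sup>2)"
  proof (rule Bochner_Integration.integrable_bound)
    show "integrable lborel (\<lambda>t. 2 * ((cmod (f t))\<^sup>2 + (cmod (g t))\<^sup>2))"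
      using L2_integrable[OF assms(1)] L2_integrable[OF assms(2)] by simp
  qed (use cmod_add_power2_le in auto)
qed

lemma L2_diff [intro]:
  assumes "f \<in> L2" "g \<in> L2"
  shows "(\<lambda>t. f t - g t) \<in> L2"
  using L2_add[OF assms(1) L2_cmult[OF assms(2), of "-1"]] by simp

lemma L2_sum [intro]:
  assumes "\<And>i. i \<in> I \<Longrightarrow> f i \<in> L2"
  shows "(\<lambda>t. \<Sum>i\<in>I. f i t) \<in> L2"
  using assms by (induction I rule: infinite_finite_induct) (simp_all add: L2_add)

lemma norm_L2_cmult: "norm_L2 (\<lambda>t. c * f t) = cmod c * norm_L2 f"
  by (simp add: norm_L2_def norm_mult power_mult_distrib real_sqrt_mult)

lemma norm_L2_minus_commute: "norm_L2 (\<lambda>t. f t - g t) = norm_L2 (\<lambda>t. g t - f t)"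
  by (simp add: norm_L2_def norm_minus_commute)

lemma L2_cmod_mult_integrable:
  assumes "f \<in> L2" "g \<in> L2"
  shows "integrable lborel (\<lambda>t. cmod (f t) * cmod (g t))"
proof (rule Bochner_Integration.integrable_bound)
  have [measurable]: "f \<in> borel_measurable borel" "g \<in> borel_measurable borel"
    using assms by (auto dest: L2_measurable)
  show "integrable lborel (\<lambda>t. (cmod (f t))\<^sup>2 + (cmod (g t))\<^sup>2)"
    using L2_integrable[OF assms(1)] L2_integrable[OF assms(2)] by simp
  have "cmod (f t) * cmod (g t) \<le> (cmod (f t))\<^sup>2 + (cmod (g t))\<^sup>2" for t
  proof -
    have "0 \<le> cmod (f t) * cmod (g t)" by simp
    then show ?thesis using sum_squares_bound[of "cmod (f t)" "cmod (g t)"] by linarith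
  qed
  then show "AE t in lborel. norm (cmod (f t) * cmod (g t)) \<le> norm ((cmod (f t))\<^sup>2 + (cmod (g t))\<^sup>2)"
    by auto
  show "(\<lambda>t. cmod (f t) * cmod (g t)) \<in> borel_measurable lborel" by simp
qed

lemma L2_mult_integrable:
  assumes "f \<in> L2" "g \<in> L2"
  shows "integrable lborel (\<lambda>t. f t * g t)"
proof -
  have [measurable]: "f \<in> borel_measurable borel" "g \<in> borel_measurable borel"
    using assms by (auto dest: L2_measurable)
  show ?thesis
    by (rule Bochner_Integration.integrable_bound[OF L2_cmod_mult_integrable[OF assms]]) (auto simp: norm_mult)
qed

lemma Cauchy_Schwarz_L2:
  assumes "f \<in> L2" "g \<in> L2"
  shows "(\<integral>t. cmod (f t) * cmod (g t) \<partial>lborel) \<le> norm_L2 f * norm_L2 g"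
proof -
  define X Y Z where "X = (norm_L2 f)\<^sup>2" and "Y = (norm_L2 g)\<^sup>2"
    and "Z = (\<integral>t. cmod (f t) * cmod (g t) \<partial>lborel)"
  \<comment> \<open>The discriminant of this polynomial in \<open>s\<close> is nonpositive.\<close>
  have quad: "0 \<le> s\<^sup>2 * X - 2 * s * Z + Y" for s
  proof -
    have "0 \<le> (\<integral>t. (s * cmod (f t) - cmod (g t))\<^sup>2 \<partial>lborel)" by simp
    also have "\<dots> = (\<integral>t. s\<^sup>2 * (cmod (f t))\<^sup>2 - 2 * s * (cmod (f t) * cmod (g t)) + (cmod (g t))\<^sup>2 \<partial>lborel)"
      by (simp add: power2_eq_square algebra_simps)
    also have "\<dots> = s\<^sup>2 * X - 2 * s * Z + Y"
      using L2_integrable[OF assms(1)] L2_integrable[OF assms(2)] L2_cmod_mult_integrable[OF assms]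
      by (simp add: X_def Y_def Z_def norm_L2_power2)
    finally show ?thesis .
  qed
  have Z: "Z \<ge> 0" unfolding Z_def by simp
  have XY: "X \<ge> 0" "Y \<ge> 0" by (auto simp: X_def Y_def)
  have "Z\<^sup>2 \<le> X * Y"
  proof (cases "X = 0")
    case True
    have "Z = 0"
    proof (rule ccontr)
      assume "Z \<noteq> 0"
      then show False using quad[of "(Y + 1) / (2 * Z)"] True Z by simp
    qed
    then show ?thesis using True by simp
  next
    case False
    with XY have "X > 0" by simp
    have "0 \<le> X * ((Z / X)\<^sup>2 * X - 2 * (Z / X) * Z + Y)" by (intro mult_nonneg_nonneg quad XY)
    also have "\<dots> = X * Y - Z\<^sup>2" using \<open>X > 0\<close> by (simp add: field_simps power2_eq_square)
    finally show ?thesis by simp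
  qed
  then have "Z\<^sup>2 \<le> (norm_L2 f * norm_L2 g)\<^sup>2" by (simp add: X_def Y_def power_mult_distrib)
  then show ?thesis unfolding Z_def using power2_le_imp_le by (metis mult_nonneg_nonneg norm_L2_nonneg)
qed

text \<open>
  The pairing is bilinear; conjugates are inserted where the inner product is meant.
\<close>

lemma norm_integral_mult_le:
  assumes "f \<in> L2" "g \<in> L2"
  shows "cmod (\<integral>t. f t * g t \<partial>lborel) \<le> norm_L2 f * norm_L2 g"
proof -
  have "cmod (\<integral>t. f t * g t \<partial>lborel) \<le> (\<integral>t. cmod (f t * g t) \<partial>lborel)"
    by (rule integral_norm_bound)
  also have "\<dots> \<le> norm_L2 f * norm_L2 g"
    using Cauchy_Schwarz_L2[OF assms] by (simp add: norm_mult)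
  finally show ?thesis .
qed

lemma norm_L2_mono:
  assumes "g \<in> L2" "f \<in> borel_measurable borel" "\<And>t. cmod (f t) \<le> cmod (g t)"
  shows "norm_L2 f \<le> norm_L2 g"
  unfolding norm_L2_def
proof (intro real_sqrt_le_mono integral_mono)
  show "integrable lborel (\<lambda>t. (cmod (f t))\<^sup>2)"
    using L2_dominated[OF assms(1,2), of 1] assms(3) by (auto dest: L2_integrable)
qed (use assms L2_integrable in \<open>auto intro: power_mono\<close>)

lemma norm_L2_triangle:
  assumes "f \<in> L2" "g \<in> L2"
  shows "norm_L2 (\<lambda>t. f t + g t) \<le> norm_L2 f + norm_L2 g"
proof -
  have "(norm_L2 (\<lambda>t. f t + g t))\<^sup>2
      \<le> (\<integral>t. (cmod (f t))\<^sup>2 + 2 * (cmod (f t) * cmod (g t)) + (cmod (g t))\<^sup>2 \<partial>lborel)"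
    unfolding norm_L2_power2
  proof (rule integral_mono)
    show "(cmod (f t + g t))\<^sup>2 \<le> (cmod (f t))\<^sup>2 + 2 * (cmod (f t) * cmod (g t)) + (cmod (g t))\<^sup>2" for t
      using power_mono[OF norm_triangle_ineq[of "f t" "g t"], of 2] by (simp add: power2_sum)
  qed (use L2_add[OF assms] L2_integrable assms L2_cmod_mult_integrable in auto)
  also have "\<dots> = (norm_L2 f)\<^sup>2 + 2 * (\<integral>t. cmod (f t) * cmod (g t) \<partial>lborel) + (norm_L2 g)\<^sup>2"
    using L2_integrable[OF assms(1)] L2_integrable[OF assms(2)] L2_cmod_mult_integrable[OF assms]
    by (simp add: norm_L2_power2)
  also have "\<dots> \<le> (norm_L2 f + norm_L2 g)\<^sup>2"
    using Cauchy_Schwarz_L2[OF assms] by (simp add: power2_sum)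
  finally show ?thesis using power2_le_imp_le by (metis add_nonneg_nonneg norm_L2_nonneg)
qed

lemma norm_L2_triangle_sub:
  assumes "f \<in> L2" "g \<in> L2"
  shows "norm_L2 (\<lambda>t. f t - g t) \<le> norm_L2 f + norm_L2 g"
  using norm_L2_triangle[OF assms(1) L2_cmult[OF assms(2), of "-1"]] norm_L2_cmult[of "-1" g] by simp

lemma norm_L2_triangle_mid:
  assumes "f \<in> L2" "g \<in> L2" "h \<in> L2"
  shows "norm_L2 (\<lambda>t. f t - h t) \<le> norm_L2 (\<lambda>t. f t - g t) + norm_L2 (\<lambda>t. g t - h t)"
  using norm_L2_triangle[OF L2_diff[OF assms(1,2)] L2_diff[OF assms(2,3)]] by simp

lemma norm_L2_reverse_triangle:
  assumes "f \<in> L2" "g \<in> L2"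
  shows "\<bar>norm_L2 f - norm_L2 g\<bar> \<le> norm_L2 (\<lambda>t. f t - g t)"
  using norm_L2_triangle_mid[OF assms L2_zero] norm_L2_triangle_mid[OF assms(2,1) L2_zero]
    norm_L2_minus_commute[of f g] by simp

lemma norm_L2_sum_le:
  assumes "\<And>i. i \<in> I \<Longrightarrow> f i \<in> L2"
  shows "norm_L2 (\<lambda>t. \<Sum>i\<in>I. f i t) \<le> (\<Sum>i\<in>I. norm_L2 (f i))"
  using assms
proof (induction I rule: infinite_finite_induct)
  case (insert x F)
  then show ?case
    using norm_L2_triangle[of "f x" "\<lambda>t. \<Sum>i\<in>F. f i t"] L2_sum[of F f] by simp
qed simp_all

text \<open>Riesz--Fischer: a rapidly convergent subsequence has square integrable total variation, so
  it converges almost everywhere, and Fatou's lemma bounds the distance to the pointwise limit.\<close>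

theorem L2_complete:
  assumes L2: "\<And>n. u n \<in> L2"
    and Cauchy: "\<And>\<epsilon>. \<epsilon> > 0 \<Longrightarrow> \<exists>N. \<forall>m\<ge>N. \<forall>n\<ge>N. norm_L2 (\<lambda>t. u m t - u n t) < \<epsilon>"
  shows "\<exists>g\<in>L2. (\<lambda>n. norm_L2 (\<lambda>t. g t - u n t)) \<longlonglongrightarrow> 0"
proof -
  have [measurable]: "u n \<in> borel_measurable borel" for n
    using L2 L2_measurable by blast
  have "\<forall>k. \<exists>N. \<forall>m\<ge>N. \<forall>n\<ge>N. norm_L2 (\<lambda>t. u m t - u n t) < (1/2)^k"
    using Cauchy by simp
  then obtain N where N: "\<And>k m n. m \<ge> N k \<Longrightarrow> n \<ge> N k \<Longrightarrow> norm_L2 (\<lambda>t. u m t - u n t) < (1/2)^k"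
    by metis
  \<comment> \<open>The summand \<open>k\<close> makes \<open>r\<close> exceed any given index, the maximum makes it monotone.\<close>
  define r where "r = (\<lambda>k. k + Max (N ` {..k}))"
  have rN: "r k \<ge> N k" for k unfolding r_def by (rule trans_le_add2[OF Max_ge]) auto
  have rmono: "r k \<le> r (Suc k)" for k unfolding r_def by (intro add_mono Max_mono) auto
  define v where "v = (\<lambda>k. u (r k))"
  have v_L2: "v k \<in> L2" for k using L2 by (simp add: v_def)
  have [measurable]: "v k \<in> borel_measurable borel" for k by (simp add: v_def)
  define d where "d = (\<lambda>k t. complex_of_real (cmod (v (Suc k) t - v k t)))"
  have d_L2: "d k \<in> L2" for k
    by (rule L2_dominated[OF L2_diff[OF v_L2 v_L2], where C=1]) (auto simp: d_def)
  have d_norm: "norm_L2 (d k) \<le> (1/2)^k" for k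
  proof -
    have "norm_L2 (d k) = norm_L2 (\<lambda>t. v (Suc k) t - v k t)" by (simp add: norm_L2_def d_def)
    also have "\<dots> \<le> (1/2)^k" unfolding v_def
      using N[of k "r (Suc k)" "r k"] rN[of k] rmono[of k] by simp
    finally show ?thesis .
  qed
  have int_sq: "(\<integral>\<^sup>+t. ennreal ((\<Sum>k<n. cmod (v (Suc k) t - v k t))\<^sup>2) \<partial>lborel) \<le> 4" for n
  proof -
    have eq: "(\<Sum>k<n. cmod (v (Suc k) t - v k t))\<^sup>2 = (cmod (\<Sum>k<n. d k t))\<^sup>2" for t
      unfolding d_def of_real_sum[symmetric] norm_of_real by simp
    have mem: "(\<lambda>t. \<Sum>k<n. d k t) \<in> L2" using d_L2 by auto
    have "norm_L2 (\<lambda>t. \<Sum>k<n. d k t) \<le> (\<Sum>k<n. norm_L2 (d k))" by (rule norm_L2_sum_le[OF d_L2])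
    also have "\<dots> \<le> (\<Sum>k<n. (1/2)^k)" by (intro sum_mono d_norm)
    also have "\<dots> \<le> 2" by (subst geometric_sum) auto
    finally have "norm_L2 (\<lambda>t. \<Sum>k<n. d k t) ^ 2 \<le> 2^2" by (intro power_mono) auto
    then have "(\<integral>t. (cmod (\<Sum>k<n. d k t))\<^sup>2 \<partial>lborel) \<le> 4" by (simp add: norm_L2_power2)
    then show ?thesis unfolding eq
      using L2_integrable[OF mem] by (subst nn_integral_eq_integral) (auto simp flip: ennreal_numeral)
  qed
  have "(\<integral>\<^sup>+t. (SUP n. ennreal ((\<Sum>k<n. cmod (v (Suc k) t - v k t))\<^sup>2)) \<partial>lborel)
      = (SUP n. (\<integral>\<^sup>+t. ennreal ((\<Sum>k<n. cmod (v (Suc k) t - v k t))\<^sup>2) \<partial>lborel))"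
  proof (rule nn_integral_monotone_convergence_SUP)
    show "incseq (\<lambda>n t. ennreal ((\<Sum>k<n. cmod (v (Suc k) t - v k t))\<^sup>2))"
      by (intro incseq_SucI le_funI ennreal_leI power_mono sum_nonneg) simp_all
  qed measurable
  also have "\<dots> \<le> 4" using int_sq by (intro SUP_least)
  finally have "(\<integral>\<^sup>+t. (SUP n. ennreal ((\<Sum>k<n. cmod (v (Suc k) t - v k t))\<^sup>2)) \<partial>lborel) \<noteq> \<infinity>"
    by (auto simp: top_unique)
  then have "AE t in lborel. (SUP n. ennreal ((\<Sum>k<n. cmod (v (Suc k) t - v k t))\<^sup>2)) \<noteq> \<infinity>"
    by (intro nn_integral_PInf_AE) simp_all
  then have AEconv: "AE t in lborel. convergent (\<lambda>k. v k t)"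
  proof eventually_elim
    case (elim t)
    then obtain B where B: "B \<ge> 0" "(SUP n. ennreal ((\<Sum>k<n. cmod (v (Suc k) t - v k t))\<^sup>2)) = ennreal B"
      by (cases "SUP n. ennreal ((\<Sum>k<n. cmod (v (Suc k) t - v k t))\<^sup>2)" rule: ennreal_cases) auto
    have "(\<Sum>k<n. cmod (v (Suc k) t - v k t)) \<le> sqrt B" for n
    proof -
      have "ennreal ((\<Sum>k<n. cmod (v (Suc k) t - v k t))\<^sup>2) \<le> ennreal B"
        unfolding B(2)[symmetric] by (rule SUP_upper) simp
      then show ?thesis using B(1) by (simp add: ennreal_le_iff real_le_rsqrt)
    qed
    then have "summable (\<lambda>k. cmod (v (Suc k) t - v k t))"
      by (intro summableI_nonneg_bounded) auto
    then have "summable (\<lambda>k. v (Suc k) t - v k t)" by (rule summable_norm_cancel)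
    then have "convergent (\<lambda>n. \<Sum>k<n. v (Suc k) t - v k t)" by (simp add: summable_iff_convergent)
    then have "convergent (\<lambda>n. v n t - v 0 t)" by (simp add: sum_lessThan_telescope[of "\<lambda>k. v k t"])
    then show ?case using convergent_add[OF _ convergent_const, of "\<lambda>n. v n t - v 0 t" "v 0 t"] by simp
  qed
  define g where "g = (\<lambda>t. lim (\<lambda>k. v k t))"
  have [measurable]: "g \<in> borel_measurable borel" unfolding g_def by measurable
  have AElim: "AE t in lborel. (\<lambda>k. v k t) \<longlonglongrightarrow> g t"
    using AEconv by eventually_elim (simp add: g_def convergent_LIMSEQ_iff)
  have key: "(\<integral>\<^sup>+t. ennreal ((cmod (g t - u n t))\<^sup>2) \<partial>lborel) \<le> ennreal (\<epsilon>\<^sup>2)"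
    if "\<epsilon> > 0" "\<forall>m\<ge>M. \<forall>n\<ge>M. norm_L2 (\<lambda>t. u m t - u n t) < \<epsilon>" "n \<ge> M" for \<epsilon> M n
  proof -
    have "(\<integral>\<^sup>+t. ennreal ((cmod (g t - u n t))\<^sup>2) \<partial>lborel)
       = (\<integral>\<^sup>+t. liminf (\<lambda>k. ennreal ((cmod (v k t - u n t))\<^sup>2)) \<partial>lborel)"
    proof (rule nn_integral_cong_AE, use AElim in eventually_elim)
      case (elim t)
      then have "(\<lambda>k. ennreal ((cmod (v k t - u n t))\<^sup>2)) \<longlonglongrightarrow> ennreal ((cmod (g t - u n t))\<^sup>2)"
        by (intro tendsto_intros)
      then show ?case by (rule lim_imp_Liminf[OF sequentially_bot, symmetric])
    qed
    also have "\<dots> \<le> liminf (\<lambda>k. (\<integral>\<^sup>+t. ennreal ((cmod (v k t - u n t))\<^sup>2) \<partial>lborel))"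
      by (rule nn_integral_liminf) measurable
    also have "\<dots> \<le> ennreal (\<epsilon>\<^sup>2)"
    proof (rule Liminf_le[OF sequentially_bot])
      have le: "(\<integral>\<^sup>+t. ennreal ((cmod (v k t - u n t))\<^sup>2) \<partial>lborel) \<le> ennreal (\<epsilon>\<^sup>2)" if "k \<ge> M" for k
      proof -
        have "r k \<ge> M" using that by (simp add: r_def)
        then have "norm_L2 (\<lambda>t. v k t - u n t) \<le> \<epsilon>"
          using \<open>\<forall>m\<ge>M. \<forall>n\<ge>M. norm_L2 (\<lambda>t. u m t - u n t) < \<epsilon>\<close> \<open>n \<ge> M\<close> unfolding v_def
          by (intro less_imp_le) auto
        then have "(norm_L2 (\<lambda>t. v k t - u n t))\<^sup>2 \<le> \<epsilon>\<^sup>2" by (intro power_mono) auto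
        then show ?thesis
          using L2_integrable[OF L2_diff[OF v_L2 L2, of k n]]
          by (subst nn_integral_eq_integral) (auto simp: norm_L2_power2 intro: ennreal_leI)
      qed
      show "\<forall>\<^sub>F k in sequentially. (\<integral>\<^sup>+t. ennreal ((cmod (v k t - u n t))\<^sup>2) \<partial>lborel) \<le> ennreal (\<epsilon>\<^sup>2)"
        using eventually_ge_at_top[of M] by eventually_elim (rule le)
    qed
    finally show ?thesis .
  qed
  have diff_L2: "(\<lambda>t. g t - u n t) \<in> L2" and diff_norm: "norm_L2 (\<lambda>t. g t - u n t) \<le> \<epsilon>"
    if "\<epsilon> > 0" "\<forall>m\<ge>M. \<forall>n\<ge>M. norm_L2 (\<lambda>t. u m t - u n t) < \<epsilon>" "n \<ge> M" for \<epsilon> M n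
  proof -
    have "integrable lborel (\<lambda>t. (cmod (g t - u n t))\<^sup>2)"
      using key[OF that] by (intro integrableI_bounded) (auto simp: le_less_trans)
    then show "(\<lambda>t. g t - u n t) \<in> L2" by (intro L2_I) simp_all
    then have "ennreal ((norm_L2 (\<lambda>t. g t - u n t))\<^sup>2) \<le> ennreal (\<epsilon>\<^sup>2)"
      using key[OF that] by (subst (asm) nn_integral_eq_integral) (auto simp: norm_L2_power2 L2_integrable)
    then show "norm_L2 (\<lambda>t. g t - u n t) \<le> \<epsilon>" using \<open>\<epsilon> > 0\<close> by (auto intro: power2_le_imp_le)
  qed
  obtain M where M: "\<forall>m\<ge>M. \<forall>n\<ge>M. norm_L2 (\<lambda>t. u m t - u n t) < 1"
    using Cauchy[of 1] by auto
  have "g \<in> L2" using L2_add[OF diff_L2[OF _ M order_refl] L2, of M] by simp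
  moreover have "(\<lambda>n. norm_L2 (\<lambda>t. g t - u n t)) \<longlonglongrightarrow> 0"
  proof (rule LIMSEQ_I)
    fix \<epsilon> :: real assume "\<epsilon> > 0"
    obtain M where M: "\<forall>m\<ge>M. \<forall>n\<ge>M. norm_L2 (\<lambda>t. u m t - u n t) < \<epsilon> / 2"
      using Cauchy[of "\<epsilon> / 2"] \<open>\<epsilon> > 0\<close> by auto
    have "norm_L2 (\<lambda>t. g t - u n t) \<le> \<epsilon> / 2" if "n \<ge> M" for n
      using diff_norm[OF _ M that] \<open>\<epsilon> > 0\<close> by simp
    then show "\<exists>M. \<forall>n\<ge>M. norm (norm_L2 (\<lambda>t. g t - u n t) - 0) < \<epsilon>"
      using \<open>\<epsilon> > 0\<close> by (intro exI[of _ M]) fastforce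
  qed
  ultimately show ?thesis by blast
qed

section \<open>Coefficients with respect to a Schauder basis\<close>

text \<open>
  Baire's theorem: if no \<open>A m\<close> were dense in a ball, one could choose a nested sequence of balls, the
  \<open>m\<close>-th of them at a positive distance from \<open>A m\<close>, and their common point would lie in no \<open>A m\<close>.
\<close>

lemma L2_Baire:
  fixes A :: "nat \<Rightarrow> (real \<Rightarrow> complex) set"
  assumes cover: "\<And>f. f \<in> L2 \<Longrightarrow> \<exists>m. f \<in> A m"
  shows "\<exists>m. \<exists>x\<in>L2. \<exists>r>0. \<forall>y\<in>L2. norm_L2 (\<lambda>t. y t - x t) \<le> r \<longrightarrow>
           (\<forall>\<eta>>0. \<exists>z\<in>A m \<inter> L2. norm_L2 (\<lambda>t. y t - z t) < \<eta>)"
proof (rule ccontr)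
  assume neg: "\<not> ?thesis"
  have gap: "\<exists>y\<in>L2. norm_L2 (\<lambda>t. y t - x t) \<le> r \<and> (\<exists>\<eta>>0. \<forall>z\<in>A m \<inter> L2. norm_L2 (\<lambda>t. y t - z t) \<ge> \<eta>)"
    if "x \<in> L2" "r > 0" for m x r
  proof (rule ccontr)
    assume "\<not> ?thesis"
    then have "\<forall>y\<in>L2. norm_L2 (\<lambda>t. y t - x t) \<le> r \<longrightarrow>
           (\<forall>\<eta>>0. \<exists>z\<in>A m \<inter> L2. norm_L2 (\<lambda>t. y t - z t) < \<eta>)"
    proof (intro ballI impI allI)
      fix y and \<eta> :: real
      assume y: "y \<in> L2" "norm_L2 (\<lambda>t. y t - x t) \<le> r" "\<eta> > 0"
      show "\<exists>z\<in>A m \<inter> L2. norm_L2 (\<lambda>t. y t - z t) < \<eta>"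
      proof (rule ccontr)
        assume "\<not> ?thesis"
        then have "\<forall>z\<in>A m \<inter> L2. norm_L2 (\<lambda>t. y t - z t) \<ge> \<eta>" by (auto simp: not_less)
        with y \<open>\<not> (\<exists>y\<in>L2. _ y)\<close> show False by blast
      qed
    qed
    with neg that show False by blast
  qed
  define P where "P = (\<lambda>(n::nat) (s :: (real \<Rightarrow> complex) \<times> real). fst s \<in> L2 \<and> snd s > 0 \<and> snd s \<le> (1/2)^n)"
  define Q where "Q = (\<lambda>n (s :: (real \<Rightarrow> complex) \<times> real) (s' :: (real \<Rightarrow> complex) \<times> real).
     norm_L2 (\<lambda>t. fst s' t - fst s t) \<le> snd s / 2 \<and> snd s' \<le> snd s / 2 \<and>
     (\<forall>z\<in>A n \<inter> L2. norm_L2 (\<lambda>t. fst s' t - z t) > snd s'))"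
  have "\<exists>s. \<forall>n. P n (s n) \<and> Q n (s n) (s (Suc n))"
  proof (rule dependent_nat_choice)
    show "\<exists>s. P 0 s" unfolding P_def by (intro exI[of _ "(\<lambda>t. 0, 1)"]) simp
    fix s n assume s: "P n s"
    then have "fst s \<in> L2" "snd s / 2 > 0" by (auto simp: P_def)
    from gap[OF this, of n] obtain y \<eta> where y: "y \<in> L2" "norm_L2 (\<lambda>t. y t - fst s t) \<le> snd s / 2"
      "\<eta> > 0" "\<And>z. z \<in> A n \<inter> L2 \<Longrightarrow> norm_L2 (\<lambda>t. y t - z t) \<ge> \<eta>"
      by blast
    \<comment> \<open>Halving \<open>\<eta>\<close> keeps \<open>A n\<close> at more than the new radius from the new centre.\<close>
    show "\<exists>s'. P (Suc n) s' \<and> Q n s s'"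
    proof (intro exI[of _ "(y, min (snd s / 2) (\<eta> / 2))"] conjI)
      show "P (Suc n) (y, min (snd s / 2) (\<eta> / 2))" using s y by (auto simp: P_def)
      have "min (snd s / 2) (\<eta> / 2) < norm_L2 (\<lambda>t. y t - z t)" if "z \<in> A n \<inter> L2" for z
        using y(3) y(4)[OF that] by linarith
      then show "Q n s (y, min (snd s / 2) (\<eta> / 2))" using y by (auto simp: Q_def)
    qed
  qed
  then obtain s where s: "\<And>n. P n (s n)" "\<And>n. Q n (s n) (s (Suc n))" by blast
  define x r where "x = (\<lambda>n. fst (s n))" and "r = (\<lambda>n. snd (s n))"
  have x_L2: "x n \<in> L2" and r_pos: "r n > 0" and r_le: "r n \<le> (1/2)^n" for n
    using s(1)[of n] by (auto simp: P_def x_def r_def)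
  have step: "norm_L2 (\<lambda>t. x (Suc n) t - x n t) \<le> r n / 2" "r (Suc n) \<le> r n / 2"
    "\<And>z. z \<in> A n \<inter> L2 \<Longrightarrow> norm_L2 (\<lambda>t. x (Suc n) t - z t) > r (Suc n)" for n
    using s(2)[of n] by (auto simp: Q_def x_def r_def)
  have tail: "norm_L2 (\<lambda>t. x (i + k) t - x i t) \<le> r i - r (i + k)" for i k
  proof (induction k)
    case (Suc k)
    have "norm_L2 (\<lambda>t. x (i + Suc k) t - x i t)
        \<le> norm_L2 (\<lambda>t. x (Suc (i + k)) t - x (i + k) t) + norm_L2 (\<lambda>t. x (i + k) t - x i t)"
      using norm_L2_triangle_mid[OF x_L2[of "Suc (i + k)"] x_L2[of "i + k"] x_L2[of i]] by simp
    also have "\<dots> \<le> r (i + k) / 2 + (r i - r (i + k))" using Suc step(1)[of "i + k"] by simp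
    also have "\<dots> \<le> r i - r (i + Suc k)" using step(2)[of "i + k"] by simp
    finally show ?case .
  qed simp
  have tail': "norm_L2 (\<lambda>t. x j t - x i t) \<le> r i" if "i \<le> j" for i j
    using tail[of i "j - i"] r_pos[of j] that by simp
  have "\<exists>g\<in>L2. (\<lambda>n. norm_L2 (\<lambda>t. g t - x n t)) \<longlonglongrightarrow> 0"
  proof (rule L2_complete[OF x_L2])
    fix \<epsilon> :: real assume "\<epsilon> > 0"
    then obtain N where N: "(1/2)^N < \<epsilon> / 2" using real_arch_pow_inv[of "\<epsilon>/2" "1/2"] by auto
    have "norm_L2 (\<lambda>t. x m t - x n t) < \<epsilon>" if "m \<ge> N" "n \<ge> N" for m n
    proof -
      have "norm_L2 (\<lambda>t. x m t - x n t) \<le> norm_L2 (\<lambda>t. x m t - x N t) + norm_L2 (\<lambda>t. x N t - x n t)"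
        by (rule norm_L2_triangle_mid[OF x_L2 x_L2 x_L2])
      also have "\<dots> \<le> r N + r N"
        using tail'[OF that(1)] tail'[OF that(2)] by (subst norm_L2_minus_commute[of "x N"]) simp
      also have "\<dots> < \<epsilon>" using N r_le[of N] by simp
      finally show ?thesis .
    qed
    then show "\<exists>N. \<forall>m\<ge>N. \<forall>n\<ge>N. norm_L2 (\<lambda>t. x m t - x n t) < \<epsilon>" by blast
  qed
  then obtain g where g: "g \<in> L2" "(\<lambda>n. norm_L2 (\<lambda>t. g t - x n t)) \<longlonglongrightarrow> 0" by blast
  have close: "norm_L2 (\<lambda>t. x i t - g t) \<le> r i" for i
  proof -
    have "norm_L2 (\<lambda>t. x i t - g t) \<le> r i + norm_L2 (\<lambda>t. g t - x n t)" if "n \<ge> i" for n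
      using norm_L2_triangle_mid[OF x_L2[of i] x_L2[of n] g(1)] tail'[OF that]
      by (simp add: norm_L2_minus_commute[of "x i"] norm_L2_minus_commute[of "x n" g])
    moreover have "(\<lambda>n. r i + norm_L2 (\<lambda>t. g t - x n t)) \<longlonglongrightarrow> r i + 0"
      by (intro tendsto_intros g)
    ultimately show ?thesis by (metis (no_types, lifting) LIMSEQ_le_const add.right_neutral)
  qed
  obtain m where "g \<in> A m" using cover[OF g(1)] by blast
  then have "norm_L2 (\<lambda>t. x (Suc m) t - g t) > r (Suc m)" using step(3) g(1) by blast
  with close[of "Suc m"] show False by simp
qed

locale normalized_schauder_basis =
  fixes e :: "nat \<Rightarrow> real \<Rightarrow> complex"
  assumes basis: "schauder_basis_L2 e" and norm_e [simp]: "\<And>n. norm_L2 (e n) = 1"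
begin

definition coef :: "(real \<Rightarrow> complex) \<Rightarrow> nat \<Rightarrow> complex" where
  "coef f = (THE c. (\<lambda>N. norm_L2 (\<lambda>t. f t - (\<Sum>n<N. c n * e n t))) \<longlonglongrightarrow> 0)"

definition partial_sum :: "nat \<Rightarrow> (real \<Rightarrow> complex) \<Rightarrow> real \<Rightarrow> complex" where
  "partial_sum N f t = (\<Sum>n<N. coef f n * e n t)"

lemma e_L2 [simp]: "e n \<in> L2"
  using basis by (auto simp: schauder_basis_L2_def)

lemma combination_L2 [simp]: "(\<lambda>t. \<Sum>n<N. a n * e n t) \<in> L2"
  by (intro L2_sum L2_cmult e_L2)

lemma partial_sum_L2 [simp]: "partial_sum N f \<in> L2"
  unfolding partial_sum_def[abs_def] by simp

lemma norm_combination_le: "norm_L2 (\<lambda>t. \<Sum>n<N. a n * e n t) \<le> (\<Sum>n<N. cmod (a n))"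
  using norm_L2_sum_le[of "{..<N}" "\<lambda>n t. a n * e n t"] by (simp add: L2_cmult norm_L2_cmult)

lemma ex1_coef:
  assumes "f \<in> L2"
  shows "\<exists>!c. (\<lambda>N. norm_L2 (\<lambda>t. f t - (\<Sum>n<N. c n * e n t))) \<longlonglongrightarrow> 0"
  using assms basis unfolding schauder_basis_L2_def by blast

lemma partial_sum_tendsto:
  assumes "f \<in> L2"
  shows "(\<lambda>N. norm_L2 (\<lambda>t. f t - partial_sum N f t)) \<longlonglongrightarrow> 0"
  using theI'[OF ex1_coef[OF assms]] unfolding coef_def[symmetric] partial_sum_def .

lemma coef_eqI:
  assumes "f \<in> L2" "(\<lambda>N. norm_L2 (\<lambda>t. f t - (\<Sum>n<N. c n * e n t))) \<longlonglongrightarrow> 0"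
  shows "coef f = c"
  unfolding coef_def by (rule the1_equality[OF ex1_coef]) (fact assms)+

text \<open>
  Linearity is a consequence of the uniqueness of the expansion: the combined coefficients do
  expand the combined function.
\<close>

lemma coef_linear:
  assumes "f \<in> L2" "g \<in> L2"
  shows "coef (\<lambda>t. a * f t + b * g t) = (\<lambda>n. a * coef f n + b * coef g n)"
proof (rule coef_eqI)
  show "(\<lambda>t. a * f t + b * g t) \<in> L2" using assms by auto
  let ?D = "\<lambda>f N t. f t - partial_sum N f t"
  have D: "?D f N \<in> L2" if "f \<in> L2" for f N using that by (rule L2_diff) simp
  have "norm_L2 (\<lambda>t. (a * f t + b * g t) - (\<Sum>n<N. (a * coef f n + b * coef g n) * e n t))
      \<le> cmod a * norm_L2 (?D f N) + cmod b * norm_L2 (?D g N)" for N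
  proof -
    have "(\<lambda>t. (a * f t + b * g t) - (\<Sum>n<N. (a * coef f n + b * coef g n) * e n t))
        = (\<lambda>t. a * ?D f N t + b * ?D g N t)"
      by (simp add: partial_sum_def algebra_simps sum.distrib sum_distrib_left)
    then show ?thesis
      using norm_L2_triangle[OF L2_cmult[OF D[OF assms(1)]] L2_cmult[OF D[OF assms(2)]], of a N b N]
      by (simp add: norm_L2_cmult)
  qed
  then have "\<forall>\<^sub>F N in sequentially. norm (norm_L2 (\<lambda>t. (a * f t + b * g t) -
      (\<Sum>n<N. (a * coef f n + b * coef g n) * e n t))) \<le> cmod a * norm_L2 (?D f N) + cmod b * norm_L2 (?D g N)"
    by simp
  moreover have "(\<lambda>N. cmod a * norm_L2 (?D f N) + cmod b * norm_L2 (?D g N)) \<longlonglongrightarrow> 0"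
    by (intro tendsto_add_zero tendsto_mult_right_zero partial_sum_tendsto assms)
  ultimately show "(\<lambda>N. norm_L2 (\<lambda>t. (a * f t + b * g t) -
      (\<Sum>n<N. (a * coef f n + b * coef g n) * e n t))) \<longlonglongrightarrow> 0"
    by (rule Lim_null_comparison)
qed

lemma coef_add: "f \<in> L2 \<Longrightarrow> g \<in> L2 \<Longrightarrow> coef (\<lambda>t. f t + g t) n = coef f n + coef g n"
  using coef_linear[of f g 1 1] by simp

lemma coef_diff: "f \<in> L2 \<Longrightarrow> g \<in> L2 \<Longrightarrow> coef (\<lambda>t. f t - g t) n = coef f n - coef g n"
  using coef_linear[of f g 1 "-1"] by simp

lemma coef_cmult: "f \<in> L2 \<Longrightarrow> coef (\<lambda>t. a * f t) n = a * coef f n"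
  using coef_linear[of f f a 0] by simp

lemma coef_sum:
  assumes "finite I" "\<And>i. i \<in> I \<Longrightarrow> f i \<in> L2"
  shows "coef (\<lambda>t. \<Sum>i\<in>I. f i t) n = (\<Sum>i\<in>I. coef (f i) n)"
  using assms
proof (induction I rule: finite_induct)
  case empty
  show ?case using coef_cmult[OF L2_zero, of 0] by simp
next
  case (insert i I)
  then show ?case using coef_add[of "f i" "\<lambda>t. \<Sum>i\<in>I. f i t" n] L2_sum[of I f] by simp
qed

lemma coef_combination:
  "coef (\<lambda>t. \<Sum>n<N. a n * e n t) = (\<lambda>m. if m < N then a m else 0)" (is "_ = ?c")
proof (rule coef_eqI)
  have "norm_L2 (\<lambda>t. (\<Sum>n<N. a n * e n t) - (\<Sum>n<M. ?c n * e n t)) = 0" if "M \<ge> N" for M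
  proof -
    have "(\<Sum>n<M. ?c n * e n t) = (\<Sum>n<N. a n * e n t)" for t
      using that by (intro sum.mono_neutral_cong_right) auto
    then show ?thesis by simp
  qed
  then have "\<forall>\<^sub>F M in sequentially. norm_L2 (\<lambda>t. (\<Sum>n<N. a n * e n t) - (\<Sum>n<M. ?c n * e n t)) = 0"
    unfolding eventually_sequentially by blast
  then show "(\<lambda>M. norm_L2 (\<lambda>t. (\<Sum>n<N. a n * e n t) - (\<Sum>n<M. ?c n * e n t))) \<longlonglongrightarrow> 0"
    by (rule tendsto_eventually)
qed simp

lemma coef_partial_sum: "coef (partial_sum N f) m = (if m < N then coef f m else 0)"
  using coef_combination[where N=N and a="coef f"] by (simp add: partial_sum_def[abs_def])

lemma coef_e: "coef (e n) n = 1"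
proof -
  have "(\<lambda>t. \<Sum>m<Suc n. (if m = n then 1 else 0) * e m t) = e n" by (simp add: if_distrib cong: if_cong)
  then show ?thesis using coef_combination[where N="Suc n" and a="\<lambda>m. if m = n then 1 else 0"] by simp
qed

lemma partial_sum_diff:
  assumes "f \<in> L2" "g \<in> L2"
  shows "partial_sum N (\<lambda>t. f t - g t) = (\<lambda>t. partial_sum N f t - partial_sum N g t)"
  by (simp add: partial_sum_def[abs_def] coef_diff[OF assms] left_diff_distrib sum_subtractf)

lemma partial_sum_cmult:
  assumes "f \<in> L2"
  shows "partial_sum N (\<lambda>t. a * f t) = (\<lambda>t. a * partial_sum N f t)"
  by (simp add: partial_sum_def[abs_def] coef_cmult[OF assms] sum_distrib_left mult.assoc)

lemma norm_partial_sum_tendsto: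
  assumes "f \<in> L2"
  shows "(\<lambda>N. norm_L2 (partial_sum N f)) \<longlonglongrightarrow> norm_L2 f"
proof -
  have "\<bar>norm_L2 (partial_sum N f) - norm_L2 f\<bar> \<le> norm_L2 (\<lambda>t. f t - partial_sum N f t)" for N
    using norm_L2_reverse_triangle[OF partial_sum_L2 assms]
    by (simp add: norm_L2_minus_commute[of f])
  then have "(\<lambda>N. norm_L2 (partial_sum N f) - norm_L2 f) \<longlonglongrightarrow> 0"
    by (intro Lim_null_comparison[OF _ partial_sum_tendsto[OF assms]]) auto
  then show ?thesis by (simp add: LIM_zero_iff)
qed

text \<open>
  Consecutive partial sums differ by \<open>coef f n * e n\<close>, and \<open>e n\<close> is a unit vector.
\<close>

lemma cmod_coef_le:
  assumes "f \<in> L2" "\<And>N. norm_L2 (partial_sum N f) \<le> B"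
  shows "cmod (coef f n) \<le> 2 * B"
proof -
  have "cmod (coef f n) = norm_L2 (\<lambda>t. partial_sum (Suc n) f t - partial_sum n f t)"
    by (simp add: partial_sum_def norm_L2_cmult)
  also have "\<dots> \<le> norm_L2 (partial_sum (Suc n) f) + norm_L2 (partial_sum n f)"
    by (rule norm_L2_triangle_sub) simp_all
  also have "\<dots> \<le> 2 * B" using assms(2)[of "Suc n"] assms(2)[of n] by simp
  finally show ?thesis .
qed

text \<open>
  Every \<open>f\<close> has bounded partial sums, so by Baire's theorem the functions whose partial
  sums are bounded by some fixed \<open>m\<close> are dense in a ball. Subtracting an approximation of its
  centre moves the ball to the origin, and scaling covers all radii.
\<close>

lemma dense_bounded_partial_sums:
  "\<exists>C\<ge>0. \<forall>\<rho>>0. \<forall>y\<in>L2. norm_L2 y \<le> \<rho> \<longrightarrow> (\<forall>\<eta>>0. \<exists>z\<in>L2.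
     (\<forall>N. norm_L2 (partial_sum N z) \<le> C * \<rho>) \<and> norm_L2 (\<lambda>t. y t - z t) < \<eta>)"
proof -
  define A where "A = (\<lambda>m::nat. {f. \<forall>N. norm_L2 (partial_sum N f) \<le> real m})"
  have "\<exists>m. f \<in> A m" if "f \<in> L2" for f
  proof -
    have "Bseq (\<lambda>N. norm_L2 (partial_sum N f))"
      using norm_partial_sum_tendsto[OF that] by (intro convergent_imp_Bseq convergentI)
    then obtain B where "\<And>N. norm_L2 (partial_sum N f) \<le> B"
      by (auto simp: Bseq_def)
    moreover obtain m where "B \<le> real m" using real_arch_simple by blast
    ultimately show ?thesis unfolding A_def by (blast intro: order_trans)
  qed
  from L2_Baire[of A, OF this] obtain m x r where mxr: "x \<in> L2" "r > 0"
    "\<And>y \<eta>. y \<in> L2 \<Longrightarrow> norm_L2 (\<lambda>t. y t - x t) \<le> r \<Longrightarrow> \<eta> > 0 \<Longrightarrow>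
      \<exists>z\<in>A m \<inter> L2. norm_L2 (\<lambda>t. y t - z t) < \<eta>" by blast
  show ?thesis
  proof (intro exI[of _ "2 * real m / r"] conjI allI impI ballI)
    fix \<rho> \<eta> :: real and y assume *: "\<rho> > 0" "y \<in> L2" "norm_L2 y \<le> \<rho>" "\<eta> > 0"
    define c where "c = \<rho> / r"
    have "c > 0" using * mxr by (simp add: c_def)
    define y' where "y' = (\<lambda>t. x t + complex_of_real (1 / c) * y t)"
    have y': "y' \<in> L2" unfolding y'_def using mxr * by (intro L2_add L2_cmult)
    have "norm_L2 (\<lambda>t. y' t - x t) \<le> r"
    proof -
      have "norm_L2 (\<lambda>t. y' t - x t) = cmod (complex_of_real (1 / c)) * norm_L2 y"
        unfolding y'_def by (simp only: add_diff_cancel_left' norm_L2_cmult)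
      also have "\<dots> = norm_L2 y / c" using \<open>c > 0\<close> by (simp only: norm_of_real) simp
      also have "\<dots> \<le> \<rho> / c" using * \<open>c > 0\<close> by (intro divide_right_mono) auto
      also have "\<dots> = r" using * by (simp add: c_def)
      finally show ?thesis .
    qed
    from mxr(3)[OF y' this, of "\<eta> / c / 2"] obtain z1 where
      z1: "z1 \<in> A m" "z1 \<in> L2" "norm_L2 (\<lambda>t. y' t - z1 t) < \<eta> / c / 2" using * \<open>c > 0\<close> by auto
    have "norm_L2 (\<lambda>t. x t - x t) \<le> r" using mxr by simp
    from mxr(3)[OF mxr(1) this] obtain z2 where
      z2: "z2 \<in> A m" "z2 \<in> L2" "norm_L2 (\<lambda>t. x t - z2 t) < \<eta> / c / 2"
      using * \<open>c > 0\<close> by (metis IntE divide_pos_pos zero_less_numeral)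
    define z where "z = (\<lambda>t. complex_of_real c * (z1 t - z2 t))"
    show "\<exists>z\<in>L2. (\<forall>N. norm_L2 (partial_sum N z) \<le> 2 * real m / r * \<rho>) \<and> norm_L2 (\<lambda>t. y t - z t) < \<eta>"
    proof (intro bexI[of _ z] conjI allI)
      show "z \<in> L2" unfolding z_def using z1 z2 by auto
      fix N
      have "partial_sum N z = (\<lambda>t. complex_of_real c * (partial_sum N z1 t - partial_sum N z2 t))"
        using z1 z2 unfolding z_def
        by (subst partial_sum_cmult) (auto simp: partial_sum_diff)
      then have "norm_L2 (partial_sum N z) = c * norm_L2 (\<lambda>t. partial_sum N z1 t - partial_sum N z2 t)"
        using \<open>c > 0\<close> by (simp add: norm_L2_cmult)
      also have "\<dots> \<le> c * (norm_L2 (partial_sum N z1) + norm_L2 (partial_sum N z2))"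
        using \<open>c > 0\<close> by (intro mult_left_mono norm_L2_triangle_sub) simp_all
      also have "\<dots> \<le> c * (real m + real m)"
        using z1 z2 \<open>c > 0\<close> by (intro mult_left_mono add_mono) (auto simp: A_def)
      finally show "norm_L2 (partial_sum N z) \<le> 2 * real m / r * \<rho>" by (simp add: c_def mult_ac)
      have d1: "(\<lambda>t. y' t - z1 t) \<in> L2" using y' z1 by auto
      have d2: "(\<lambda>t. x t - z2 t) \<in> L2" using mxr z2 by auto
      have "(\<lambda>t. y t - z t) = (\<lambda>t. complex_of_real c * ((y' t - z1 t) - (x t - z2 t)))"
        using \<open>c > 0\<close> by (auto simp: y'_def z_def algebra_simps)
      then have "norm_L2 (\<lambda>t. y t - z t) = c * norm_L2 (\<lambda>t. (y' t - z1 t) - (x t - z2 t))"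
        using \<open>c > 0\<close> by (simp add: norm_L2_cmult)
      also have "\<dots> \<le> c * (norm_L2 (\<lambda>t. y' t - z1 t) + norm_L2 (\<lambda>t. x t - z2 t))"
        using \<open>c > 0\<close> by (intro mult_left_mono norm_L2_triangle_sub d1 d2) simp
      also have "\<dots> < c * (\<eta> / c / 2 + \<eta> / c / 2)"
        using \<open>c > 0\<close> z1 z2 by (intro mult_strict_left_mono add_strict_mono)
      finally show "norm_L2 (\<lambda>t. y t - z t) < \<eta>" using \<open>c > 0\<close> by simp
    qed
  qed (use mxr in auto)
qed

text \<open>
  The partial sum operators are uniformly bounded; as they are not known to be continuous, the
  proof is the successive approximation of the open mapping theorem. Correcting the
  error \<open>y i\<close> of size \<open>\<rho> / 2 ^ i\<close> by an element with partial sums of size \<open>C * \<rho> / 2 ^ i\<close>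
  produces the next error \<open>y (i + 1)\<close>. The coefficients of \<open>y i\<close> converge to some \<open>l n\<close>, uniformly
  enough to make \<open>\<Sum>n. l n * e n\<close> an expansion of \<open>0\<close>. By uniqueness \<open>l = 0\<close>, so the partial sums
  of \<open>f = y 0\<close> are exhausted by those of the corrections.
\<close>

theorem basis_constant: "\<exists>K\<ge>1. \<forall>f\<in>L2. \<forall>N. norm_L2 (partial_sum N f) \<le> K * norm_L2 f"
proof -
  obtain C where C: "C \<ge> 0" "\<And>\<rho> y \<eta>. \<rho> > 0 \<Longrightarrow> y \<in> L2 \<Longrightarrow> norm_L2 y \<le> \<rho> \<Longrightarrow> \<eta> > 0 \<Longrightarrow> \<exists>z\<in>L2.
     (\<forall>N. norm_L2 (partial_sum N z) \<le> C * \<rho>) \<and> norm_L2 (\<lambda>t. y t - z t) < \<eta>"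
    using dense_bounded_partial_sums by blast
  have main: "norm_L2 (partial_sum N f) \<le> 2 * C * \<rho>" if f: "f \<in> L2" "norm_L2 f \<le> \<rho>" "\<rho> > 0" for f \<rho> N
  proof -
    define P where "P = (\<lambda>(i::nat) y. y \<in> L2 \<and> norm_L2 y \<le> \<rho> / 2^i \<and> (i = 0 \<longrightarrow> y = f))"
    define Q where "Q = (\<lambda>(i::nat) y y'. \<forall>N. norm_L2 (partial_sum N (\<lambda>t. y t - y' t :: complex)) \<le> C * (\<rho> / 2^i))"
    have "\<exists>y. \<forall>i. P i (y i) \<and> Q i (y i) (y (Suc i))"
    proof (rule dependent_nat_choice)
      show "\<exists>y. P 0 y" using f by (auto simp: P_def)
      fix y i assume "P i y"
      then have y: "y \<in> L2" "norm_L2 y \<le> \<rho> / 2^i" by (auto simp: P_def)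
      from C(2)[OF _ y, of "\<rho> / 2^Suc i"] obtain z where z: "z \<in> L2"
        "\<And>N. norm_L2 (partial_sum N z) \<le> C * (\<rho> / 2^i)" "norm_L2 (\<lambda>t. y t - z t) < \<rho> / 2^Suc i"
        using \<open>\<rho> > 0\<close> by auto
      show "\<exists>y'. P (Suc i) y' \<and> Q i y y'"
        using y z by (intro exI[of _ "\<lambda>t. y t - z t"]) (auto simp: P_def Q_def)
    qed
    then obtain y where y: "\<And>i. P i (y i)" "\<And>i. Q i (y i) (y (Suc i))" by blast
    have y_L2 [simp]: "y i \<in> L2" and y_norm: "norm_L2 (y i) \<le> \<rho> / 2^i" and y0: "y 0 = f" for i
      using y(1)[of i] y(1)[of 0] by (auto simp: P_def)
    have incr: "norm_L2 (\<lambda>t. partial_sum N (y i) t - partial_sum N (y (Suc i)) t) \<le> C * (\<rho> / 2^i)" for i N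
      using y(2)[of i] by (simp add: Q_def partial_sum_diff)
    have incr_sum: "norm_L2 (\<lambda>t. partial_sum N (y i) t - partial_sum N (y (i + k)) t)
        \<le> 2 * C * (\<rho> / 2^i) - 2 * C * (\<rho> / 2^(i + k))" for i k N
    proof (induction k)
      case (Suc k)
      have "norm_L2 (\<lambda>t. partial_sum N (y i) t - partial_sum N (y (i + Suc k)) t)
        \<le> norm_L2 (\<lambda>t. partial_sum N (y i) t - partial_sum N (y (i + k)) t)
          + norm_L2 (\<lambda>t. partial_sum N (y (i + k)) t - partial_sum N (y (i + Suc k)) t)"
        by (rule norm_L2_triangle_mid) simp_all
      also have "\<dots> \<le> (2 * C * (\<rho> / 2^i) - 2 * C * (\<rho> / 2^(i + k))) + C * (\<rho> / 2^(i + k))"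
        using Suc incr[of N "i + k"] by simp
      also have "\<dots> = 2 * C * (\<rho> / 2^i) - 2 * C * (\<rho> / 2^(i + Suc k))"
        by (simp add: field_simps)
      finally show ?case .
    qed simp
    have incr_le: "norm_L2 (\<lambda>t. partial_sum N (y i) t - partial_sum N (y (i + k)) t) \<le> 2 * C * (\<rho> / 2^i)" for i k N
    proof -
      have "0 \<le> 2 * C * (\<rho> / 2^(i + k))" using C(1) \<open>\<rho> > 0\<close> by simp
      then show ?thesis using incr_sum[of N i k] by linarith
    qed
    \<comment> \<open>The increments of the coefficients are bounded by a geometric series.\<close>
    have "\<exists>l. (\<lambda>i. coef (y i) n) \<longlonglongrightarrow> l" for n
    proof -
      have le: "cmod (coef (y i) n - coef (y (Suc i)) n) \<le> 2 * (C * (\<rho> / 2^i))" for i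
        using cmod_coef_le[of "\<lambda>t. y i t - y (Suc i) t" "C * (\<rho> / 2^i)" n] y(2)[of i]
          L2_diff[OF y_L2[of i] y_L2[of "Suc i"]]
        by (auto simp: Q_def coef_diff)
      have "summable (\<lambda>i. 2 * C * \<rho> * (1/2)^i)" by (intro summable_mult summable_geometric) simp
      then have "summable (\<lambda>i. coef (y i) n - coef (y (Suc i)) n)"
      proof (rule summable_comparison_test')
        show "norm (coef (y i) n - coef (y (Suc i)) n) \<le> 2 * C * \<rho> * (1/2)^i" for i
        proof -
          have "2 * (C * (\<rho> / 2^i)) = 2 * C * \<rho> * (1/2)^i" by (simp add: power_one_over)
          then show ?thesis using le[of i] by (simp only:)
        qed
      qed
      then have "convergent (\<lambda>k. \<Sum>i<k. coef (y i) n - coef (y (Suc i)) n)"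
        by (simp add: summable_iff_convergent)
      then have "convergent (\<lambda>k. coef (y 0) n - coef (y k) n)"
        by (simp add: sum_lessThan_telescope'[of "\<lambda>i. coef (y i) n"])
      then obtain l where "(\<lambda>k. coef (y 0) n - coef (y k) n) \<longlonglongrightarrow> l" by (auto simp: convergent_def)
      from tendsto_diff[OF tendsto_const[of "coef (y 0) n"] this] show ?thesis by auto
    qed
    then obtain l where l: "\<And>n. (\<lambda>i. coef (y i) n) \<longlonglongrightarrow> l n" by metis
    define R where "R = (\<lambda>N t. \<Sum>n<N. l n * e n t)"
    have R_L2 [simp]: "R N \<in> L2" for N by (simp add: R_def)
    have lim: "(\<lambda>i. norm_L2 (\<lambda>t. partial_sum N (y i) t - R N t)) \<longlonglongrightarrow> 0" for N
    proof (rule Lim_null_comparison)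
      have "(\<lambda>t. partial_sum N (y i) t - R N t) = (\<lambda>t. \<Sum>n<N. (coef (y i) n - l n) * e n t)" for i
        by (simp add: partial_sum_def R_def sum_subtractf left_diff_distrib)
      then show "\<forall>\<^sub>F i in sequentially. norm (norm_L2 (\<lambda>t. partial_sum N (y i) t - R N t))
          \<le> (\<Sum>n<N. cmod (coef (y i) n - l n))"
        using norm_combination_le by simp
      show "(\<lambda>i. \<Sum>n<N. cmod (coef (y i) n - l n)) \<longlonglongrightarrow> 0"
        using l by (intro tendsto_null_sum tendsto_norm_zero) (simp add: LIM_zero_iff)
    qed
    have yR: "norm_L2 (\<lambda>t. partial_sum N (y i) t - R N t) \<le> 2 * C * (\<rho> / 2^i)" for N i
    proof -
      have "norm_L2 (\<lambda>t. partial_sum N (y i) t - R N t)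
        \<le> 2 * C * (\<rho> / 2^i) + norm_L2 (\<lambda>t. partial_sum N (y (k + i)) t - R N t)" for k
        using norm_L2_triangle_mid[OF partial_sum_L2[of N "y i"] partial_sum_L2[of N "y (k + i)"] R_L2[of N]]
          incr_le[of N i k] by (simp add: add.commute)
      moreover have "(\<lambda>k. 2 * C * (\<rho> / 2^i) + norm_L2 (\<lambda>t. partial_sum N (y (k + i)) t - R N t)) \<longlonglongrightarrow> 2 * C * (\<rho> / 2^i) + 0"
        using LIMSEQ_ignore_initial_segment[OF lim, of N i] by (intro tendsto_add tendsto_const)
      ultimately show ?thesis
        by (intro LIMSEQ_le_const[where X = "\<lambda>k. 2 * C * (\<rho> / 2^i) + norm_L2 (\<lambda>t. partial_sum N (y (k + i)) t - R N t)"]) auto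
    qed
    have "(\<lambda>N. norm_L2 (R N)) \<longlonglongrightarrow> 0"
    proof (rule LIMSEQ_I)
      fix \<epsilon> :: real assume "\<epsilon> > 0"
      have pos: "(2 * C + 1) * \<rho> > 0" using C \<open>\<rho> > 0\<close> by simp
      obtain i where i: "(1/2)^i < \<epsilon> / 2 / ((2 * C + 1) * \<rho>)"
        using real_arch_pow_inv[of "\<epsilon> / 2 / ((2 * C + 1) * \<rho>)" "1/2"] \<open>\<epsilon> > 0\<close> pos by auto
      have i': "2 * C * (\<rho> / 2^i) + \<rho> / 2^i < \<epsilon> / 2"
        using i unfolding pos_less_divide_eq[OF pos] by (simp add: power_one_over field_simps)
      obtain M where M: "\<And>N. N \<ge> M \<Longrightarrow> \<bar>norm_L2 (partial_sum N (y i)) - norm_L2 (y i)\<bar> < \<epsilon> / 2"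
        using LIMSEQ_D[OF norm_partial_sum_tendsto[OF y_L2], of "\<epsilon>/2" i] \<open>\<epsilon> > 0\<close> by auto
      have "norm_L2 (R N) < \<epsilon>" if "N \<ge> M" for N
      proof -
        have "norm_L2 (R N) \<le> norm_L2 (partial_sum N (y i)) + norm_L2 (\<lambda>t. partial_sum N (y i) t - R N t)"
          using norm_L2_reverse_triangle[OF partial_sum_L2[of N "y i"] R_L2[of N]] by simp
        then show ?thesis using yR[of N i] M[OF that] y_norm[of i] i' by linarith
      qed
      then show "\<exists>M. \<forall>N\<ge>M. norm (norm_L2 (R N) - 0) < \<epsilon>" by auto
    qed
    then have "coef (\<lambda>t. 0) = l"
      by (intro coef_eqI L2_zero) (subst norm_L2_minus_commute, simp add: R_def)
    moreover have "coef (\<lambda>t. 0) = (\<lambda>n. 0)"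
      using coef_combination[where N=0] by simp
    ultimately have "R N = (\<lambda>t. 0)" by (auto simp: R_def)
    then show ?thesis using yR[of N 0] y0 by simp
  qed
  have "norm_L2 (partial_sum N f) \<le> 2 * C * norm_L2 f" if f: "f \<in> L2" for f N
  proof (cases "norm_L2 f = 0")
    case True
    have "norm_L2 (partial_sum N f) \<le> 2 * C * \<rho>" if "\<rho> > 0" for \<rho> using main[OF f _ that] that True by simp
    then have "norm_L2 (partial_sum N f) \<le> 0 + \<epsilon>" if "\<epsilon> > 0" for \<epsilon>
    proof -
      have "2 * C * (\<epsilon> / (2 * C + 1)) \<le> \<epsilon>" using C(1) that by (simp add: field_simps)
      moreover have "\<epsilon> / (2 * C + 1) > 0" using C(1) that by simp
      ultimately show ?thesis
        using \<open>\<And>\<rho>. \<rho> > 0 \<Longrightarrow> norm_L2 (partial_sum N f) \<le> 2 * C * \<rho>\<close> by (metis add_0 order_trans)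
    qed
    then have "norm_L2 (partial_sum N f) \<le> 0" by (rule field_le_epsilon)
    then show ?thesis using True by simp
  next
    case False
    then show ?thesis using main[OF f order_refl] norm_L2_nonneg[of f] by simp
  qed
  then have "norm_L2 (partial_sum N f) \<le> max 1 (2 * C) * norm_L2 f" if "f \<in> L2" for f N
    using that by (meson max.cobounded2 mult_right_mono norm_L2_nonneg order_trans)
  then show ?thesis by (intro exI[of _ "max 1 (2 * C)"]) auto
qed

lemma split_by_threshold:
  fixes F :: "nat set"
  assumes "finite F" "card F \<le> m + m'"
  shows "\<exists>N. card (F \<inter> {..<N}) \<le> m \<and> card (F \<inter> {N..}) \<le> m'"
proof -
  have split: "card F = card (F \<inter> {..<N}) + card (F \<inter> {N..})" for N
    using assms(1) by (subst card_Un_disjoint[symmetric]) (auto intro!: arg_cong[of _ _ card])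
  show ?thesis
  proof (cases "card F \<le> m")
    case True
    obtain N where "F \<subseteq> {..<N}" using assms(1) finite_nat_iff_bounded by blast
    then have "F \<inter> {N..} = {}" by auto
    then show ?thesis using True split[of N] by (intro exI[of _ N]) auto
  next
    case False
    obtain N where "F \<subseteq> {..<N}" using assms(1) finite_nat_iff_bounded by blast
    then have ex: "card (F \<inter> {..<N}) > m" using False by (simp add: Int_absorb2)
    define L where "L = (LEAST N. card (F \<inter> {..<N}) > m)"
    have L: "card (F \<inter> {..<L}) > m" unfolding L_def using ex by (rule LeastI)
    then obtain L' where L': "L = Suc L'" by (cases L) auto
    have "\<not> card (F \<inter> {..<L'}) > m" using not_less_Least[of L' "\<lambda>N. card (F \<inter> {..<N}) > m"] L'
      by (simp add: L_def)
    moreover have "card (F \<inter> {..<L}) \<le> Suc (card (F \<inter> {..<L'}))"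
    proof -
      have "card (F \<inter> {..<L}) \<le> card (insert L' (F \<inter> {..<L'}))"
        using assms(1) L' by (intro card_mono) auto
      also have "\<dots> \<le> Suc (card (F \<inter> {..<L'}))" by (rule card_insert_le_m1) simp_all
      finally show ?thesis .
    qed
    ultimately show ?thesis using L assms(2) split[of L'] by (intro exI[of _ L']) linarith
  qed
qed

text \<open>
  The trivial bound has \<open>r = 2\<close>. The gain comes from splitting \<open>F\<close> into two halves, one before and one
  after an index \<open>N\<close>. With \<open>u\<close> the \<open>N\<close>-th partial sum of \<open>f\<close> and \<open>v = f - u\<close>,
  the functions \<open>f - \<delta> v\<close> and \<open>f - \<delta> u\<close> have the same coefficients as \<open>f\<close> on the first and on the
  second half, respectively. By the expansion of the square,
  \<open>\<parallel>f - \<delta> v\<parallel>\<^sup>2 + \<parallel>f - \<delta> u\<parallel>\<^sup>2 = (2 - 2 \<delta>) \<parallel>f\<parallel>\<^sup>2 + \<delta>\<^sup>2 (\<parallel>u\<parallel>\<^sup>2 + \<parallel>v\<parallel>\<^sup>2)\<close>, and \<open>\<parallel>u\<parallel>\<close>, \<open>\<parallel>v\<parallel>\<close> are at most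
  \<open>K * \<parallel>f\<parallel>\<close>. For small \<open>\<delta> > 0\<close> this is less than \<open>2 \<parallel>f\<parallel>\<^sup>2\<close>, so the two norms add up to less than
  \<open>2 \<parallel>f\<parallel>\<close>, and the estimate follows by induction.
\<close>

theorem sum_cmod_coef_le:
  "\<exists>B>0. \<exists>r. 1 \<le> r \<and> r < 2 \<and> (\<forall>k F. \<forall>f\<in>L2. finite F \<and> card F \<le> 2 ^ k \<longrightarrow>
     (\<Sum>n\<in>F. cmod (coef f n)) \<le> B * r ^ k * norm_L2 f)"
proof -
  obtain K0 where K0: "K0 \<ge> 1" "\<And>f N. f \<in> L2 \<Longrightarrow> norm_L2 (partial_sum N f) \<le> K0 * norm_L2 f"
    using basis_constant by blast
  \<comment> \<open>With the factor 2, \<open>K\<close> bounds the complementary projections as well.\<close>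
  define K where "K = 2 * K0"
  have "K \<ge> 2" using K0 by (simp add: K_def)
  define \<delta> where "\<delta> = 1 / (2 * K\<^sup>2)"
  define r where "r = sqrt (4 - 1 / K\<^sup>2)"
  have "K\<^sup>2 \<ge> 2\<^sup>2" using \<open>K \<ge> 2\<close> by (intro power_mono) auto
  then have K2: "1 / K\<^sup>2 > 0" "1 / K\<^sup>2 \<le> 1" using \<open>K \<ge> 2\<close> by (auto simp: field_simps)
  have r: "1 \<le> r" "r < 2" "r\<^sup>2 = 4 - 1 / K\<^sup>2"
  proof -
    have bd: "1 \<le> 4 - 1 / K\<^sup>2" "4 - 1 / K\<^sup>2 < 4" using K2 by linarith+
    show "1 \<le> r" unfolding r_def using bd(1) by simp
    show "r < 2" unfolding r_def using real_sqrt_less_mono[OF bd(2)] by simp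
    show "r\<^sup>2 = 4 - 1 / K\<^sup>2" unfolding r_def using bd(1) by (subst real_sqrt_pow2) linarith+
  qed
  have est: "(\<Sum>n\<in>F. cmod (coef f n)) \<le> K * r ^ k * norm_L2 f"
    if "finite F" "card F \<le> 2 ^ k" "f \<in> L2" for F f k
    using that
  proof (induction k arbitrary: F f)
    case 0
    have *: "cmod (coef f n) \<le> K * norm_L2 f" for n
      using cmod_coef_le[OF \<open>f \<in> L2\<close> K0(2)[OF \<open>f \<in> L2\<close>], of n] by (simp add: K_def)
    have "card F \<le> 1" using 0 by simp
    then consider "F = {}" | n where "F = {n}"
      using 0(1) by (metis card_1_singletonE card_eq_0_iff le_eq_less_or_eq less_one)
    then show ?case using *  \<open>K \<ge> 2\<close> by cases auto
  next
    case (Suc k)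
    note f = \<open>f \<in> L2\<close>
    obtain N where N: "card (F \<inter> {..<N}) \<le> 2^k" "card (F \<inter> {N..}) \<le> 2^k"
      using split_by_threshold[of F "2^k" "2^k"] Suc.prems by auto
    define u where "u = partial_sum N f"
    define v where "v = (\<lambda>t. f t - u t)"
    have u: "u \<in> L2" by (simp add: u_def)
    have v: "v \<in> L2" unfolding v_def using f u by (rule L2_diff)
    define f1 f2 where "f1 = (\<lambda>t. f t - complex_of_real \<delta> * v t)"
      and "f2 = (\<lambda>t. f t - complex_of_real \<delta> * u t)"
    have f12: "f1 \<in> L2" "f2 \<in> L2" unfolding f1_def f2_def using f u v by (auto intro: L2_diff L2_cmult)
    have "coef v n = 0" if "n < N" for n
      using that unfolding v_def by (simp add: coef_diff f u) (simp add: u_def coef_partial_sum)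
    then have c1: "coef f1 n = coef f n" if "n < N" for n
      using that unfolding f1_def by (simp add: coef_diff coef_cmult L2_cmult f v)
    have "coef u n = 0" if "n \<ge> N" for n
      using that by (simp add: u_def coef_partial_sum)
    then have c2: "coef f2 n = coef f n" if "n \<ge> N" for n
      using that unfolding f2_def by (simp add: coef_diff coef_cmult L2_cmult f u)
    have nu: "norm_L2 u \<le> K * norm_L2 f" 
    proof -
      have "0 \<le> K0 * norm_L2 f" using K0(1) by simp
      then show ?thesis using K0(2)[OF f, of N] by (simp add: u_def K_def)
    qed
    have "norm_L2 v \<le> norm_L2 f + norm_L2 u" unfolding v_def by (rule norm_L2_triangle_sub[OF f u])
    also have "\<dots> \<le> norm_L2 f + K0 * norm_L2 f" using K0(2)[OF f, of N] by (simp add: u_def)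
    also have "\<dots> \<le> K * norm_L2 f"
      using mult_right_mono[OF K0(1) norm_L2_nonneg, of f] by (simp add: K_def)
    finally have nv: "norm_L2 v \<le> K * norm_L2 f" .
    have pw: "(cmod (f1 t))\<^sup>2 + (cmod (f2 t))\<^sup>2
        = (2 - 2 * \<delta>) * (cmod (f t))\<^sup>2 + \<delta>\<^sup>2 * ((cmod (u t))\<^sup>2 + (cmod (v t))\<^sup>2)" for t
      unfolding f1_def f2_def v_def cmod_power2 by (simp add: power2_eq_square algebra_simps)
    have "(norm_L2 f1)\<^sup>2 + (norm_L2 f2)\<^sup>2 = (\<integral>t. (cmod (f1 t))\<^sup>2 + (cmod (f2 t))\<^sup>2 \<partial>lborel)"
      using f12 by (simp add: norm_L2_power2 L2_integrable)
    also have "\<dots> = (2 - 2 * \<delta>) * (norm_L2 f)\<^sup>2 + \<delta>\<^sup>2 * ((norm_L2 u)\<^sup>2 + (norm_L2 v)\<^sup>2)"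
      unfolding pw using f u v by (simp add: norm_L2_power2 L2_integrable)
    also have "\<dots> \<le> (2 - 2 * \<delta>) * (norm_L2 f)\<^sup>2 + \<delta>\<^sup>2 * ((K * norm_L2 f)\<^sup>2 + (K * norm_L2 f)\<^sup>2)"
      by (intro add_left_mono mult_left_mono add_mono power_mono nu nv) auto
    also have "\<dots> = r\<^sup>2 / 2 * (norm_L2 f)\<^sup>2"
    proof -
      have a: "\<delta>\<^sup>2 * K\<^sup>2 = \<delta> / 2" using \<open>K \<ge> 2\<close> by (simp add: \<delta>_def power2_eq_square)
      have b: "1 / K\<^sup>2 = 2 * \<delta>" by (simp add: \<delta>_def)
      have coeff: "2 - 2 * \<delta> + 2 * (\<delta>\<^sup>2 * K\<^sup>2) = r\<^sup>2 / 2" unfolding r(3) a b by simp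
      have "(2 - 2 * \<delta>) * (norm_L2 f)\<^sup>2 + \<delta>\<^sup>2 * ((K * norm_L2 f)\<^sup>2 + (K * norm_L2 f)\<^sup>2)
          = (2 - 2 * \<delta> + 2 * (\<delta>\<^sup>2 * K\<^sup>2)) * (norm_L2 f)\<^sup>2"
        unfolding power_mult_distrib by algebra
      then show ?thesis unfolding coeff .
    qed
    finally have sq: "(norm_L2 f1)\<^sup>2 + (norm_L2 f2)\<^sup>2 \<le> r\<^sup>2 / 2 * (norm_L2 f)\<^sup>2" .
    have "(norm_L2 f1 + norm_L2 f2)\<^sup>2 \<le> 2 * ((norm_L2 f1)\<^sup>2 + (norm_L2 f2)\<^sup>2)"
      using sum_squares_bound[of "norm_L2 f1" "norm_L2 f2"] by (simp add: power2_sum)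
    also have "\<dots> \<le> (r * norm_L2 f)\<^sup>2" using sq by (simp add: power_mult_distrib)
    finally have sum_le: "norm_L2 f1 + norm_L2 f2 \<le> r * norm_L2 f"
      using r(1) by (intro power2_le_imp_le[of "norm_L2 f1 + norm_L2 f2"]) auto
    have "(\<Sum>n\<in>F. cmod (coef f n)) = (\<Sum>n\<in>F \<inter> {..<N}. cmod (coef f n)) + (\<Sum>n\<in>F \<inter> {N..}. cmod (coef f n))"
      using Suc.prems(1) by (subst sum.union_disjoint[symmetric]) (auto intro!: sum.cong)
    also have "\<dots> = (\<Sum>n\<in>F \<inter> {..<N}. cmod (coef f1 n)) + (\<Sum>n\<in>F \<inter> {N..}. cmod (coef f2 n))"
      by (intro arg_cong2[of _ _ _ _ "(+)"] sum.cong) (auto simp: c1 c2)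
    also have "\<dots> \<le> K * r ^ k * norm_L2 f1 + K * r ^ k * norm_L2 f2"
      using Suc.prems(1) by (intro add_mono Suc.IH N f12) auto
    also have "\<dots> = K * r ^ k * (norm_L2 f1 + norm_L2 f2)" by (simp add: algebra_simps)
    also have "\<dots> \<le> K * r ^ k * (r * norm_L2 f)"
      using \<open>K \<ge> 2\<close> r(1) sum_le by (intro mult_left_mono) auto
    finally show ?case by (simp add: mult_ac)
  qed
  show ?thesis
    using est r \<open>K \<ge> 2\<close> by (intro exI[of _ K] conjI exI[of _ r]) auto
qed

end

section \<open>Truncation and continuity of translations\<close>

text \<open>
  In this form the dominating function bounds the error and not the sequence, which lets it be applied to
  truncations with the truncated function itself as the bound.
\<close>

lemma norm_L2_dominated_convergence:
  assumes "f \<in> borel_measurable borel" "\<And>n. u n \<in> borel_measurable borel" "w \<in> L2"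
    and "\<And>n t. cmod (f t - u n t) \<le> cmod (w t)" "AE t in lborel. (\<lambda>n. u n t) \<longlonglongrightarrow> f t"
  shows "(\<lambda>n. norm_L2 (\<lambda>t. f t - u n t)) \<longlonglongrightarrow> 0"
proof -
  note [measurable] = assms(1,2)
  have "(\<lambda>n. \<integral>t. (cmod (f t - u n t))\<^sup>2 \<partial>lborel) \<longlonglongrightarrow> (\<integral>t. 0 \<partial>(lborel :: real measure))"
  proof (rule integral_dominated_convergence[where w="\<lambda>t. (cmod (w t))\<^sup>2"])
    show "AE t in lborel. (\<lambda>n. (cmod (f t - u n t))\<^sup>2) \<longlonglongrightarrow> 0"
      using assms(5)
    proof eventually_elim
      case (elim t)
      then have "(\<lambda>n. (cmod (f t - u n t))\<^sup>2) \<longlonglongrightarrow> (cmod (f t - f t))\<^sup>2"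
        by (intro tendsto_intros)
      then show ?case by simp
    qed
    show "integrable lborel (\<lambda>t. (cmod (w t))\<^sup>2)" by (rule L2_integrable[OF assms(3)])
    show "AE t in lborel. norm ((cmod (f t - u n t))\<^sup>2) \<le> (cmod (w t))\<^sup>2" for n
      using assms(4)[of t n for t] by (intro AE_I2) (simp add: power_mono)
  qed simp_all
  then have "(\<lambda>n. sqrt (\<integral>t. (cmod (f t - u n t))\<^sup>2 \<partial>lborel)) \<longlonglongrightarrow> sqrt 0"
    by (intro tendsto_real_sqrt) simp
  then show ?thesis by (simp add: norm_L2_def)
qed

lemma L2_translate:
  assumes "f \<in> L2"
  shows "(\<lambda>t. f (t + h)) \<in> L2"
proof (rule L2_I)
  have [measurable]: "f \<in> borel_measurable borel" using assms by (rule L2_measurable)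
  show "(\<lambda>t. f (t + h)) \<in> borel_measurable borel" by measurable
  show "integrable lborel (\<lambda>t. (cmod (f (t + h)))\<^sup>2)"
    using lborel_integrable_real_affine[OF L2_integrable[OF assms], of 1 h] by (simp add: add.commute)
qed

lemma norm_L2_translate: "norm_L2 (\<lambda>t. f (t + h)) = norm_L2 f"
  using lborel_integral_real_affine[of 1 "\<lambda>t. (cmod (f t))\<^sup>2" h] by (simp add: norm_L2_def add.commute)

lemma indicator_interval_L2: "(\<lambda>t. indicator {a..b} t) \<in> L2"
proof (rule L2_I)
  have "integrable lborel (\<lambda>t. indicator {a..b} t :: real)"
    by (intro integrable_real_indicator) (auto simp: emeasure_lborel_Icc_eq)
  then show "integrable lborel (\<lambda>t. (cmod (indicator {a..b} t))\<^sup>2)"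
    by (rule Bochner_Integration.integrable_bound) (auto split: split_indicator)
qed simp

definition truncate :: "nat \<Rightarrow> (real \<Rightarrow> complex) \<Rightarrow> real \<Rightarrow> complex" where
  "truncate N f t = indicator {- real N..real N} t * f t"

lemma truncate_measurable [measurable]: "f \<in> borel_measurable borel \<Longrightarrow> truncate N f \<in> borel_measurable borel"
  unfolding truncate_def[abs_def] by measurable

lemma cmod_truncate_le: "cmod (truncate N f t) \<le> cmod (f t)"
  by (simp add: truncate_def split: split_indicator)

lemma truncate_L2 [simp]: "f \<in> L2 \<Longrightarrow> truncate N f \<in> L2"
  by (rule L2_dominated[where C=1]) (auto simp: cmod_truncate_le dest: L2_measurable)

lemma truncate_integrable: "f \<in> L2 \<Longrightarrow> integrable lborel (truncate N f)"
  unfolding truncate_def[abs_def] by (rule L2_mult_integrable[OF indicator_interval_L2])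

lemma eventually_le_real: "\<forall>\<^sub>F n in sequentially. x \<le> real n"
  using filterlim_real_sequentially by (simp add: filterlim_at_top)

lemma truncate_tendsto:
  assumes "f \<in> L2"
  shows "(\<lambda>N. norm_L2 (\<lambda>t. f t - truncate N f t)) \<longlonglongrightarrow> 0"
proof (rule norm_L2_dominated_convergence[OF _ _ assms])
  have [measurable]: "f \<in> borel_measurable borel" using assms by (rule L2_measurable)
  show "f \<in> borel_measurable borel" "truncate n f \<in> borel_measurable borel" for n by measurable
  show "cmod (f t - truncate n f t) \<le> cmod (f t)" for n t
    by (simp add: truncate_def split: split_indicator)
  show "AE t in lborel. (\<lambda>n. truncate n f t) \<longlonglongrightarrow> f t"
  proof (rule AE_I2, rule tendsto_eventually)
    fix t
    show "\<forall>\<^sub>F n in sequentially. truncate n f t = f t"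
      using eventually_le_real[of "\<bar>t\<bar>"] by eventually_elim (auto simp: truncate_def indicator_def abs_le_iff)
  qed
qed

lemma L2_approx_bounded:
  assumes "f \<in> L2" "\<epsilon> > 0"
  shows "\<exists>g\<in>L2. \<exists>m::nat. m > 0 \<and> (\<forall>t. cmod (g t) \<le> real m) \<and> (\<forall>t. \<bar>t\<bar> > real m \<longrightarrow> g t = 0)
            \<and> norm_L2 (\<lambda>t. f t - g t) < \<epsilon>"
proof -
  have [measurable]: "f \<in> borel_measurable borel" using assms(1) by (rule L2_measurable)
  define u where "u = (\<lambda>(m::nat) t. if \<bar>t\<bar> \<le> real m \<and> cmod (f t) \<le> real m then f t else 0)"
  have [measurable]: "u m \<in> borel_measurable borel" for m unfolding u_def by measurable
  have "(\<lambda>m. norm_L2 (\<lambda>t. f t - u m t)) \<longlonglongrightarrow> 0"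
  proof (rule norm_L2_dominated_convergence[OF _ _ assms(1)])
    show "AE t in lborel. (\<lambda>n. u n t) \<longlonglongrightarrow> f t"
    proof (rule AE_I2, rule tendsto_eventually)
      fix t
      show "\<forall>\<^sub>F n in sequentially. u n t = f t"
        using eventually_le_real[of "\<bar>t\<bar>"] eventually_le_real[of "cmod (f t)"]
        by eventually_elim (simp add: u_def)
    qed
  qed (auto simp: u_def)
  from LIMSEQ_D[OF this assms(2)] obtain M where M: "\<And>m. m \<ge> M \<Longrightarrow> norm_L2 (\<lambda>t. f t - u m t) < \<epsilon>" by auto
  have "u (Suc M) \<in> L2" by (rule L2_dominated[OF assms(1), where C=1]) (auto simp: u_def)
  moreover have "cmod (u (Suc M) t) \<le> real (Suc M)" for t by (simp add: u_def)
  moreover have "u (Suc M) t = 0" if "\<bar>t\<bar> > real (Suc M)" for t using that by (simp add: u_def)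
  ultimately show ?thesis using M[of "Suc M"] by (intro bexI[of _ "u (Suc M)"] exI[of _ "Suc M"]) auto
qed

text \<open>
  A measurable function is the pointwise limit almost everywhere of continuous functions \<open>g n\<close>.
  Clipping their values to the disc of radius \<open>m\<close> and multiplying by a cutoff keeps them continuous,
  leaves the limit \<open>f\<close> unchanged, and makes the convergence dominated.
\<close>

lemma L2_approx_continuous_bounded:
  assumes f: "f \<in> L2" and m: "m > 0" "\<And>t. cmod (f t) \<le> real m" "\<And>t. \<bar>t\<bar> > real m \<Longrightarrow> f t = 0"
    and "\<epsilon> > 0"
  shows "\<exists>g. continuous_on UNIV g \<and> (\<forall>t. \<bar>t\<bar> > real m + 1 \<longrightarrow> g t = 0) \<and> norm_L2 (\<lambda>t. f t - g t) < \<epsilon>"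
proof -
  have [measurable]: "f \<in> borel_measurable borel" using f by (rule L2_measurable)
  have "f \<in> borel_measurable lebesgue" by (rule measurable_completion) simp
  then have "f measurable_on UNIV" by (rule lebesgue_measurable_imp_measurable_on) simp
  then obtain Z g where Z: "negligible Z" "\<And>n. continuous_on UNIV (g n)"
    "\<And>t. t \<notin> Z \<Longrightarrow> (\<lambda>n. g n t) \<longlonglongrightarrow> f t"
    unfolding measurable_on_def by auto
  define clip where "clip = (\<lambda>z::complex. z * complex_of_real (real m / max (real m) (cmod z)))"
  define cut where "cut = (\<lambda>t::real. max 0 (min 1 (real m + 1 - \<bar>t\<bar>)))"
  define u where "u = (\<lambda>n t. complex_of_real (cut t) * clip (g n t))"
  have clip_cont: "continuous_on UNIV clip"
    unfolding clip_def using m(1) by (intro continuous_intros) auto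
  have u_cont: "continuous_on UNIV (u n)" for n
    unfolding u_def cut_def by (intro continuous_intros continuous_on_compose2[OF clip_cont Z(2)]) auto
  have [measurable]: "u n \<in> borel_measurable borel" for n
    using u_cont by (rule borel_measurable_continuous_onI)
  have clip_le: "cmod (clip z) \<le> real m" for z
  proof -
    have "cmod z * real m \<le> real m * max (real m) (cmod z)" by (simp add: mult.commute mult_left_mono)
    then show ?thesis using m(1) by (simp add: clip_def norm_mult norm_divide field_simps max_def)
  qed
  have clip_0: "clip 0 = 0" by (simp add: clip_def)
  have clip_f: "clip (f t) = f t" for t using m(1) m(2)[of t] by (simp add: clip_def max_absorb1)
  have chi: "0 \<le> cut t" "cut t \<le> 1" "\<bar>t\<bar> \<le> real m \<Longrightarrow> cut t = 1" "\<bar>t\<bar> > real m + 1 \<Longrightarrow> cut t = 0" for t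
    by (auto simp: cut_def)
  have u_le: "cmod (u n t) \<le> real m" for n t
  proof -
    have "cmod (u n t) = cut t * cmod (clip (g n t))" using chi(1) by (simp add: u_def norm_mult)
    also have "\<dots> \<le> 1 * real m" by (intro mult_mono chi clip_le) auto
    finally show ?thesis by simp
  qed
  have u_supp: "u n t = 0" if "\<bar>t\<bar> > real m + 1" for n t using chi(4)[OF that] by (simp add: u_def)
  have AEZ: "AE t in lborel. t \<notin> Z"
  proof -
    have "AE t in lebesgue. t \<notin> Z" using Z(1) by (intro AE_not_in) (simp add: negligible_iff_null_sets)
    then show ?thesis by (simp add: AE_completion_iff)
  qed
  define w where "w = (\<lambda>t::real. complex_of_real (2 * real m) * indicator {-(real m + 1)..real m + 1} t)"
  have "(\<lambda>n. norm_L2 (\<lambda>t. f t - u n t)) \<longlonglongrightarrow> 0"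
  proof (rule norm_L2_dominated_convergence)
    show "w \<in> L2" unfolding w_def by (intro L2_cmult indicator_interval_L2)
    show "cmod (f t - u n t) \<le> cmod (w t)" for n t
    proof (cases "\<bar>t\<bar> > real m + 1")
      case True
      then show ?thesis using u_supp[OF True] m(3)[of t] by simp
    next
      case False
      then have "t \<in> {-(real m + 1)..real m + 1}" by auto
      then have "cmod (w t) = 2 * real m" by (simp add: w_def norm_mult)
      then show ?thesis using norm_triangle_ineq4[of "f t" "u n t"] m(2)[of t] u_le[of n t] by linarith
    qed
    show "AE t in lborel. (\<lambda>n. u n t) \<longlonglongrightarrow> f t"
      using AEZ
    proof eventually_elim
      case (elim t)
      have "isCont clip (f t)" using clip_cont by (simp add: continuous_on_eq_continuous_at)
      then have "(\<lambda>n. clip (g n t)) \<longlonglongrightarrow> clip (f t)"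
        using Z(3)[OF elim] by (rule isCont_tendsto_compose)
      then have "(\<lambda>n. u n t) \<longlonglongrightarrow> complex_of_real (cut t) * clip (f t)"
        unfolding u_def by (intro tendsto_intros)
      also have "complex_of_real (cut t) * clip (f t) = f t"
        using chi(3)[of t] m(3)[of t] by (cases "\<bar>t\<bar> \<le> real m") (auto simp: clip_f clip_0)
      finally show ?case .
    qed
  qed simp_all
  from LIMSEQ_D[OF this \<open>\<epsilon> > 0\<close>] obtain n where "norm_L2 (\<lambda>t. f t - u n t) < \<epsilon>" by auto
  then show ?thesis using u_cont u_supp by blast
qed

lemma L2_compact_support:
  assumes "continuous_on UNIV g" "\<And>t. \<bar>t\<bar> > R \<Longrightarrow> g t = 0" "R \<ge> 0"
  shows "\<exists>B\<ge>0. \<forall>t. cmod (g t) \<le> B" "g \<in> L2"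
proof -
  have "bounded (g ` {-R..R})"
    using assms(1) by (intro compact_imp_bounded compact_continuous_image) (auto intro: continuous_on_subset)
  then obtain B where B: "\<And>t. t \<in> {-R..R} \<Longrightarrow> cmod (g t) \<le> B" unfolding bounded_iff by blast
  have B': "cmod (g t) \<le> \<bar>B\<bar>" for t
  proof (cases "\<bar>t\<bar> > R")
    case False
    then have "t \<in> {-R..R}" by auto
    from B[OF this] show ?thesis by linarith
  qed (simp add: assms(2))
  then show "\<exists>B\<ge>0. \<forall>t. cmod (g t) \<le> B" by (intro exI[of _ "\<bar>B\<bar>"]) auto
  show "g \<in> L2"
  proof (rule L2_dominated[OF indicator_interval_L2[of "-R" R]])
    show "g \<in> borel_measurable borel" using assms(1) by (rule borel_measurable_continuous_onI)
    show "cmod (g t) \<le> \<bar>B\<bar> * cmod (indicator {-R..R} t)" for t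
      using B'[of t] assms(2)[of t] by (auto split: split_indicator)
  qed
qed

lemma translate_continuous_compact_support:
  assumes g: "continuous_on UNIV g" "\<And>t. \<bar>t\<bar> > R \<Longrightarrow> g t = 0" "R \<ge> 0" and h: "h \<longlonglongrightarrow> 0"
  shows "(\<lambda>k. norm_L2 (\<lambda>t. g t - g (t + h k))) \<longlonglongrightarrow> 0"
proof -
  obtain B where B: "B \<ge> 0" "\<And>t. cmod (g t) \<le> B" using L2_compact_support(1)[OF g(1,2,3)] by auto
  have [measurable]: "g \<in> borel_measurable borel" using g(1) by (rule borel_measurable_continuous_onI)
  have "Bseq h" using h by (intro convergent_imp_Bseq convergentI)
  then obtain H where H: "\<And>k. \<bar>h k\<bar> \<le> H" by (auto simp: Bseq_def)
  define w where "w = (\<lambda>t::real. complex_of_real (2 * B) * indicator {-(R + H)..R + H} t)"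
  show ?thesis
  proof (rule norm_L2_dominated_convergence)
    show "w \<in> L2" unfolding w_def by (intro L2_cmult indicator_interval_L2)
    show "cmod (g t - g (t + h k)) \<le> cmod (w t)" for k t
    proof (cases "\<bar>t\<bar> > R + H")
      case True
      then have "g t = 0" "g (t + h k) = 0" using H[of k] by (auto intro!: g(2))
      then show ?thesis by simp
    next
      case False
      then have "t \<in> {-(R + H)..R + H}" by auto
      then have "cmod (w t) = 2 * B" using B(1) by (simp add: w_def norm_mult)
      then show ?thesis using norm_triangle_ineq4[of "g t" "g (t + h k)"] B(2)[of t] B(2)[of "t + h k"] by linarith
    qed
    show "AE t in lborel. (\<lambda>n. g (t + h n)) \<longlonglongrightarrow> g t"
    proof (rule AE_I2)
      fix t
      have "(\<lambda>n. t + h n) \<longlonglongrightarrow> t + 0" by (intro tendsto_intros h)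
      then show "(\<lambda>n. g (t + h n)) \<longlonglongrightarrow> g t"
        using g(1) by (intro isCont_tendsto_compose[of t g]) (simp_all add: continuous_on_eq_continuous_at)
    qed
  qed simp_all
qed

text \<open>
  Dominated convergence settles continuous functions of compact support, and these are dense.
\<close>

theorem L2_translate_continuous:
  assumes f: "f \<in> L2" and h: "h \<longlonglongrightarrow> 0"
  shows "(\<lambda>k. norm_L2 (\<lambda>t. f t - f (t + h k))) \<longlonglongrightarrow> 0"
proof (rule LIMSEQ_I)
  fix \<epsilon> :: real assume "\<epsilon> > 0"
  obtain f1 m where f1: "f1 \<in> L2" "(m::nat) > 0" "\<And>t. cmod (f1 t) \<le> real m"
    "\<And>t. \<bar>t\<bar> > real m \<Longrightarrow> f1 t = 0" "norm_L2 (\<lambda>t. f t - f1 t) < \<epsilon> / 6"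
    using L2_approx_bounded[OF f, of "\<epsilon> / 6"] \<open>\<epsilon> > 0\<close> by auto
  obtain g where g: "continuous_on UNIV g" "\<And>t. \<bar>t\<bar> > real m + 1 \<Longrightarrow> g t = 0" "norm_L2 (\<lambda>t. f1 t - g t) < \<epsilon> / 6"
    using L2_approx_continuous_bounded[OF f1(1-4), of "\<epsilon> / 6"] \<open>\<epsilon> > 0\<close> by auto
  have g_L2: "g \<in> L2" by (rule L2_compact_support(2)[where R="real m + 1"]) (use g in auto)
  have fg: "norm_L2 (\<lambda>t. f t - g t) < \<epsilon> / 3"
    using norm_L2_triangle_mid[OF f f1(1) g_L2] f1(5) g(3) by linarith
  have "(\<lambda>k. norm_L2 (\<lambda>t. g t - g (t + h k))) \<longlonglongrightarrow> 0"
    by (rule translate_continuous_compact_support[where R="real m + 1"]) (use g h in auto)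
  from LIMSEQ_D[OF this, of "\<epsilon> / 3"] obtain K where
    K: "\<And>k. k \<ge> K \<Longrightarrow> norm_L2 (\<lambda>t. g t - g (t + h k)) < \<epsilon> / 3" using \<open>\<epsilon> > 0\<close> by auto
  have "norm_L2 (\<lambda>t. f t - f (t + h k)) < \<epsilon>" if "k \<ge> K" for k
  proof -
    have "norm_L2 (\<lambda>t. g (t + h k) - f (t + h k)) = norm_L2 (\<lambda>t. f t - g t)"
      using norm_L2_translate[of "\<lambda>t. g t - f t" "h k"] norm_L2_minus_commute[of f g] by simp
    then show ?thesis
      using norm_L2_triangle_mid[OF f g_L2 L2_translate[OF f, of "h k"]]
        norm_L2_triangle_mid[OF g_L2 L2_translate[OF g_L2, of "h k"] L2_translate[OF f, of "h k"]]
        fg K[OF that] by linarith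
  qed
  then show "\<exists>K. \<forall>k\<ge>K. norm (norm_L2 (\<lambda>t. f t - f (t + h k)) - 0) < \<epsilon>" by auto
qed


section \<open>Plancherel's theorem\<close>

definition fourier_integral :: "(real \<Rightarrow> complex) \<Rightarrow> real \<Rightarrow> complex" where
  "fourier_integral f \<xi> = (\<integral>t. f t * cis (- (2 * pi * t * \<xi>)) \<partial>lborel)"

lemma cis_measurable [measurable]: "cis \<in> borel_measurable borel"
  by (intro borel_measurable_continuous_onI continuous_intros)

lemma cnj_measurable [measurable]: "cnj \<in> borel_measurable borel"
  by (intro borel_measurable_continuous_onI continuous_intros)

lemma L2_cnj: "f \<in> L2 \<Longrightarrow> (\<lambda>t. cnj (f t)) \<in> L2"
proof (rule L2_dominated[where C=1 and f=f])
  assume "f \<in> L2"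
  then have [measurable]: "f \<in> borel_measurable borel" by (rule L2_measurable)
  show "(\<lambda>t. cnj (f t)) \<in> borel_measurable borel" by measurable
qed simp_all

lemma fourier_integral_measurable [measurable]:
  assumes [measurable]: "f \<in> borel_measurable borel"
  shows "fourier_integral f \<in> borel_measurable borel"
  unfolding fourier_integral_def[abs_def] by measurable

lemma integrable_times_cis:
  assumes "integrable lborel f" "g \<in> borel_measurable borel"
  shows "integrable lborel (\<lambda>t. f t * cis (g t) :: complex)"
proof (rule Bochner_Integration.integrable_bound[OF assms(1)])
  have [measurable]: "f \<in> borel_measurable lborel" using assms(1) by (rule borel_measurable_integrable)
  note [measurable] = assms(2)
  show "(\<lambda>t. f t * cis (g t)) \<in> borel_measurable lborel" by measurable
qed (simp add: norm_mult)

lemma integrable_fourier_kernel: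
  "integrable lborel f \<Longrightarrow> integrable lborel (\<lambda>t. f t * cis (- (2 * pi * t * \<xi>)))"
  by (rule integrable_times_cis) simp_all

lemma cmod_fourier_integral_le: "cmod (fourier_integral f \<xi>) \<le> (\<integral>t. cmod (f t) \<partial>lborel)"
proof -
  have "cmod (fourier_integral f \<xi>) \<le> (\<integral>t. cmod (f t * cis (- (2 * pi * t * \<xi>))) \<partial>lborel)"
    unfolding fourier_integral_def by (rule integral_norm_bound)
  then show ?thesis by (simp add: norm_mult)
qed

lemma fourier_integral_diff:
  assumes "integrable lborel f" "integrable lborel g"
  shows "fourier_integral (\<lambda>t. f t - g t) \<xi> = fourier_integral f \<xi> - fourier_integral g \<xi>"
  unfolding fourier_integral_def left_diff_distrib
  by (rule Bochner_Integration.integral_diff) (intro integrable_fourier_kernel assms)+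

lemma fourier_integral_cmult: "fourier_integral (\<lambda>t. a * f t) \<xi> = a * fourier_integral f \<xi>"
  unfolding fourier_integral_def by (simp add: mult.assoc)

lemma fourier_integral_translate:
  "fourier_integral (\<lambda>t. f (t + h)) \<xi> = cis (2 * pi * h * \<xi>) * fourier_integral f \<xi>"
proof -
  have "fourier_integral f \<xi> = (\<integral>t. f (h + 1 * t) * cis (- (2 * pi * (h + 1 * t) * \<xi>)) \<partial>lborel)"
    using lborel_integral_real_affine[of 1 "\<lambda>t. f t * cis (- (2 * pi * t * \<xi>))" h]
    by (simp add: fourier_integral_def)
  also have "\<dots> = (\<integral>t. cis (- (2 * pi * h * \<xi>)) * (f (t + h) * cis (- (2 * pi * t * \<xi>))) \<partial>lborel)"
    by (intro Bochner_Integration.integral_cong refl) (simp add: algebra_simps cis_mult add.commute)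
  also have "\<dots> = cis (- (2 * pi * h * \<xi>)) * fourier_integral (\<lambda>t. f (t + h)) \<xi>"
    unfolding fourier_integral_def by simp
  finally show ?thesis by (simp add: mult.assoc[symmetric] cis_mult)
qed

text \<open>
  Fubini's theorem for \<open>f t * g \<xi> * cis (- (2 * pi * t * \<xi>))\<close>.
\<close>

lemma multiplication_formula:
  assumes f: "integrable lborel f" and g: "integrable lborel g"
  shows "(\<integral>\<xi>. g \<xi> * fourier_integral f \<xi> \<partial>lborel) = (\<integral>t. f t * fourier_integral g t \<partial>lborel)"
proof -
  have [measurable]: "f \<in> borel_measurable lborel" "g \<in> borel_measurable lborel"
    using f g by (auto intro: borel_measurable_integrable)
  have "integrable (lborel \<Otimes>\<^sub>M lborel) (\<lambda>(t, \<xi>). f t * g \<xi> * cis (- (2 * pi * t * \<xi>)))"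
  proof (rule lborel_pair.Fubini_integrable)
    show "(\<lambda>(t, \<xi>). f t * g \<xi> * cis (- (2 * pi * t * \<xi>))) \<in> borel_measurable (lborel \<Otimes>\<^sub>M lborel)"
      by measurable
    show "integrable lborel (\<lambda>t. \<integral>\<xi>. norm (case (t, \<xi>) of (t, \<xi>) \<Rightarrow> f t * g \<xi> * cis (- (2 * pi * t * \<xi>))) \<partial>lborel)"
      using f by (simp add: norm_mult)
    show "AE t in lborel. integrable lborel (\<lambda>\<xi>. case (t, \<xi>) of (t, \<xi>) \<Rightarrow> f t * g \<xi> * cis (- (2 * pi * t * \<xi>)))"
      using g by (intro AE_I2) (auto intro!: integrable_times_cis)
  qed
  from lborel_pair.Fubini_integral[OF this]
  have "(\<integral>\<xi>. (\<integral>t. f t * g \<xi> * cis (- (2 * pi * t * \<xi>)) \<partial>lborel) \<partial>lborel)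
      = (\<integral>t. (\<integral>\<xi>. f t * g \<xi> * cis (- (2 * pi * t * \<xi>)) \<partial>lborel) \<partial>lborel)" .
  moreover have "(\<integral>t. f t * g \<xi> * cis (- (2 * pi * t * \<xi>)) \<partial>lborel) = g \<xi> * fourier_integral f \<xi>" for \<xi>
  proof -
    have "(\<integral>t. f t * g \<xi> * cis (- (2 * pi * t * \<xi>)) \<partial>lborel) = (\<integral>t. g \<xi> * (f t * cis (- (2 * pi * t * \<xi>))) \<partial>lborel)"
      by (simp add: mult_ac)
    then show ?thesis by (simp add: fourier_integral_def)
  qed
  moreover have "(\<integral>\<xi>. f t * g \<xi> * cis (- (2 * pi * t * \<xi>)) \<partial>lborel) = f t * fourier_integral g t" for t
    by (simp add: fourier_integral_def mult_ac)
  ultimately show ?thesis by simp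
qed

lemma integral_std_normal_cis:
  "(\<integral>x. complex_of_real (std_normal_density x) * cis (s * x) \<partial>lborel) = complex_of_real (exp (- s\<^sup>2 / 2))"
proof -
  have "(\<integral>x. std_normal_density x *\<^sub>R iexp (s * x) \<partial>lborel) = char std_normal_distribution s"
    unfolding char_def by (subst integral_density) (auto simp: normal_density_nonneg)
  then show ?thesis
    by (simp add: char_std_normal_distribution scaleR_conv_of_real cis_conv_exp)
qed

text \<open>
  A weight that tends to 1 as \<open>c\<close> tends to 0. Its Fourier transform is the density of the
  normal distribution with standard deviation \<open>c\<close>, an approximate identity.
\<close>

definition gaussian_weight :: "real \<Rightarrow> real \<Rightarrow> complex" where
  "gaussian_weight c \<xi> = complex_of_real (exp (- (2 * pi * c * \<xi>)\<^sup>2 / 2))"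

lemma gaussian_weight_eq: "gaussian_weight c \<xi> = complex_of_real (sqrt (2 * pi) * std_normal_density (2 * pi * c * \<xi>))"
  by (simp add: gaussian_weight_def std_normal_density_def)

lemma integrable_std_normal: "integrable lborel std_normal_density"
  using integrable_std_normal_moment[of 0] by simp

lemma gaussian_weight_integrable:
  assumes "c > 0" shows "integrable lborel (gaussian_weight c)"
proof -
  have "integrable lborel (\<lambda>\<xi>. std_normal_density (0 + 2 * pi * c * \<xi>))"
    using assms by (intro lborel_integrable_real_affine[OF integrable_std_normal]) auto
  then show ?thesis unfolding gaussian_weight_eq[abs_def] by simp
qed

lemma fourier_gaussian_weight:
  assumes "c > 0"
  shows "fourier_integral (gaussian_weight c) r = complex_of_real (std_normal_density (r / c) / c)"
proof -
  define G where "G = (\<lambda>x. complex_of_real (std_normal_density x) * cis ((- (r / c)) * x))"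
  have "(\<integral>x. G x \<partial>lborel) = complex_of_real (2 * pi * c) * (\<integral>\<xi>. G (2 * pi * c * \<xi>) \<partial>lborel)"
    using lborel_integral_real_affine[of "2 * pi * c" G 0] assms by (simp add: scaleR_conv_of_real)
  moreover have "fourier_integral (gaussian_weight c) r
      = complex_of_real (sqrt (2 * pi)) * (\<integral>\<xi>. G (2 * pi * c * \<xi>) \<partial>lborel)"
  proof -
    have "gaussian_weight c \<xi> * cis (- (2 * pi * \<xi> * r)) = complex_of_real (sqrt (2 * pi)) * G (2 * pi * c * \<xi>)" for \<xi>
      using assms by (simp add: G_def gaussian_weight_eq mult_ac)
    then show ?thesis by (simp add: fourier_integral_def)
  qed
  moreover have "(\<integral>x. G x \<partial>lborel) = complex_of_real (exp (- (r / c)\<^sup>2 / 2))"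
    unfolding G_def by (subst integral_std_normal_cis) simp
  ultimately have "complex_of_real (2 * pi * c) * fourier_integral (gaussian_weight c) r
      = complex_of_real (sqrt (2 * pi) * exp (- (r / c)\<^sup>2 / 2))"
    by (simp add: mult_ac)
  also have "\<dots> = complex_of_real (2 * pi * c) * complex_of_real (std_normal_density (r / c) / c)"
  proof -
    have "sqrt (2 * pi) * sqrt (2 * pi) = 2 * pi" by simp
    then have "sqrt (2 * pi) * exp (- (r / c)\<^sup>2 / 2) = 2 * pi * c * (std_normal_density (r / c) / c)"
      using assms by (simp add: std_normal_density_def field_simps del: real_sqrt_mult_self real_sqrt_mult)
    then show ?thesis by (metis of_real_mult)
  qed
  finally show ?thesis using assms by (simp add: field_simps)
qed


lemma cnj_fourier_integral: "cnj (fourier_integral f \<xi>) = fourier_integral (\<lambda>t. cnj (f (- t))) \<xi>"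
proof -
  have "cnj (fourier_integral f \<xi>) = (\<integral>t. cnj (f t) * cis (2 * pi * t * \<xi>) \<partial>lborel)"
    unfolding fourier_integral_def Bochner_Integration.integral_cnj[symmetric]
    by (simp add: cis_cnj del: Bochner_Integration.integral_cnj)
  also have "\<dots> = fourier_integral (\<lambda>t. cnj (f (- t))) \<xi>"
    using lborel_integral_real_affine[of "-1" "\<lambda>t. cnj (f t) * cis (2 * pi * t * \<xi>)" 0]
    by (simp add: fourier_integral_def)
  finally show ?thesis .
qed

lemma fourier_integral_modulate:
  "fourier_integral (\<lambda>\<xi>. f \<xi> * cis (- (2 * pi * \<xi> * t))) s = fourier_integral f (s + t)"
  unfolding fourier_integral_def
  by (intro Bochner_Integration.integral_cong refl) (simp add: mult.assoc cis_mult algebra_simps)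

text \<open>
  Formally both sides are \<open>\<integral>\<integral> f(t) * cnj (f(s)) * W(t - s) ds dt\<close>, where \<open>W\<close> is the Fourier transform
  of the weight. Only absolutely convergent double integrals are exchanged: one application of
  the multiplication formula unfolds each of the two factors of \<open>\<bar>F f\<bar>\<^sup>2 = F f * cnj (F f)\<close>.
\<close>

lemma gaussian_mean_fourier_integral:
  assumes f: "f \<in> L2" "integrable lborel f" and "c > 0"
  shows "(\<integral>\<xi>. gaussian_weight c \<xi> * complex_of_real ((cmod (fourier_integral f \<xi>))\<^sup>2) \<partial>lborel)
       = (\<integral>u. complex_of_real (std_normal_density u) * (\<integral>t. f t * cnj (f (t + c * u)) \<partial>lborel) \<partial>lborel)"
proof -
  have [measurable]: "f \<in> borel_measurable borel" using f(1) by (rule L2_measurable)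
  define w where "w = gaussian_weight c"
  have w_int: "integrable lborel w" unfolding w_def using \<open>c > 0\<close> by (rule gaussian_weight_integrable)
  have [measurable]: "w \<in> borel_measurable lborel" using w_int by (rule borel_measurable_integrable)
  define f' where "f' = (\<lambda>t. cnj (f (- t)))"
  have f'_int: "integrable lborel f'"
    unfolding f'_def using lborel_integrable_real_affine[OF f(2), of "-1" 0] by simp
  define G where "G = (\<lambda>\<xi>. w \<xi> * fourier_integral f' \<xi>)"
  have G_int: "integrable lborel G"
  proof (rule Bochner_Integration.integrable_bound)
    show "integrable lborel (\<lambda>\<xi>. w \<xi> * complex_of_real (\<integral>t. cmod (f' t) \<partial>lborel))"
      using w_int by simp
    have [measurable]: "f' \<in> borel_measurable borel" unfolding f'_def by measurable
    show "G \<in> borel_measurable lborel" unfolding G_def by measurable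
    show "AE \<xi> in lborel. cmod (G \<xi>) \<le> cmod (w \<xi> * complex_of_real (\<integral>t. cmod (f' t) \<partial>lborel))"
      by (intro AE_I2) (simp add: G_def norm_mult mult_left_mono cmod_fourier_integral_le)
  qed
  have FG: "fourier_integral G t = (\<integral>u. cnj (f (t + c * u)) * complex_of_real (std_normal_density u) \<partial>lborel)" for t
  proof -
    define W where "W = (\<lambda>\<xi>. w \<xi> * cis (- (2 * pi * \<xi> * t)))"
    have W_int: "integrable lborel W" unfolding W_def using w_int by (rule integrable_times_cis) simp
    have "fourier_integral G t = (\<integral>\<xi>. G \<xi> * cis (- (2 * pi * \<xi> * t)) \<partial>lborel)"
      by (rule fourier_integral_def)
    also have "\<dots> = (\<integral>\<xi>. W \<xi> * fourier_integral f' \<xi> \<partial>lborel)"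
      by (simp add: G_def W_def mult_ac)
    also have "\<dots> = (\<integral>s. f' s * fourier_integral W s \<partial>lborel)"
      by (rule multiplication_formula[OF f'_int W_int])
    also have "\<dots> = (\<integral>s. f' s * complex_of_real (std_normal_density ((s + t) / c) / c) \<partial>lborel)"
      unfolding W_def fourier_integral_modulate w_def fourier_gaussian_weight[OF \<open>c > 0\<close>] ..
    also have "\<dots> = c *\<^sub>R (\<integral>u. f' (- t + (- c) * u) * complex_of_real (std_normal_density ((- t + (- c) * u + t) / c) / c) \<partial>lborel)"
      by (subst lborel_integral_real_affine[of "- c" _ "- t"]) (use \<open>c > 0\<close> in auto)
    also have "(\<lambda>u. f' (- t + (- c) * u) * complex_of_real (std_normal_density ((- t + (- c) * u + t) / c) / c))
      = (\<lambda>u. (1 / c) *\<^sub>R (cnj (f (t + c * u)) * complex_of_real (std_normal_density u)))"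
      using \<open>c > 0\<close> by (auto simp: f'_def std_normal_density_def scaleR_conv_of_real add.commute mult.commute)
    finally show ?thesis using \<open>c > 0\<close> by simp
  qed
  let ?H = "\<lambda>u t. f t * cnj (f (t + c * u)) * complex_of_real (std_normal_density u)"
  have "gaussian_weight c \<xi> * complex_of_real ((cmod (fourier_integral f \<xi>))\<^sup>2) = G \<xi> * fourier_integral f \<xi>" for \<xi>
    unfolding complex_norm_square G_def w_def f'_def cnj_fourier_integral[symmetric] by (simp only: mult_ac)
  then have "(\<integral>\<xi>. gaussian_weight c \<xi> * complex_of_real ((cmod (fourier_integral f \<xi>))\<^sup>2) \<partial>lborel)
      = (\<integral>t. f t * fourier_integral G t \<partial>lborel)"
    by (simp only: multiplication_formula[OF f(2) G_int])
  also have "\<dots> = (\<integral>t. (\<integral>u. ?H u t \<partial>lborel) \<partial>lborel)"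
    unfolding FG by (simp add: mult.assoc)
  also have "\<dots> = (\<integral>u. (\<integral>t. ?H u t \<partial>lborel) \<partial>lborel)"
  proof (rule lborel_pair.Fubini_integral, rule lborel_pair.Fubini_integrable, unfold prod.case)
    show "(\<lambda>(u, t). ?H u t) \<in> borel_measurable (lborel \<Otimes>\<^sub>M lborel)"
      by measurable
    have tr: "(\<lambda>t. cnj (f (t + c * u))) \<in> L2" for u
      by (rule L2_cnj[OF L2_translate[OF f(1)]])
    have tr_norm: "norm_L2 (\<lambda>t. cnj (f (t + c * u))) = norm_L2 f" for u
      using norm_L2_translate[of f "c * u"] by (simp add: norm_L2_def)
    show "AE u in lborel. integrable lborel (\<lambda>t. ?H u t)"
      using L2_mult_integrable[OF f(1) tr] by auto
    have bound: "(\<integral>t. cmod (f t) * cmod (cnj (f (t + c * u))) \<partial>lborel) \<le> norm_L2 f * norm_L2 f" for u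
      using Cauchy_Schwarz_L2[OF f(1) tr[of u]] unfolding tr_norm .
    show "integrable lborel (\<lambda>u. \<integral>t. cmod (?H u t) \<partial>lborel)"
    proof (rule Bochner_Integration.integrable_bound)
      show "integrable lborel (\<lambda>u. std_normal_density u * (norm_L2 f * norm_L2 f))"
        using integrable_std_normal by simp
      show "(\<lambda>u. \<integral>t. cmod (?H u t) \<partial>lborel) \<in> borel_measurable lborel"
        by measurable
      show "AE u in lborel. norm (\<integral>t. cmod (?H u t) \<partial>lborel)
          \<le> norm (std_normal_density u * (norm_L2 f * norm_L2 f))"
      proof (rule AE_I2)
        fix u
        have "(\<integral>t. cmod (?H u t) \<partial>lborel)
            = (\<integral>t. cmod (f t) * cmod (cnj (f (t + c * u))) \<partial>lborel) * std_normal_density u"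
          by (simp add: norm_mult)
        also have "\<dots> \<le> (norm_L2 f * norm_L2 f) * std_normal_density u"
          by (intro mult_right_mono bound) simp
        finally show "norm (\<integral>t. cmod (?H u t) \<partial>lborel)
          \<le> norm (std_normal_density u * (norm_L2 f * norm_L2 f))" by (simp add: mult.commute)
      qed
    qed
  qed
  also have "\<dots> = (\<integral>u. complex_of_real (std_normal_density u) * (\<integral>t. f t * cnj (f (t + c * u)) \<partial>lborel) \<partial>lborel)"
    by (simp add: mult.commute)
  finally show ?thesis .
qed

text \<open>
  As \<open>c\<close> tends to 0, the left side of \<open>gaussian_mean_fourier_integral\<close> increases to the integral of
  \<open>\<bar>F f\<bar>\<^sup>2\<close>, and the right side tends to \<open>\<parallel>f\<parallel>\<^sup>2\<close> because translations are continuous in \<open>L\<^sup>2\<close>.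
\<close>

theorem Plancherel_integrable:
  assumes f: "f \<in> L2" "integrable lborel f"
  shows "fourier_integral f \<in> L2" "norm_L2 (fourier_integral f) = norm_L2 f"
proof -
  have [measurable]: "f \<in> borel_measurable borel" using f(1) by (rule L2_measurable)
  define c where "c = (\<lambda>n. 1 / real (Suc n))"
  have c_pos: "c n > 0" for n by (simp add: c_def)
  have c_lim: "c \<longlonglongrightarrow> 0" unfolding c_def using LIMSEQ_inverse_real_of_nat by (simp add: inverse_eq_divide)
  define M where "M = (\<integral>t. cmod (f t) \<partial>lborel)"
  have FM: "(cmod (fourier_integral f \<xi>))\<^sup>2 \<le> M\<^sup>2" for \<xi>
    unfolding M_def by (intro power_mono cmod_fourier_integral_le) simp
  define g where "g = (\<lambda>n \<xi>. exp (- (2 * pi * c n * \<xi>)\<^sup>2 / 2))"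
  have gw: "gaussian_weight (c n) \<xi> = complex_of_real (g n \<xi>)" for n \<xi>
    by (simp add: gaussian_weight_def g_def)
  define I where "I = (\<lambda>n \<xi>. g n \<xi> * (cmod (fourier_integral f \<xi>))\<^sup>2)"
  have g_int: "integrable lborel (g n)" for n
    using gaussian_weight_integrable[OF c_pos, of n] unfolding gw[abs_def] complex_of_real_integrable_eq .
  have I_int: "integrable lborel (I n)" for n
  proof (rule Bochner_Integration.integrable_bound)
    show "integrable lborel (\<lambda>\<xi>. g n \<xi> * M\<^sup>2)" using g_int by simp
    show "I n \<in> borel_measurable lborel" unfolding I_def g_def by measurable
    show "AE \<xi> in lborel. norm (I n \<xi>) \<le> norm (g n \<xi> * M\<^sup>2)"
      using FM by (intro AE_I2) (simp add: I_def g_def abs_mult mult_left_mono)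
  qed
  \<comment> \<open>The autocorrelation of \<open>f\<close>, with \<open>A 0 = \<parallel>f\<parallel>\<^sup>2\<close>.\<close>
  define A where "A = (\<lambda>h. \<integral>t. f t * cnj (f (t + h)) \<partial>lborel)"
  have tr: "(\<lambda>t. cnj (f (t + h))) \<in> L2" for h
    by (rule L2_cnj[OF L2_translate[OF f(1)]])
  have tr_norm: "norm_L2 (\<lambda>t. cnj (f (t + h))) = norm_L2 f" for h
    using norm_L2_translate[of f h] by (simp add: norm_L2_def)
  have A0: "A 0 = complex_of_real ((norm_L2 f)\<^sup>2)"
  proof -
    have "A 0 = (\<integral>t. complex_of_real ((cmod (f t))\<^sup>2) \<partial>lborel)"
      unfolding A_def complex_norm_square by simp
    then show ?thesis unfolding norm_L2_power2 integral_complex_of_real .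
  qed
  have A_le: "cmod (A h) \<le> (norm_L2 f)\<^sup>2" for h
    using norm_integral_mult_le[OF f(1) tr[of h]] unfolding tr_norm by (simp add: A_def power2_eq_square)
  have A_lim: "(\<lambda>n. A (c n * u)) \<longlonglongrightarrow> complex_of_real ((norm_L2 f)\<^sup>2)" for u
  proof -
    have "(\<lambda>n. c n * u) \<longlonglongrightarrow> 0" using tendsto_mult_left_zero[OF c_lim] .
    then have "(\<lambda>n. norm_L2 (\<lambda>t. f t - f (t + c n * u))) \<longlonglongrightarrow> 0" by (rule L2_translate_continuous[OF f(1)])
    then have lim: "(\<lambda>n. norm_L2 f * norm_L2 (\<lambda>t. f t - f (t + c n * u))) \<longlonglongrightarrow> 0"
      by (rule tendsto_mult_right_zero)
    have "cmod (A (c n * u) - A 0) \<le> norm_L2 f * norm_L2 (\<lambda>t. f t - f (t + c n * u))" for n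
    proof -
      have "A (c n * u) - A 0 = (\<integral>t. f t * (cnj (f (t + c n * u)) - cnj (f (t + 0))) \<partial>lborel)"
        unfolding A_def right_diff_distrib
        by (rule Bochner_Integration.integral_diff[symmetric]) (intro L2_mult_integrable f(1) tr)+
      also have "cmod \<dots> \<le> norm_L2 f * norm_L2 (\<lambda>t. cnj (f (t + c n * u)) - cnj (f (t + 0)))"
        by (rule norm_integral_mult_le[OF f(1) L2_diff[OF tr tr]])
      also have "norm_L2 (\<lambda>t. cnj (f (t + c n * u)) - cnj (f (t + 0))) = norm_L2 (\<lambda>t. f t - f (t + c n * u))"
        by (simp add: norm_L2_def norm_minus_commute flip: complex_cnj_diff)
      finally show ?thesis .
    qed
    then have "(\<lambda>n. A (c n * u) - A 0) \<longlonglongrightarrow> 0"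
      by (intro Lim_null_comparison[OF _ lim] always_eventually allI)
    then show ?thesis unfolding A0 by (simp only: LIM_zero_iff)
  qed
  have I_eq: "complex_of_real (\<integral>\<xi>. I n \<xi> \<partial>lborel) = (\<integral>u. complex_of_real (std_normal_density u) * A (c n * u) \<partial>lborel)" for n
  proof -
    have "complex_of_real (\<integral>\<xi>. I n \<xi> \<partial>lborel) = (\<integral>\<xi>. gaussian_weight (c n) \<xi> * complex_of_real ((cmod (fourier_integral f \<xi>))\<^sup>2) \<partial>lborel)"
      unfolding I_def gw of_real_mult[symmetric] by (simp only: integral_complex_of_real)
    then show ?thesis unfolding gaussian_mean_fourier_integral[OF f c_pos] A_def .
  qed
  have A_meas [measurable]: "A \<in> borel_measurable borel" unfolding A_def by measurable
  have "(\<lambda>n. \<integral>u. complex_of_real (std_normal_density u) * A (c n * u) \<partial>lborel)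
      \<longlonglongrightarrow> (\<integral>u. complex_of_real (std_normal_density u) * complex_of_real ((norm_L2 f)\<^sup>2) \<partial>lborel)"
  proof (rule integral_dominated_convergence[where w="\<lambda>u. std_normal_density u * (norm_L2 f)\<^sup>2"])
    show "integrable lborel (\<lambda>u. std_normal_density u * (norm_L2 f)\<^sup>2)" using integrable_std_normal by simp
    show "AE u in lborel. (\<lambda>n. complex_of_real (std_normal_density u) * A (c n * u))
        \<longlonglongrightarrow> complex_of_real (std_normal_density u) * complex_of_real ((norm_L2 f)\<^sup>2)"
      by (intro AE_I2 tendsto_mult tendsto_const A_lim)
    show "AE u in lborel. norm (complex_of_real (std_normal_density u) * A (c n * u)) \<le> std_normal_density u * (norm_L2 f)\<^sup>2" for n
      using A_le by (intro AE_I2) (simp add: norm_mult mult_left_mono)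
  qed simp_all
  also have "(\<integral>u. complex_of_real (std_normal_density u) * complex_of_real ((norm_L2 f)\<^sup>2) \<partial>lborel) = complex_of_real ((norm_L2 f)\<^sup>2)"
    using integral_std_normal_cis[of 0] by simp
  finally have "(\<lambda>n. complex_of_real (\<integral>\<xi>. I n \<xi> \<partial>lborel)) \<longlonglongrightarrow> complex_of_real ((norm_L2 f)\<^sup>2)"
    unfolding I_eq .
  then have I_lim: "(\<lambda>n. \<integral>\<xi>. I n \<xi> \<partial>lborel) \<longlonglongrightarrow> (norm_L2 f)\<^sup>2" by (simp only: tendsto_of_real_iff)
  have I_mono: "AE \<xi> in lborel. mono (\<lambda>n. I n \<xi>)"
  proof (intro AE_I2 monoI)
    fix \<xi> and m n :: nat assume "m \<le> n"
    then have "c n \<le> c m" by (simp add: c_def frac_le)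
    then have "\<bar>2 * pi * c n * \<xi>\<bar> \<le> \<bar>2 * pi * c m * \<xi>\<bar>"
      using c_pos[of n] c_pos[of m] by (simp add: abs_mult mult_mono)
    then have "(2 * pi * c n * \<xi>)\<^sup>2 \<le> (2 * pi * c m * \<xi>)\<^sup>2" by (simp only: abs_le_square_iff)
    then show "I m \<xi> \<le> I n \<xi>" unfolding I_def g_def by (intro mult_right_mono) auto
  qed
  have I_conv: "AE \<xi> in lborel. (\<lambda>n. I n \<xi>) \<longlonglongrightarrow> (cmod (fourier_integral f \<xi>))\<^sup>2"
  proof (rule AE_I2)
    fix \<xi>
    have "(\<lambda>n. I n \<xi>) \<longlonglongrightarrow> exp (- (2 * pi * 0 * \<xi>)\<^sup>2 / 2) * (cmod (fourier_integral f \<xi>))\<^sup>2"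
      unfolding I_def g_def by (intro tendsto_intros c_lim) simp_all
    then show "(\<lambda>n. I n \<xi>) \<longlonglongrightarrow> (cmod (fourier_integral f \<xi>))\<^sup>2" by simp
  qed
  have I_nonneg: "AE \<xi> in lborel. 0 \<le> I n \<xi>" for n by (simp add: I_def g_def)
  have meas: "(\<lambda>\<xi>. (cmod (fourier_integral f \<xi>))\<^sup>2) \<in> borel_measurable lborel" by measurable
  note conv = integral_monotone_convergence_nonneg[OF I_int I_mono I_nonneg I_conv I_lim meas]
  show "fourier_integral f \<in> L2" by (rule L2_I[OF _ conv(1)]) measurable
  show "norm_L2 (fourier_integral f) = norm_L2 f"
    unfolding norm_L2_def[of "fourier_integral f"] conv(2) by simp
qed


lemma fourier_truncated_eq: "fourier_truncated N f = fourier_integral (truncate N f)"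
proof
  fix \<xi>
  have "exp (- 2 * of_real pi * \<i> * of_real t * of_real \<xi>) = cis (- (2 * pi * t * \<xi>))" for t
    by (simp add: cis_conv_exp mult_ac)
  then show "fourier_truncated N f \<xi> = fourier_integral (truncate N f) \<xi>"
    unfolding fourier_truncated_def fourier_integral_def set_lebesgue_integral_def truncate_def
    by (intro Bochner_Integration.integral_cong refl) (simp add: indicator_def)
qed

lemma fourier_truncated_L2: "f \<in> L2 \<Longrightarrow> fourier_truncated N f \<in> L2"
  unfolding fourier_truncated_eq by (rule Plancherel_integrable) (simp_all add: truncate_integrable)

text \<open>
  Plancherel's theorem for the differences of truncations makes the truncated transforms a Cauchy
  sequence; so the choice operator in the definition of \<open>fourier_L2\<close> picks an actual limit.
\<close>

lemma fourier_L2_limit: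
  assumes f: "f \<in> L2"
  shows "fourier_L2 f \<in> L2"
    and "(\<lambda>N. norm_L2 (\<lambda>\<xi>. fourier_L2 f \<xi> - fourier_truncated N f \<xi>)) \<longlonglongrightarrow> 0"
proof -
  have dist: "norm_L2 (\<lambda>\<xi>. fourier_truncated m f \<xi> - fourier_truncated n f \<xi>)
      = norm_L2 (\<lambda>t. truncate m f t - truncate n f t)" for m n
  proof -
    have "(\<lambda>\<xi>. fourier_truncated m f \<xi> - fourier_truncated n f \<xi>)
        = fourier_integral (\<lambda>t. truncate m f t - truncate n f t)"
      unfolding fourier_truncated_eq
      by (rule ext) (rule fourier_integral_diff[OF truncate_integrable[OF f] truncate_integrable[OF f], symmetric])
    then show ?thesis
      using Plancherel_integrable(2)[OF L2_diff, of "truncate m f" "truncate n f"] f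
      by (simp add: truncate_integrable)
  qed
  have "\<exists>g\<in>L2. (\<lambda>N. norm_L2 (\<lambda>\<xi>. g \<xi> - fourier_truncated N f \<xi>)) \<longlonglongrightarrow> 0"
  proof (rule L2_complete)
    fix \<epsilon> :: real assume "\<epsilon> > 0"
    from LIMSEQ_D[OF truncate_tendsto[OF f], of "\<epsilon> / 2"] obtain M where
      M: "\<And>N. N \<ge> M \<Longrightarrow> norm_L2 (\<lambda>t. f t - truncate N f t) < \<epsilon> / 2" using \<open>\<epsilon> > 0\<close> by auto
    have "norm_L2 (\<lambda>\<xi>. fourier_truncated m f \<xi> - fourier_truncated n f \<xi>) < \<epsilon>" if "m \<ge> M" "n \<ge> M" for m n
      using norm_L2_triangle_mid[OF truncate_L2[OF f, of m] f truncate_L2[OF f, of n]] M[OF that(1)] M[OF that(2)]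
      unfolding dist norm_L2_minus_commute[of "truncate m f" f] by linarith
    then show "\<exists>M. \<forall>m\<ge>M. \<forall>n\<ge>M. norm_L2 (\<lambda>\<xi>. fourier_truncated m f \<xi> - fourier_truncated n f \<xi>) < \<epsilon>"
      by blast
  qed (rule fourier_truncated_L2[OF f])
  then have "\<exists>g. g \<in> L2 \<and> (\<lambda>N. norm_L2 (\<lambda>\<xi>. g \<xi> - fourier_truncated N f \<xi>)) \<longlonglongrightarrow> 0" by blast
  from someI_ex[OF this] show "fourier_L2 f \<in> L2"
    "(\<lambda>N. norm_L2 (\<lambda>\<xi>. fourier_L2 f \<xi> - fourier_truncated N f \<xi>)) \<longlonglongrightarrow> 0"
    unfolding fourier_L2_def[symmetric] by blast+
qed

lemma cmod_cis_diff_le: "cmod (cis x - cis y) \<le> \<bar>x - y\<bar>"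
proof -
  have "cis x - cis y = cis y * (iexp (x - y) - 1)"
    by (simp add: cis_conv_exp[symmetric] right_diff_distrib cis_mult del: of_real_diff)
  then have "cmod (cis x - cis y) = cmod (iexp (x - y) - 1)" by (simp add: norm_mult)
  also have "\<dots> \<le> \<bar>x - y\<bar>" using iexp_approx1[of "x - y" 0] by simp
  finally show ?thesis .
qed

lemma L2_cis_mult:
  assumes "f \<in> L2" "g \<in> borel_measurable borel"
  shows "(\<lambda>t. cis (g t) * f t) \<in> L2"
proof (rule L2_dominated[OF assms(1), where C=1])
  note [measurable] = L2_measurable[OF assms(1)] assms(2)
  show "(\<lambda>t. cis (g t) * f t) \<in> borel_measurable borel" by measurable
qed (simp add: norm_mult)

text \<open>
  On the Fourier side the operator is multiplication by \<open>m \<xi> = cis (2 \<pi> h \<xi>) - cis (2 \<pi> b h)\<close>, and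
  \<open>\<bar>m \<xi>\<bar> \<le> 2 \<pi> \<bar>h\<bar> \<bar>\<xi> - b\<bar>\<close>. Plancherel's theorem for integrable functions applies
  to truncations, and both errors of truncation vanish in the limit.
\<close>

theorem translate_close_to_modulation:
  assumes f: "f \<in> L2" and mom: "p_moment 2 (fourier_L2 f) b \<le> ennreal (B\<^sup>2)" and "B \<ge> 0"
  shows "norm_L2 (\<lambda>t. f (t + h) - cis (2 * pi * b * h) * f t) \<le> 2 * pi * B * \<bar>h\<bar>"
proof -
  define F where "F = fourier_L2 f"
  have F: "F \<in> L2" unfolding F_def by (rule fourier_L2_limit(1)[OF f])
  have [measurable]: "F \<in> borel_measurable borel" "f \<in> borel_measurable borel"
    using F f by (auto intro: L2_measurable)
  define m where "m = (\<lambda>\<xi>. cis (2 * pi * h * \<xi>) - cis (2 * pi * b * h))"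
  have [measurable]: "m \<in> borel_measurable borel" unfolding m_def by measurable
  have m2: "cmod (m \<xi>) \<le> 2" for \<xi>
    unfolding m_def using norm_triangle_ineq4[of "cis (2 * pi * h * \<xi>)" "cis (2 * pi * b * h)"] by simp
  have m_le: "cmod (m \<xi>) \<le> 2 * pi * \<bar>h\<bar> * \<bar>\<xi> - b\<bar>" for \<xi>
  proof -
    have "2 * pi * h * \<xi> - 2 * pi * b * h = 2 * pi * h * (\<xi> - b)" by (simp add: algebra_simps)
    then show ?thesis using cmod_cis_diff_le[of "2 * pi * h * \<xi>" "2 * pi * b * h"]
      by (simp add: m_def abs_mult)
  qed
  have mL2: "(\<lambda>\<xi>. m \<xi> * g \<xi>) \<in> L2" if "g \<in> L2" for g
  proof (rule L2_dominated[OF that, where C=2])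
    have [measurable]: "g \<in> borel_measurable borel" using that by (rule L2_measurable)
    show "(\<lambda>\<xi>. m \<xi> * g \<xi>) \<in> borel_measurable borel" by measurable
    show "cmod (m \<xi> * g \<xi>) \<le> 2 * cmod (g \<xi>)" for \<xi> using m2 by (simp add: norm_mult mult_right_mono)
  qed
  have mF: "norm_L2 (\<lambda>\<xi>. m \<xi> * F \<xi>) \<le> 2 * pi * B * \<bar>h\<bar>"
  proof -
    define w where "w = (\<lambda>\<xi>. complex_of_real (\<xi> - b) * F \<xi>)"
    have [measurable]: "w \<in> borel_measurable borel" unfolding w_def by measurable
    have wsq: "(cmod (w \<xi>))\<^sup>2 = \<bar>\<xi> - b\<bar> powr 2 * (cmod (F \<xi>))\<^sup>2" for \<xi>
      by (simp add: w_def norm_mult power_mult_distrib powr_numeral del: of_real_diff)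
    have nn: "(\<integral>\<^sup>+\<xi>. ennreal ((cmod (w \<xi>))\<^sup>2) \<partial>lborel) \<le> ennreal (B\<^sup>2)"
      using mom unfolding p_moment_def wsq F_def .
    have w: "w \<in> L2"
      by (rule L2_I, measurable, rule integrableI_bounded) (use nn in \<open>auto simp: le_less_trans\<close>)
    have "ennreal ((norm_L2 w)\<^sup>2) \<le> ennreal (B\<^sup>2)"
      using nn by (subst (asm) nn_integral_eq_integral) (auto simp: norm_L2_power2 L2_integrable[OF w])
    then have wB: "norm_L2 w \<le> B" using \<open>B \<ge> 0\<close> by (auto intro: power2_le_imp_le)
    have "norm_L2 (\<lambda>\<xi>. m \<xi> * F \<xi>) \<le> norm_L2 (\<lambda>\<xi>. complex_of_real (2 * pi * \<bar>h\<bar>) * w \<xi>)"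
    proof (rule norm_L2_mono[OF L2_cmult[OF w]])
      fix \<xi>
      have "cmod (m \<xi> * F \<xi>) \<le> 2 * pi * \<bar>h\<bar> * \<bar>\<xi> - b\<bar> * cmod (F \<xi>)"
        unfolding norm_mult by (intro mult_right_mono m_le) simp
      also have "\<dots> = cmod (complex_of_real (2 * pi * \<bar>h\<bar>) * w \<xi>)"
        unfolding w_def norm_mult norm_of_real by (simp add: abs_mult)
      finally show "cmod (m \<xi> * F \<xi>) \<le> cmod (complex_of_real (2 * pi * \<bar>h\<bar>) * w \<xi>)" .
    qed measurable
    also have "\<dots> = 2 * pi * \<bar>h\<bar> * norm_L2 w"
      unfolding norm_L2_cmult norm_of_real by (simp add: abs_mult)
    also have "\<dots> \<le> 2 * pi * \<bar>h\<bar> * B" by (intro mult_left_mono wB) simp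
    finally show ?thesis by (simp add: mult_ac)
  qed
  define D where "D = (\<lambda>g :: real \<Rightarrow> complex. \<lambda>t. g (t + h) - cis (2 * pi * b * h) * g t)"
  have D_L2: "D g \<in> L2" if "g \<in> L2" for g
    unfolding D_def by (intro L2_diff L2_translate L2_cmult that)
  have D_diff: "norm_L2 (\<lambda>t. D f t - D g t) \<le> 2 * norm_L2 (\<lambda>t. f t - g t)" if "g \<in> L2" for g
  proof -
    have d: "(\<lambda>t. f t - g t) \<in> L2" using f that by (rule L2_diff)
    have "(\<lambda>t. D f t - D g t) = (\<lambda>t. (f (t + h) - g (t + h)) - cis (2 * pi * b * h) * (f t - g t))"
      by (simp add: D_def algebra_simps)
    then show ?thesis
      using norm_L2_triangle_sub[OF L2_translate[OF d, of h] L2_cmult[OF d, of "cis (2 * pi * b * h)"]]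
        norm_L2_translate[of "\<lambda>t. f t - g t" h] by (simp add: norm_L2_cmult)
  qed
  have D_trunc: "norm_L2 (D (truncate N f)) \<le> 2 * pi * B * \<bar>h\<bar> + 2 * norm_L2 (\<lambda>\<xi>. F \<xi> - fourier_truncated N f \<xi>)" for N
  proof -
    define g where "g = truncate N f"
    have g: "g \<in> L2" "integrable lborel g" using f by (auto simp: g_def truncate_integrable)
    have g': "integrable lborel (\<lambda>t. g (t + h))"
      using lborel_integrable_real_affine[OF g(2), of 1 h] by (simp add: add.commute)
    have Dg_int: "integrable lborel (D g)" unfolding D_def using g' g(2) by simp
    have "fourier_integral (D g) = (\<lambda>\<xi>. m \<xi> * fourier_integral g \<xi>)"
      unfolding D_def using g(2) g'
      by (intro ext, subst fourier_integral_diff) (auto simp: fourier_integral_translate fourier_integral_cmult m_def left_diff_distrib)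
    then have eq: "norm_L2 (D g) = norm_L2 (\<lambda>\<xi>. m \<xi> * fourier_integral g \<xi>)"
      using Plancherel_integrable(2)[OF D_L2[OF g(1)] Dg_int] by simp
    have Fg: "fourier_integral g \<in> L2" using g by (rule Plancherel_integrable)
    have r1: "norm_L2 (\<lambda>\<xi>. m \<xi> * fourier_integral g \<xi>)
        \<le> norm_L2 (\<lambda>\<xi>. m \<xi> * F \<xi>) + norm_L2 (\<lambda>\<xi>. m \<xi> * F \<xi> - m \<xi> * fourier_integral g \<xi>)"
      using norm_L2_reverse_triangle[OF mL2[OF F] mL2[OF Fg]] by linarith
    have r2: "norm_L2 (\<lambda>\<xi>. m \<xi> * F \<xi> - m \<xi> * fourier_integral g \<xi>)
        \<le> norm_L2 (\<lambda>\<xi>. 2 * (F \<xi> - fourier_integral g \<xi>))"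
    proof (rule norm_L2_mono[OF L2_cmult[OF L2_diff[OF F Fg]]])
      have [measurable]: "fourier_integral g \<in> borel_measurable borel" using Fg by (rule L2_measurable)
      show "(\<lambda>\<xi>. m \<xi> * F \<xi> - m \<xi> * fourier_integral g \<xi>) \<in> borel_measurable borel" by measurable
      show "cmod (m \<xi> * F \<xi> - m \<xi> * fourier_integral g \<xi>) \<le> cmod (2 * (F \<xi> - fourier_integral g \<xi>))" for \<xi>
        unfolding right_diff_distrib[symmetric] norm_mult using m2 by (simp add: mult_right_mono)
    qed
    have r3: "norm_L2 (\<lambda>\<xi>. 2 * (F \<xi> - fourier_integral g \<xi>)) = 2 * norm_L2 (\<lambda>\<xi>. F \<xi> - fourier_truncated N f \<xi>)"
      unfolding norm_L2_cmult fourier_truncated_eq g_def by simp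
    show ?thesis using r1 r2 r3 mF eq unfolding g_def by linarith
  qed
  have "norm_L2 (D f) \<le> 2 * pi * B * \<bar>h\<bar> + (2 * norm_L2 (\<lambda>\<xi>. F \<xi> - fourier_truncated N f \<xi>)
      + 2 * norm_L2 (\<lambda>t. f t - truncate N f t))" for N
    using norm_L2_reverse_triangle[OF D_L2[OF f] D_L2[OF truncate_L2[OF f, of N]]]
      D_diff[OF truncate_L2[OF f, of N]] D_trunc[of N] by linarith
  moreover have "(\<lambda>N. 2 * pi * B * \<bar>h\<bar> + (2 * norm_L2 (\<lambda>\<xi>. F \<xi> - fourier_truncated N f \<xi>)
      + 2 * norm_L2 (\<lambda>t. f t - truncate N f t))) \<longlonglongrightarrow> 2 * pi * B * \<bar>h\<bar> + (2 * 0 + 2 * 0)"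
    unfolding F_def by (intro tendsto_intros fourier_L2_limit(2) truncate_tendsto f)
  ultimately have "norm_L2 (D f) \<le> 2 * pi * B * \<bar>h\<bar> + (2 * 0 + 2 * 0)"
    by (intro LIMSEQ_le_const[where a="norm_L2 (D f)"]) auto
  then show ?thesis by (simp add: D_def)
qed

section \<open>Moments and the p-mean\<close>

text \<open>
  By the mean value theorem on both halves of the interval, as the derivative of
  \<open>z powr p\<close> is strictly increasing for \<open>p > 1\<close>.
\<close>

lemma powr_midpoint_less:
  fixes u v p :: real
  assumes "p > 1" "0 \<le> u" "u < v"
  shows "((u + v) / 2) powr p < (u powr p + v powr p) / 2"
proof -
  define s where "s = (u + v) / 2"
  have s: "u < s" "s < v" "s - u = v - s" using assms by (auto simp: s_def field_simps)
  have cont: "continuous_on {a..b} (\<lambda>z. z powr p)" if "0 \<le> a" for a b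
    using that assms(1) by (intro continuous_on_powr') (auto intro: continuous_intros)
  have deriv: "((\<lambda>z. z powr p) has_real_derivative p * z powr (p - 1)) (at z)" if "z > 0" for z
    using that by (rule has_real_derivative_powr)
  have mv: "\<exists>z. a < z \<and> z < b \<and> b powr p - a powr p = (b - a) * (p * z powr (p - 1))"
    if "0 \<le> a" "a < b" for a b
  proof -
    have "\<exists>l z. a < z \<and> z < b \<and> ((\<lambda>z. z powr p) has_real_derivative l) (at z) \<and> b powr p - a powr p = (b - a) * l"
    proof (rule MVT[OF that(2) cont[OF that(1)]])
      fix x assume "a < x" "x < b"
      then show "(\<lambda>z. z powr p) differentiable (at x)"
        using deriv[of x] that(1) by (auto simp: real_differentiable_def)
    qed
    then obtain l z where z: "a < z" "z < b" "((\<lambda>z. z powr p) has_real_derivative l) (at z)"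
      "b powr p - a powr p = (b - a) * l" by blast
    have "l = p * z powr (p - 1)" using DERIV_unique[OF z(3) deriv] z(1) that(1) by simp
    then show ?thesis using z by blast
  qed
  obtain y where y: "u < y" "y < s" "s powr p - u powr p = (s - u) * (p * y powr (p - 1))"
    using mv[OF assms(2) s(1)] by blast
  obtain z where z: "s < z" "z < v" "v powr p - s powr p = (v - s) * (p * z powr (p - 1))"
    using mv[OF _ s(2)] s(1) assms(2) by auto
  have "y powr (p - 1) < z powr (p - 1)" using y z assms by (intro powr_less_mono2) auto
  then have "s powr p - u powr p < v powr p - s powr p"
    unfolding y(3) z(3) s(3) using s(2) assms(1) by (intro mult_strict_left_mono) auto
  then show ?thesis by (simp add: s_def)
qed

lemma abs_powr_midpoint_less:
  fixes x y p :: real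
  assumes "p > 1" "x \<noteq> y"
  shows "\<bar>(x + y) / 2\<bar> powr p < (\<bar>x\<bar> powr p + \<bar>y\<bar> powr p) / 2"
proof (cases "\<bar>x\<bar> = \<bar>y\<bar>")
  case True
  then have "y = - x" "x \<noteq> 0" using assms(2) by (auto simp: abs_if split: if_splits)
  then show ?thesis using assms(1) by simp
next
  case False
  have "\<bar>(x + y) / 2\<bar> powr p \<le> ((\<bar>x\<bar> + \<bar>y\<bar>) / 2) powr p"
    using assms(1) by (intro powr_mono2) auto
  also have "\<dots> < (\<bar>x\<bar> powr p + \<bar>y\<bar> powr p) / 2"
    using powr_midpoint_less[OF assms(1), of "\<bar>x\<bar>" "\<bar>y\<bar>"] powr_midpoint_less[OF assms(1), of "\<bar>y\<bar>" "\<bar>x\<bar>"] False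
    by (cases "\<bar>x\<bar> < \<bar>y\<bar>") (auto simp: add.commute)
  finally show ?thesis .
qed

lemma abs_powr_add_le:
  fixes x y p :: real
  assumes "p \<ge> 0"
  shows "\<bar>x + y\<bar> powr p \<le> 2 powr p * (\<bar>x\<bar> powr p + \<bar>y\<bar> powr p)"
proof -
  have "\<bar>x + y\<bar> powr p \<le> (2 * max \<bar>x\<bar> \<bar>y\<bar>) powr p"
    using assms by (intro powr_mono2) auto
  also have "\<dots> = 2 powr p * (max \<bar>x\<bar> \<bar>y\<bar>) powr p" by (simp add: powr_mult)
  also have "\<dots> \<le> 2 powr p * (\<bar>x\<bar> powr p + \<bar>y\<bar> powr p)"
    by (intro mult_left_mono) (auto simp: max_def)
  finally show ?thesis .
qed

lemma p_moment_integral: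
  assumes "p > 1" and h: "h \<in> L2" and fin: "p_moment p h 0 \<noteq> \<infinity>"
  shows "integrable lborel (\<lambda>t. \<bar>t - a\<bar> powr p * (cmod (h t))\<^sup>2)"
    and "p_moment p h a = ennreal (\<integral>t. \<bar>t - a\<bar> powr p * (cmod (h t))\<^sup>2 \<partial>lborel)"
proof -
  have [measurable]: "h \<in> borel_measurable borel" using h by (rule L2_measurable)
  have int0: "integrable lborel (\<lambda>t. \<bar>t\<bar> powr p * (cmod (h t))\<^sup>2)"
  proof (rule integrableI_bounded)
    show "(\<integral>\<^sup>+t. ennreal (norm (\<bar>t\<bar> powr p * (cmod (h t))\<^sup>2)) \<partial>lborel) < \<infinity>"
      using fin by (simp add: p_moment_def less_top)
  qed measurable
  show int: "integrable lborel (\<lambda>t. \<bar>t - a\<bar> powr p * (cmod (h t))\<^sup>2)"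
  proof (rule Bochner_Integration.integrable_bound)
    show "integrable lborel (\<lambda>t. 2 powr p * (\<bar>t\<bar> powr p * (cmod (h t))\<^sup>2 + \<bar>a\<bar> powr p * (cmod (h t))\<^sup>2))"
      using int0 L2_integrable[OF h] by simp
    show "AE t in lborel. norm (\<bar>t - a\<bar> powr p * (cmod (h t))\<^sup>2)
        \<le> norm (2 powr p * (\<bar>t\<bar> powr p * (cmod (h t))\<^sup>2 + \<bar>a\<bar> powr p * (cmod (h t))\<^sup>2))"
    proof (rule AE_I2)
      fix t
      have "\<bar>t - a\<bar> powr p * (cmod (h t))\<^sup>2 \<le> 2 powr p * (\<bar>t\<bar> powr p + \<bar>a\<bar> powr p) * (cmod (h t))\<^sup>2"
        using abs_powr_add_le[of p t "- a"] assms(1) by (intro mult_right_mono) auto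
      then show "norm (\<bar>t - a\<bar> powr p * (cmod (h t))\<^sup>2)
        \<le> norm (2 powr p * (\<bar>t\<bar> powr p * (cmod (h t))\<^sup>2 + \<bar>a\<bar> powr p * (cmod (h t))\<^sup>2))"
        by (simp add: algebra_simps)
    qed
  qed measurable
  show "p_moment p h a = ennreal (\<integral>t. \<bar>t - a\<bar> powr p * (cmod (h t))\<^sup>2 \<partial>lborel)"
    unfolding p_moment_def by (rule nn_integral_eq_integral[OF int]) simp
qed

text \<open>
  The moment is a real-valued function of the point \<open>a\<close>, continuous by dominated convergence and
  larger than its value at \<open>0\<close> outside \<open>{-R..R}\<close>; so it attains a minimum. Two minimizers would
  contradict strict convexity at their midpoint. Existence and uniqueness are both necessary for the
  description operator in \<open>p_mean\<close> to denote a minimizer.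
\<close>

theorem p_mean_minimizes:
  assumes p: "p > 1" and h: "h \<in> L2" "norm_L2 h = 1" and fin: "p_moment p h 0 \<noteq> \<infinity>"
  shows "p_moment p h (p_mean p h) \<le> p_moment p h b"
proof -
  have [measurable]: "h \<in> borel_measurable borel" using h(1) by (rule L2_measurable)
  define f where "f = (\<lambda>a. \<integral>t. \<bar>t - a\<bar> powr p * (cmod (h t))\<^sup>2 \<partial>lborel)"
  note int = p_moment_integral(1)[OF p h(1) fin]
  have M: "p_moment p h a = ennreal (f a)" for a unfolding f_def by (rule p_moment_integral(2)[OF p h(1) fin])
  have f_nonneg: "0 \<le> f a" for a unfolding f_def by simp
  have h_int: "(\<integral>t. (cmod (h t))\<^sup>2 \<partial>lborel) = 1" using h(2) norm_L2_power2[of h] by simp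
  have coercive: "\<bar>a\<bar> powr p \<le> 2 powr p * (f a + f 0)" for a
  proof -
    have "\<bar>a\<bar> powr p = (\<integral>t. \<bar>a\<bar> powr p * (cmod (h t))\<^sup>2 \<partial>lborel)" by (simp add: h_int)
    also have "\<dots> \<le> (\<integral>t. 2 powr p * (\<bar>t - a\<bar> powr p * (cmod (h t))\<^sup>2 + \<bar>t - 0\<bar> powr p * (cmod (h t))\<^sup>2) \<partial>lborel)"
    proof (rule integral_mono)
      fix t
      have "\<bar>a\<bar> powr p * (cmod (h t))\<^sup>2 \<le> 2 powr p * (\<bar>t - a\<bar> powr p + \<bar>t\<bar> powr p) * (cmod (h t))\<^sup>2"
        using abs_powr_add_le[of p "a - t" t] p by (intro mult_right_mono) (auto simp: abs_minus_commute)
      then show "\<bar>a\<bar> powr p * (cmod (h t))\<^sup>2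
          \<le> 2 powr p * (\<bar>t - a\<bar> powr p * (cmod (h t))\<^sup>2 + \<bar>t - 0\<bar> powr p * (cmod (h t))\<^sup>2)"
        by (simp add: algebra_simps)
    qed (use int L2_integrable[OF h(1)] in \<open>auto intro: int[of 0, simplified]\<close>)
    also have "\<dots> = 2 powr p * (f a + f 0)" unfolding f_def using int[of a] int[of 0] by simp
    finally show ?thesis .
  qed
  \<comment> \<open>Beyond this radius, \<open>coercive\<close> forces \<open>f a > f 0\<close>.\<close>
  define R where "R = 2 * (2 * f 0 + 1) powr (1 / p)"
  have R: "f 0 < f a" if "\<bar>a\<bar> > R" for a
  proof -
    have "R powr p = 2 powr p * (2 * f 0 + 1)"
      unfolding R_def using f_nonneg[of 0] p by (simp add: powr_mult powr_powr)
    moreover have "R powr p < \<bar>a\<bar> powr p" using that p by (intro powr_less_mono2) (auto simp: R_def)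
    ultimately have "2 powr p * (2 * f 0 + 1) < 2 powr p * (f a + f 0)" using coercive[of a] by linarith
    then show ?thesis by simp
  qed
  have R0: "R \<ge> 0" by (simp add: R_def)
  have "continuous_on {-R..R} f"
    unfolding continuous_on_sequentially
  proof (intro ballI allI impI)
    fix x a assume "a \<in> {-R..R}" "(\<forall>n. x n \<in> {-R..R}) \<and> x \<longlonglongrightarrow> a" 
    then have xR: "x n \<in> {-R..R}" and x_lim: "x \<longlonglongrightarrow> a" for n by blast+
    have x_le: "\<bar>x n\<bar> \<le> R" for n using xR[of n] unfolding atLeastAtMost_iff by linarith
    note x = x_le x_lim
    have "(\<lambda>n. f (x n)) \<longlonglongrightarrow> f a"
      unfolding f_def
    proof (rule integral_dominated_convergence)
      show "integrable lborel (\<lambda>t. 2 powr p * (\<bar>t - 0\<bar> powr p * (cmod (h t))\<^sup>2 + R powr p * (cmod (h t))\<^sup>2))"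
        using int[of 0] L2_integrable[OF h(1)] by simp
      show "AE t in lborel. (\<lambda>n. \<bar>t - x n\<bar> powr p * (cmod (h t))\<^sup>2) \<longlonglongrightarrow> \<bar>t - a\<bar> powr p * (cmod (h t))\<^sup>2"
        using x(2) p by (intro AE_I2 tendsto_mult tendsto_const tendsto_powr' tendsto_rabs tendsto_diff) auto
      show "AE t in lborel. norm (\<bar>t - x n\<bar> powr p * (cmod (h t))\<^sup>2)
          \<le> 2 powr p * (\<bar>t - 0\<bar> powr p * (cmod (h t))\<^sup>2 + R powr p * (cmod (h t))\<^sup>2)" for n
      proof (rule AE_I2)
        fix t
        have "\<bar>t - x n\<bar> powr p \<le> 2 powr p * (\<bar>t\<bar> powr p + \<bar>x n\<bar> powr p)"
          using abs_powr_add_le[of p t "- x n"] p by simp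
        also have "\<dots> \<le> 2 powr p * (\<bar>t\<bar> powr p + R powr p)"
          using x(1)[of n] p by (intro mult_left_mono add_left_mono powr_mono2) auto
        finally have "\<bar>t - x n\<bar> powr p * (cmod (h t))\<^sup>2 \<le> 2 powr p * (\<bar>t\<bar> powr p + R powr p) * (cmod (h t))\<^sup>2"
          by (rule mult_right_mono) simp
        then show "norm (\<bar>t - x n\<bar> powr p * (cmod (h t))\<^sup>2)
          \<le> 2 powr p * (\<bar>t - 0\<bar> powr p * (cmod (h t))\<^sup>2 + R powr p * (cmod (h t))\<^sup>2)"
          by (simp add: algebra_simps)
      qed
    qed measurable
    then show "(f \<circ> x) \<longlonglongrightarrow> f a" by (simp add: o_def)
  qed
  then obtain a where a: "a \<in> {-R..R}" "\<And>y. y \<in> {-R..R} \<Longrightarrow> f a \<le> f y"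
    using continuous_attains_inf[of "{-R..R}" f] R0 by auto
  have min: "f a \<le> f y" for y
  proof (cases "y \<in> {-R..R}")
    case False
    then have "\<bar>y\<bar> > R" by auto
    then show ?thesis using R[of y] a(2)[of 0] R0 by simp
  qed (rule a(2))
  have uniq: "a' = a" if "\<And>y. f a' \<le> f y" for a'
  proof (rule ccontr)
    assume "a' \<noteq> a"
    define m where "m = (a + a') / 2"
    define g where "g = (\<lambda>t. ((\<bar>t - a\<bar> powr p + \<bar>t - a'\<bar> powr p) / 2 - \<bar>t - m\<bar> powr p))"
    have g_pos: "g t > 0" for t
    proof -
      have "((t - a) + (t - a')) / 2 = t - m" by (simp add: m_def field_simps)
      moreover have "\<bar>((t - a) + (t - a')) / 2\<bar> powr p < (\<bar>t - a\<bar> powr p + \<bar>t - a'\<bar> powr p) / 2"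
        using \<open>a' \<noteq> a\<close> by (intro abs_powr_midpoint_less p) simp
      ultimately have "\<bar>t - m\<bar> powr p < (\<bar>t - a\<bar> powr p + \<bar>t - a'\<bar> powr p) / 2" by (simp only:)
      then show ?thesis unfolding g_def by linarith
    qed
    have g_eq: "g t * (cmod (h t))\<^sup>2 = (\<bar>t - a\<bar> powr p * (cmod (h t))\<^sup>2 + \<bar>t - a'\<bar> powr p * (cmod (h t))\<^sup>2) / 2
        - \<bar>t - m\<bar> powr p * (cmod (h t))\<^sup>2" for t
      by (simp add: g_def field_simps)
    have g_nonneg: "0 \<le> g t * (cmod (h t))\<^sup>2" for t using g_pos[of t] by simp
    have g_int: "integrable lborel (\<lambda>t. g t * (cmod (h t))\<^sup>2)" unfolding g_eq using int by simp
    have "(\<integral>t. g t * (cmod (h t))\<^sup>2 \<partial>lborel) = (f a + f a') / 2 - f m"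
      unfolding g_eq f_def using int by simp
    also have "\<dots> \<le> 0" using that[of a] min[of a'] that[of m] min[of m] by simp
    finally have "(\<integral>t. g t * (cmod (h t))\<^sup>2 \<partial>lborel) = 0"
      using g_nonneg by (intro antisym integral_nonneg_AE) simp_all
    then have "AE t in lborel. g t * (cmod (h t))\<^sup>2 = 0"
      using g_nonneg by (subst (asm) integral_nonneg_eq_0_iff_AE[OF g_int]) simp_all
    then have "AE t in lborel. (cmod (h t))\<^sup>2 = 0"
    proof eventually_elim
      case (elim t)
      then show ?case using g_pos[of t] by simp
    qed
    then have "(\<integral>t. (cmod (h t))\<^sup>2 \<partial>lborel) = 0" by (rule integral_eq_zero_AE)
    with h_int show False by simp
  qed
  have "p_mean p h = a"
    unfolding p_mean_def
  proof (rule the_equality)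
    show "\<forall>b. p_moment p h a \<le> p_moment p h b" using min by (simp add: M ennreal_leI)
    show "a' = a" if "\<forall>b. p_moment p h a' \<le> p_moment p h b" for a'
      using that f_nonneg by (intro uniq) (simp add: M)
  qed
  then show ?thesis using min by (simp add: M ennreal_leI)
qed

lemma INF_p_moment_le:
  assumes "\<bar>p_dispersion p h\<bar> \<le> ereal A"
  shows "p_moment p h 0 \<noteq> \<infinity>" "(INF a. p_moment p h a) \<le> ennreal (A\<^sup>2)"
proof -
  show fin: "p_moment p h 0 \<noteq> \<infinity>" using assms by (auto simp: p_dispersion_def)
  have "(INF a. p_moment p h a) \<le> p_moment p h 0" by (rule INF_lower) simp
  with fin have fin': "(INF a. p_moment p h a) < top" by (simp add: less_top top_unique le_less_trans)
  have "sqrt (enn2real (INF a. p_moment p h a)) \<le> A" using assms fin by (simp add: p_dispersion_def)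
  then have "enn2real (INF a. p_moment p h a) \<le> A\<^sup>2"
    by (metis enn2real_nonneg real_sqrt_le_iff real_sqrt_pow2_iff power_mono real_sqrt_ge_zero)
  then show "(INF a. p_moment p h a) \<le> ennreal (A\<^sup>2)"
    using fin' by (metis ennreal_enn2real ennreal_leI)
qed

text \<open>
  Chebyshev's inequality about the p-mean. The bound uses \<open>S \<le> S powr p\<close> to be uniform in \<open>p\<close>.
\<close>

lemma time_tail_le:
  assumes p: "p > 1" and h: "h \<in> L2" "norm_L2 h = 1"
    and mean: "\<bar>p_mean p h\<bar> \<le> A" and disp: "\<bar>p_dispersion p h\<bar> \<le> ereal A" and S: "S \<ge> 1"
  shows "norm_L2 (\<lambda>t. (1 - indicator {-(A + S)..A + S} t) * h t) \<le> sqrt (A\<^sup>2 / S)"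
proof -
  have [measurable]: "h \<in> borel_measurable borel" using h(1) by (rule L2_measurable)
  note fin = INF_p_moment_le(1)[OF disp]
  define a where "a = p_mean p h"
  have "p_moment p h a \<le> (INF b. p_moment p h b)"
    unfolding a_def by (intro INF_greatest p_mean_minimizes[OF p h fin])
  also have "\<dots> \<le> ennreal (A\<^sup>2)" by (rule INF_p_moment_le(2)[OF disp])
  finally have "(\<integral>t. \<bar>t - a\<bar> powr p * (cmod (h t))\<^sup>2 \<partial>lborel) \<le> A\<^sup>2"
    unfolding p_moment_integral(2)[OF p h(1) fin] by simp
  moreover have "S * (\<integral>t. (cmod ((1 - indicator {-(A + S)..A + S} t) * h t))\<^sup>2 \<partial>lborel)
      \<le> (\<integral>t. \<bar>t - a\<bar> powr p * (cmod (h t))\<^sup>2 \<partial>lborel)"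
    unfolding integral_mult_right_zero[symmetric]
  proof (rule integral_mono)
    have "(\<lambda>t. (1 - indicator {-(A + S)..A + S} t) * h t) \<in> L2"
      by (rule L2_dominated[OF h(1), where C=1]) (auto simp: indicator_def)
    then show "integrable lborel (\<lambda>t. S * (cmod ((1 - indicator {-(A + S)..A + S} t) * h t))\<^sup>2)"
      by (simp add: L2_integrable)
    show "integrable lborel (\<lambda>t. \<bar>t - a\<bar> powr p * (cmod (h t))\<^sup>2)" by (rule p_moment_integral(1)[OF p h(1) fin])
    fix t
    show "S * (cmod ((1 - indicator {-(A + S)..A + S} t) * h t))\<^sup>2 \<le> \<bar>t - a\<bar> powr p * (cmod (h t))\<^sup>2"
    proof (cases "t \<in> {-(A + S)..A + S}")
      case False
      then have "\<bar>t\<bar> > A + S" by auto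
      then have "\<bar>t - a\<bar> \<ge> S" using mean by (simp add: a_def)
      then have "S powr p \<le> \<bar>t - a\<bar> powr p" using S p by (intro powr_mono2) auto
      moreover have "S powr 1 \<le> S powr p" using S p by (intro powr_mono) auto
      ultimately have "S \<le> \<bar>t - a\<bar> powr p" using S by simp
      then show ?thesis using False by (simp add: mult_right_mono)
    qed simp
  qed
  ultimately have "(\<integral>t. (cmod ((1 - indicator {-(A + S)..A + S} t) * h t))\<^sup>2 \<partial>lborel) \<le> A\<^sup>2 / S"
    using S by (simp add: field_simps)
  then show ?thesis unfolding norm_L2_def by (rule real_sqrt_le_mono)
qed

section \<open>Averages over the cells of a grid\<close>

lemma L2_times_indicator:
  assumes "f \<in> L2" "S \<in> sets borel"
  shows "(\<lambda>t. indicator S t * f t) \<in> L2"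
proof (rule L2_dominated[OF assms(1), where C=1])
  note [measurable] = L2_measurable[OF assms(1)] assms(2)
  show "(\<lambda>t. indicator S t * f t) \<in> borel_measurable borel" by measurable
qed (auto simp: indicator_def)

lemma indicator_L2:
  assumes "S \<in> sets borel" "S \<subseteq> {a..b}"
  shows "(\<lambda>t. indicator S t) \<in> L2"
  by (rule L2_dominated[OF indicator_interval_L2[of a b], where C=1]) (use assms in \<open>auto simp: indicator_def\<close>)

lemma norm_L2_indicator:
  assumes "a \<le> b"
  shows "norm_L2 (\<lambda>t. indicator {a..<b} t) = sqrt (b - a)" "norm_L2 (\<lambda>t. indicator {a..b} t) = sqrt (b - a)"
proof -
  have "(cmod (indicator S t))\<^sup>2 = indicator S t" for S and t :: real by (simp add: indicator_def)
  then show "norm_L2 (\<lambda>t. indicator {a..<b} t) = sqrt (b - a)" "norm_L2 (\<lambda>t. indicator {a..b} t) = sqrt (b - a)"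
    using assms by (simp_all add: norm_L2_def)
qed

definition cell :: "real \<Rightarrow> int \<Rightarrow> real set" where
  "cell \<delta> j = {of_int j * \<delta>..<(of_int j + 1) * \<delta>}"

definition cell_mean :: "real \<Rightarrow> (real \<Rightarrow> complex) \<Rightarrow> int \<Rightarrow> complex" where
  "cell_mean \<delta> G j = (\<integral>s. indicator (cell \<delta> j) s * G s \<partial>lborel) / of_real \<delta>"

lemma cell_measurable [measurable, simp]: "cell \<delta> j \<in> sets borel"
  by (simp add: cell_def)

lemma cell_length: "(of_int j + 1) * \<delta> - of_int j * \<delta> = (\<delta> :: real)"
  by (simp add: algebra_simps)

lemma cell_indicator_L2: "(\<lambda>t. indicator (cell \<delta> j) t) \<in> L2"
  by (rule indicator_L2[where a="of_int j * \<delta>" and b="(of_int j + 1) * \<delta>"]) (auto simp: cell_def)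

lemma norm_cell_indicator: "\<delta> > 0 \<Longrightarrow> norm_L2 (\<lambda>t. indicator (cell \<delta> j) t) = sqrt \<delta>"
  unfolding cell_def by (subst norm_L2_indicator) (auto simp: cell_length algebra_simps)

lemma mem_cell_iff:
  assumes "\<delta> > 0" shows "t \<in> cell \<delta> j \<longleftrightarrow> j = \<lfloor>t / \<delta>\<rfloor>"
  using assms by (auto simp: cell_def floor_eq_iff eq_commute[of j] field_simps)

lemma cmod_cell_mean_le:
  assumes "G \<in> L2" "\<delta> > 0"
  shows "cmod (cell_mean \<delta> G j) \<le> norm_L2 G / sqrt \<delta>"
proof -
  have "cmod (\<integral>s. indicator (cell \<delta> j) s * G s \<partial>lborel) \<le> sqrt \<delta> * norm_L2 G"
    using norm_integral_mult_le[OF cell_indicator_L2 assms(1), of \<delta> j] norm_cell_indicator[OF assms(2)] by simp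
  then have "cmod (cell_mean \<delta> G j) \<le> sqrt \<delta> * norm_L2 G / \<delta>"
    using assms(2) by (simp add: cell_mean_def norm_divide divide_right_mono)
  also have "\<dots> = norm_L2 G / sqrt \<delta>"
    using assms(2) by (simp add: field_simps)
  finally show ?thesis .
qed

text \<open>
  By Cauchy--Schwarz, the squared deviation from the mean over a cell of length \<open>\<delta>\<close> is at most the mean of
  \<open>\<bar>G t - G s\<bar>\<^sup>2\<close> over the \<open>s\<close> in the cell, and these \<open>s\<close> satisfy \<open>\<bar>s - t\<bar> \<le> \<delta>\<close>.
\<close>

lemma cell_deviation_le:
  assumes G: "G \<in> L2" and "\<delta> > 0" and t: "t \<in> cell \<delta> j"
  shows "ennreal ((cmod (G t - cell_mean \<delta> G j))\<^sup>2)
      \<le> ennreal (1 / \<delta>) * (\<integral>\<^sup>+h. indicator {-\<delta>..\<delta>} h * ennreal ((cmod (G (t + h) - G t))\<^sup>2) \<partial>lborel)"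
proof -
  have [measurable]: "G \<in> borel_measurable borel" using G by (rule L2_measurable)
  let ?I = "\<lambda>s. indicator (cell \<delta> j) s :: complex"
  define D where "D = (\<lambda>s. ?I s * (G t - G s))"
  have D_eq: "D s = G t * ?I s - ?I s * G s" for s by (simp add: D_def algebra_simps)
  have D: "D \<in> L2" unfolding D_eq[abs_def]
    by (intro L2_diff L2_cmult cell_indicator_L2 L2_times_indicator G) simp
  have I_int: "integrable lborel ?I" and "(\<integral>s. ?I s \<partial>lborel) = of_real \<delta>"
  proof -
    have *: "?I s = complex_of_real (indicator (cell \<delta> j) s)" for s by (simp add: indicator_def)
    have fin: "emeasure lborel (cell \<delta> j) = ennreal \<delta>"
      using \<open>\<delta> > 0\<close> by (simp add: cell_def cell_length algebra_simps)
    then have "measure lborel (cell \<delta> j) = \<delta>" using \<open>\<delta> > 0\<close> by (simp add: measure_def)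
    then show "(\<integral>s. ?I s \<partial>lborel) = of_real \<delta>" unfolding * integral_complex_of_real by simp
    show "integrable lborel ?I" unfolding * complex_of_real_integrable_eq using fin by simp
  qed
  have "of_real \<delta> * (G t - cell_mean \<delta> G j) = (\<integral>s. D s \<partial>lborel)"
  proof -
    have "(\<integral>s. D s \<partial>lborel) = G t * of_real \<delta> - (\<integral>s. ?I s * G s \<partial>lborel)"
      unfolding D_eq using I_int L2_mult_integrable[OF cell_indicator_L2 G] \<open>(\<integral>s. ?I s \<partial>lborel) = of_real \<delta>\<close> by simp
    moreover have "of_real \<delta> * cell_mean \<delta> G j = (\<integral>s. ?I s * G s \<partial>lborel)"
      using \<open>\<delta> > 0\<close> by (simp add: cell_mean_def)
    ultimately show ?thesis by (simp only: right_diff_distrib mult.commute)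
  qed
  also have "(\<integral>s. D s \<partial>lborel) = (\<integral>s. ?I s * D s \<partial>lborel)"
    by (intro Bochner_Integration.integral_cong refl) (simp add: D_def indicator_def)
  finally have "cmod (of_real \<delta> * (G t - cell_mean \<delta> G j)) \<le> norm_L2 ?I * norm_L2 D"
    using norm_integral_mult_le[OF cell_indicator_L2 D] by simp
  then have "\<delta> * cmod (G t - cell_mean \<delta> G j) \<le> sqrt \<delta> * norm_L2 D"
    using \<open>\<delta> > 0\<close> norm_cell_indicator[OF \<open>\<delta> > 0\<close>] by (simp add: norm_mult)
  then have "(\<delta> * cmod (G t - cell_mean \<delta> G j))\<^sup>2 \<le> (sqrt \<delta> * norm_L2 D)\<^sup>2"
    using \<open>\<delta> > 0\<close> by (intro power_mono) auto
  then have "\<delta> * (\<delta> * (cmod (G t - cell_mean \<delta> G j))\<^sup>2) \<le> \<delta> * (norm_L2 D)\<^sup>2"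
    using \<open>\<delta> > 0\<close> by (simp add: power_mult_distrib power2_eq_square mult_ac)
  then have "(cmod (G t - cell_mean \<delta> G j))\<^sup>2 \<le> 1 / \<delta> * (norm_L2 D)\<^sup>2"
    using \<open>\<delta> > 0\<close> by (simp add: field_simps)
  then have "ennreal ((cmod (G t - cell_mean \<delta> G j))\<^sup>2) \<le> ennreal (1 / \<delta>) * ennreal ((norm_L2 D)\<^sup>2)"
    using \<open>\<delta> > 0\<close> by (subst ennreal_mult[symmetric]) (auto intro: ennreal_leI)
  also have "ennreal ((norm_L2 D)\<^sup>2) = (\<integral>\<^sup>+s. ennreal ((cmod (D s))\<^sup>2) \<partial>lborel)"
    unfolding norm_L2_power2 by (rule nn_integral_eq_integral[symmetric]) (auto simp: L2_integrable D)
  also have "\<dots> = (\<integral>\<^sup>+h. ennreal ((cmod (D (t + h)))\<^sup>2) \<partial>lborel)"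
  proof -
    have [measurable]: "D \<in> borel_measurable borel" using D by (rule L2_measurable)
    show ?thesis
      using nn_integral_real_affine[of "\<lambda>s. ennreal ((cmod (D s))\<^sup>2)" 1 t] by simp
  qed
  also have "\<dots> \<le> (\<integral>\<^sup>+h. indicator {-\<delta>..\<delta>} h * ennreal ((cmod (G (t + h) - G t))\<^sup>2) \<partial>lborel)"
  proof (rule nn_integral_mono)
    fix h
    show "ennreal ((cmod (D (t + h)))\<^sup>2) \<le> indicator {-\<delta>..\<delta>} h * ennreal ((cmod (G (t + h) - G t))\<^sup>2)"
    proof (cases "t + h \<in> cell \<delta> j")
      case True
      then have "h \<in> {-\<delta>..\<delta>}" using t by (auto simp: cell_def algebra_simps)
      then show ?thesis using True by (simp add: D_def norm_minus_commute)
    qed (simp add: D_def)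
  qed
  finally show ?thesis by (simp add: mult_left_mono)
qed

text \<open>
  A Poincare inequality on each cell, summed over all cells: integrating \<open>cell_deviation_le\<close> over \<open>t\<close>
  and exchanging the integrals leaves twice the average over \<open>\<bar>h\<bar> \<le> \<delta>\<close> of
  \<open>\<parallel>G(\<cdot> + h) - G\<parallel>\<^sup>2 \<le> L\<^sup>2 \<delta>\<^sup>2\<close>.
\<close>

lemma cell_average_approx:
  assumes G: "G \<in> L2" and "L \<ge> 0" "\<delta> > 0"
    and lip: "\<And>h. norm_L2 (\<lambda>t. G (t + h) - G t) \<le> L * \<bar>h\<bar>"
  shows "norm_L2 (\<lambda>t. indicator {- (real M * \<delta>)..<real M * \<delta>} t * G t
           - (\<Sum>j\<in>{- int M..<int M}. cell_mean \<delta> G j * indicator (cell \<delta> j) t)) \<le> 2 * L * \<delta>"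
proof -
  have [measurable]: "G \<in> borel_measurable borel" using G by (rule L2_measurable)
  define E where "E = (\<lambda>t. indicator {- (real M * \<delta>)..<real M * \<delta>} t * G t
           - (\<Sum>j\<in>{- int M..<int M}. cell_mean \<delta> G j * indicator (cell \<delta> j) t))"
  have E_L2: "E \<in> L2"
    unfolding E_def by (intro L2_diff L2_times_indicator L2_sum L2_cmult cell_indicator_L2 G) simp
  have sum_eq: "(\<Sum>j\<in>{- int M..<int M}. cell_mean \<delta> G j * indicator (cell \<delta> j) t)
      = (if \<lfloor>t / \<delta>\<rfloor> \<in> {- int M..<int M} then cell_mean \<delta> G \<lfloor>t / \<delta>\<rfloor> else 0)" for t
  proof -
    have "cell_mean \<delta> G j * indicator (cell \<delta> j) t = (if j = \<lfloor>t / \<delta>\<rfloor> then cell_mean \<delta> G j else 0)" for j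
      using mem_cell_iff[OF \<open>\<delta> > 0\<close>, of t j] by (simp add: indicator_def)
    then show ?thesis by (simp add: sum.delta)
  qed
  have mem: "t \<in> {- (real M * \<delta>)..<real M * \<delta>} \<longleftrightarrow> \<lfloor>t / \<delta>\<rfloor> \<in> {- int M..<int M}" for t
    using \<open>\<delta> > 0\<close> by (auto simp: le_floor_iff floor_less_iff field_simps)
  have ptw: "ennreal ((cmod (E t))\<^sup>2)
      \<le> (\<integral>\<^sup>+h. ennreal (1 / \<delta>) * (indicator {-\<delta>..\<delta>} h * ennreal ((cmod (G (t + h) - G t))\<^sup>2)) \<partial>lborel)" for t
  proof (cases "\<lfloor>t / \<delta>\<rfloor> \<in> {- int M..<int M}")
    case True
    then have "E t = G t - cell_mean \<delta> G \<lfloor>t / \<delta>\<rfloor>" using mem[of t] by (simp add: E_def sum_eq)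
    then show ?thesis
      using cell_deviation_le[OF G \<open>\<delta> > 0\<close>, of t "\<lfloor>t / \<delta>\<rfloor>"] mem_cell_iff[OF \<open>\<delta> > 0\<close>, of t "\<lfloor>t / \<delta>\<rfloor>"]
      by (simp add: nn_integral_cmult)
  next
    case False
    then have "t \<notin> {- (real M * \<delta>)..<real M * \<delta>}" using mem[of t] by blast
    then have "indicator {- (real M * \<delta>)..<real M * \<delta>} t = (0::complex)" by (rule indicator_simps)
    then have "E t = 0" unfolding E_def sum_eq if_not_P[OF False] by (simp only: mult_zero_left diff_0_right)
    then show ?thesis by simp
  qed
  have "ennreal ((norm_L2 E)\<^sup>2) = (\<integral>\<^sup>+t. ennreal ((cmod (E t))\<^sup>2) \<partial>lborel)"
    unfolding norm_L2_power2 by (rule nn_integral_eq_integral[symmetric]) (auto simp: L2_integrable E_L2)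
  also have "\<dots> \<le> (\<integral>\<^sup>+t. (\<integral>\<^sup>+h. ennreal (1 / \<delta>) * (indicator {-\<delta>..\<delta>} h * ennreal ((cmod (G (t + h) - G t))\<^sup>2)) \<partial>lborel) \<partial>lborel)"
    by (intro nn_integral_mono ptw)
  also have "\<dots> = (\<integral>\<^sup>+h. (\<integral>\<^sup>+t. ennreal (1 / \<delta>) * (indicator {-\<delta>..\<delta>} h * ennreal ((cmod (G (t + h) - G t))\<^sup>2)) \<partial>lborel) \<partial>lborel)"
    by (rule lborel_pair.Fubini') measurable
  also have "\<dots> \<le> (\<integral>\<^sup>+h. ennreal (1 / \<delta>) * (ennreal (L\<^sup>2 * \<delta>\<^sup>2) * indicator {-\<delta>..\<delta>} h) \<partial>lborel)"
  proof (rule nn_integral_mono)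
    fix h
    have tr: "(\<lambda>t. G (t + h) - G t) \<in> L2" by (intro L2_diff L2_translate G)
    have "(\<integral>\<^sup>+t. ennreal ((cmod (G (t + h) - G t))\<^sup>2) \<partial>lborel) = ennreal ((norm_L2 (\<lambda>t. G (t + h) - G t))\<^sup>2)"
      unfolding norm_L2_power2 by (rule nn_integral_eq_integral) (auto simp: L2_integrable tr)
    moreover have "(norm_L2 (\<lambda>t. G (t + h) - G t))\<^sup>2 \<le> L\<^sup>2 * \<delta>\<^sup>2" if "\<bar>h\<bar> \<le> \<delta>"
    proof -
      have "norm_L2 (\<lambda>t. G (t + h) - G t) \<le> L * \<delta>"
        using lip[of h] mult_left_mono[OF that \<open>L \<ge> 0\<close>] by linarith
      from power_mono[OF this norm_L2_nonneg, of 2] show ?thesis by (simp add: power_mult_distrib)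
    qed
    ultimately have "indicator {-\<delta>..\<delta>} h * (\<integral>\<^sup>+t. ennreal ((cmod (G (t + h) - G t))\<^sup>2) \<partial>lborel)
        \<le> ennreal (L\<^sup>2 * \<delta>\<^sup>2) * indicator {-\<delta>..\<delta>} h"
      by (cases "h \<in> {-\<delta>..\<delta>}") (auto simp: abs_le_iff intro!: ennreal_leI)
    then show "(\<integral>\<^sup>+t. ennreal (1 / \<delta>) * (indicator {-\<delta>..\<delta>} h * ennreal ((cmod (G (t + h) - G t))\<^sup>2)) \<partial>lborel)
        \<le> ennreal (1 / \<delta>) * (ennreal (L\<^sup>2 * \<delta>\<^sup>2) * indicator {-\<delta>..\<delta>} h)"
      by (simp add: nn_integral_cmult mult_left_mono)
  qed
  also have "\<dots> = ennreal (1 / \<delta>) * (ennreal (L\<^sup>2 * \<delta>\<^sup>2) * ennreal (2 * \<delta>))"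
    using \<open>\<delta> > 0\<close> by (simp add: nn_integral_cmult nn_integral_indicator)
  also have "\<dots> = ennreal (2 * L\<^sup>2 * \<delta>\<^sup>2)"
  proof -
    have prod: "ennreal (1 / \<delta>) * (ennreal X * ennreal Y) = ennreal (1 / \<delta> * (X * Y))" if "0 \<le> X" "0 \<le> Y" for X Y
      using that \<open>\<delta> > 0\<close> by (subst ennreal_mult) (auto simp: ennreal_mult)
    have "1 / \<delta> * (L\<^sup>2 * \<delta>\<^sup>2 * (2 * \<delta>)) = 2 * L\<^sup>2 * \<delta>\<^sup>2" using \<open>\<delta> > 0\<close> by simp
    then show ?thesis using \<open>\<delta> > 0\<close> by (subst prod) auto
  qed
  finally have "(norm_L2 E)\<^sup>2 \<le> 2 * L\<^sup>2 * \<delta>\<^sup>2" by simp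
  also have "\<dots> \<le> (2 * L * \<delta>)\<^sup>2"
    by (simp add: power_mult_distrib)
  finally have "norm_L2 E \<le> 2 * L * \<delta>" using \<open>L \<ge> 0\<close> \<open>\<delta> > 0\<close> by (auto intro: power2_le_imp_le)
  then show ?thesis by (simp add: E_def)
qed

text \<open>
  Demodulating with a frequency \<open>k\<close> near \<open>b\<close> turns a function that is close to a modulation under
  translation into one that is Lipschitz under translation.
\<close>

lemma demodulated_translate_le:
  assumes g: "g \<in> L2" "norm_L2 g = 1" and "L \<ge> 0" and k: "\<bar>b - k\<bar> \<le> 1"
    and mod: "\<And>h. norm_L2 (\<lambda>t. g (t + h) - cis (2 * pi * b * h) * g t) \<le> L * \<bar>h\<bar>"
    and G_def: "\<And>t. G t = cis (- (2 * pi * k * t)) * g t"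
  shows "G \<in> L2" "norm_L2 G = 1" "norm_L2 (\<lambda>t. G (t + h) - G t) \<le> (L + 2 * pi) * \<bar>h\<bar>"
proof -
  have "G = (\<lambda>t. cis (- (2 * pi * k * t)) * g t)" by (rule ext) (rule G_def)
  then show "G \<in> L2" using g(1) by (auto intro!: L2_cis_mult)
  show "norm_L2 G = 1" using g(2) by (simp add: norm_L2_def G_def norm_mult)
  have tg: "(\<lambda>t. g (t + h)) \<in> L2" using g(1) by (rule L2_translate)
  have "G (t + h) - G t = cis (- (2 * pi * k * (t + h))) * (g (t + h) - cis (2 * pi * k * h) * g t)" for t
  proof -
    have "cis (- (2 * pi * k * (t + h))) * cis (2 * pi * k * h) = cis (- (2 * pi * k * t))"
      unfolding cis_mult by (rule arg_cong[of _ _ cis]) (simp add: algebra_simps)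
    then show ?thesis by (simp add: G_def right_diff_distrib mult.assoc[symmetric])
  qed
  then have "norm_L2 (\<lambda>t. G (t + h) - G t) = norm_L2 (\<lambda>t. g (t + h) - cis (2 * pi * k * h) * g t)"
    by (simp add: norm_L2_def norm_mult)
  also have "\<dots> \<le> norm_L2 (\<lambda>t. g (t + h) - cis (2 * pi * b * h) * g t)
      + norm_L2 (\<lambda>t. cis (2 * pi * b * h) * g t - cis (2 * pi * k * h) * g t)"
    by (intro norm_L2_triangle_mid tg L2_cmult g(1))
  also have "norm_L2 (\<lambda>t. cis (2 * pi * b * h) * g t - cis (2 * pi * k * h) * g t)
      = cmod (cis (2 * pi * b * h) - cis (2 * pi * k * h))"
    unfolding left_diff_distrib[symmetric] norm_L2_cmult g(2) by simp
  also have "\<dots> \<le> \<bar>2 * pi * b * h - 2 * pi * k * h\<bar>" by (rule cmod_cis_diff_le)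
  also have "\<dots> = 2 * pi * \<bar>h\<bar> * \<bar>b - k\<bar>"
  proof -
    have "2 * pi * b * h - 2 * pi * k * h = 2 * pi * h * (b - k)" by (simp add: algebra_simps)
    then show ?thesis by (simp add: abs_mult)
  qed
  also have "\<dots> \<le> 2 * pi * \<bar>h\<bar> * 1" using k by (intro mult_left_mono) auto
  finally show "norm_L2 (\<lambda>t. G (t + h) - G t) \<le> (L + 2 * pi) * \<bar>h\<bar>"
    using mod[of h] by (simp add: algebra_simps)
qed

text \<open>
  The point is that the functions \<open>cis (2 * pi * k * t) * indicator (cell \<delta> j) t\<close> depend on
  the window \<open>k\<close> but not on \<open>g\<close> or \<open>b\<close>, and that their number and the bound on the \<open>a j\<close>
  do not depend on \<open>k\<close> either.
\<close>

lemma window_approx: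
  assumes g: "g \<in> L2" "norm_L2 g = 1" and "L \<ge> 0" and k: "\<bar>b - k\<bar> \<le> 1" and "\<delta> > 0"
    and mod: "\<And>h. norm_L2 (\<lambda>t. g (t + h) - cis (2 * pi * b * h) * g t) \<le> L * \<bar>h\<bar>"
    and tail: "norm_L2 (\<lambda>t. (1 - indicator {-R..R} t) * g t) \<le> \<eta>" and R: "R < real M * \<delta>"
  shows "\<exists>a. (\<forall>j. cmod (a j) \<le> 1 / sqrt \<delta>) \<and>
    norm_L2 (\<lambda>t. g t - (\<Sum>j\<in>{- int M..<int M}. a j * (cis (2 * pi * k * t) * indicator (cell \<delta> j) t)))
      \<le> \<eta> + 2 * (L + 2 * pi) * \<delta>"
proof -
  define G where "G = (\<lambda>t. cis (- (2 * pi * k * t)) * g t)"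
  have G_eq: "G t = cis (- (2 * pi * k * t)) * g t" for t by (simp add: G_def)
  note G = demodulated_translate_le[OF g \<open>L \<ge> 0\<close> k mod G_eq]
  define S where "S = (\<lambda>t. \<Sum>j\<in>{- int M..<int M}. cell_mean \<delta> G j * indicator (cell \<delta> j) t)"
  define J where "J = {- (real M * \<delta>)..<real M * \<delta>}"
  have JG: "(\<lambda>t. indicator J t * G t) \<in> L2" unfolding J_def by (intro L2_times_indicator G) simp
  have S_L2: "S \<in> L2" unfolding S_def by (intro L2_sum L2_cmult cell_indicator_L2)
  have "norm_L2 (\<lambda>t. indicator J t * G t - S t) \<le> 2 * (L + 2 * pi) * \<delta>"
    unfolding J_def S_def using \<open>L \<ge> 0\<close> by (intro cell_average_approx G \<open>\<delta> > 0\<close>) simp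
  moreover have "norm_L2 (\<lambda>t. G t - indicator J t * G t) \<le> \<eta>"
  proof -
    have "norm_L2 (\<lambda>t. G t - indicator J t * G t) \<le> norm_L2 (\<lambda>t. (1 - indicator {-R..R} t) * g t)"
    proof (rule norm_L2_mono)
      have "(\<lambda>t. g t - indicator {-R..R} t * g t) \<in> L2" by (intro L2_diff L2_times_indicator g) simp
      then show "(\<lambda>t. (1 - indicator {-R..R} t) * g t) \<in> L2" by (simp add: left_diff_distrib)
      show "(\<lambda>t. G t - indicator J t * G t) \<in> borel_measurable borel" by (intro L2_measurable L2_diff JG G)
      fix t
      have "{-R..R} \<subseteq> J" using R by (auto simp: J_def)
      then show "cmod (G t - indicator J t * G t) \<le> cmod ((1 - indicator {-R..R} t) * g t)"
        by (auto simp: G_def indicator_def norm_mult)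
    qed
    then show ?thesis using tail by linarith
  qed
  ultimately have "norm_L2 (\<lambda>t. G t - S t) \<le> \<eta> + 2 * (L + 2 * pi) * \<delta>"
    using norm_L2_triangle_mid[OF G(1) JG S_L2] by linarith
  moreover have "norm_L2 (\<lambda>t. g t - (\<Sum>j\<in>{- int M..<int M}. cell_mean \<delta> G j * (cis (2 * pi * k * t) * indicator (cell \<delta> j) t)))
      = norm_L2 (\<lambda>t. G t - S t)"
  proof -
    have "g t - (\<Sum>j\<in>{- int M..<int M}. cell_mean \<delta> G j * (cis (2 * pi * k * t) * indicator (cell \<delta> j) t))
        = cis (2 * pi * k * t) * (G t - S t)" for t
    proof -
      have "cis (2 * pi * k * t) * G t = g t" by (simp add: G_def mult.assoc[symmetric] cis_mult)
      then show ?thesis by (simp only: right_diff_distrib S_def sum_distrib_left mult.left_commute)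
    qed
    then show ?thesis by (simp add: norm_L2_def norm_mult)
  qed
  moreover have "cmod (cell_mean \<delta> G j) \<le> 1 / sqrt \<delta>" for j
    using cmod_cell_mean_le[OF G(1) \<open>\<delta> > 0\<close>, of j] G(2) by simp
  ultimately show ?thesis by (intro exI[of _ "cell_mean \<delta> G"]) simp
qed

section \<open>Pairings with a translated bump\<close>

definition triangle :: "real \<Rightarrow> real \<Rightarrow> complex" where
  "triangle T t = complex_of_real (max 0 (1 - \<bar>t - T\<bar>))"

lemma triangle_L2: "triangle T \<in> L2"
proof (rule L2_dominated[OF indicator_interval_L2[of "T - 1" "T + 1"], where C=1])
  show "triangle T \<in> borel_measurable borel" unfolding triangle_def[abs_def] by measurable
  show "cmod (triangle T t) \<le> 1 * cmod (indicator {T - 1..T + 1} t)" for t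
    by (auto simp: triangle_def indicator_def)
qed

lemma triangle_support: "\<bar>t - T\<bar> \<ge> 1 \<Longrightarrow> triangle T t = 0"
  by (simp add: triangle_def)

lemma norm_triangle_eq: "norm_L2 (triangle T) = norm_L2 (triangle 0)"
  using norm_L2_translate[of "triangle T" T] by (simp add: triangle_def[abs_def])

lemma norm_triangle_pos: "norm_L2 (triangle 0) > 0"
proof -
  have "norm_L2 (\<lambda>t. 1/2 * indicator {-(1/2)..1/2::real} t) \<le> norm_L2 (triangle 0)"
  proof (rule norm_L2_mono[OF triangle_L2])
    show "cmod (1/2 * indicator {-(1/2)..1/2} t) \<le> cmod (triangle 0 t)" for t :: real
      by (cases "t \<in> {-(1/2)..1/2}") (auto simp: triangle_def indicator_def)
  qed measurable
  moreover have "norm_L2 (\<lambda>t. 1/2 * indicator {-(1/2)..1/2::real} t) = 1/2"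
    using norm_L2_indicator(2)[of "-(1/2)" "1/2"] by (subst norm_L2_cmult) simp
  ultimately show ?thesis by linarith
qed

lemma triangle_translate_le:
  assumes "\<bar>h\<bar> \<le> 1"
  shows "norm_L2 (\<lambda>t. triangle T t - triangle T (t - h)) \<le> 2 * \<bar>h\<bar>"
proof -
  have "norm_L2 (\<lambda>t. triangle T t - triangle T (t - h))
      \<le> norm_L2 (\<lambda>t. complex_of_real \<bar>h\<bar> * indicator {T - 2..T + 2} t)"
  proof (rule norm_L2_mono)
    show "(\<lambda>t. complex_of_real \<bar>h\<bar> * indicator {T - 2..T + 2} t) \<in> L2"
      by (intro L2_cmult indicator_interval_L2)
    show "(\<lambda>t. triangle T t - triangle T (t - h)) \<in> borel_measurable borel"
      unfolding triangle_def by measurable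
    show "cmod (triangle T t - triangle T (t - h)) \<le> cmod (complex_of_real \<bar>h\<bar> * indicator {T - 2..T + 2} t)" for t
    proof (cases "t \<in> {T - 2..T + 2}")
      case True
      have "\<bar>max 0 (1 - \<bar>t - T\<bar>) - max 0 (1 - \<bar>t - h - T\<bar>)\<bar> \<le> \<bar>h\<bar>" by linarith
      then show ?thesis using True
        unfolding triangle_def of_real_diff[symmetric] norm_of_real norm_mult by simp
    next
      case False
      then have "\<bar>t - T\<bar> \<ge> 1" "\<bar>t - h - T\<bar> \<ge> 1" using assms by auto
      then show ?thesis by (simp add: triangle_support)
    qed
  qed
  also have "\<dots> = \<bar>h\<bar> * sqrt 4"
    using norm_L2_indicator(2)[of "T - 2" "T + 2"] unfolding norm_L2_cmult norm_of_real by simp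
  finally show ?thesis by simp
qed

text \<open>
  For \<open>h = 1 / (2 * b)\<close> the modulation factor is \<open>-1\<close>, so \<open>g(\<cdot> + h)\<close> is close to \<open>-g\<close>, while the triangle
  is Lipschitz under translation. Hence moving the translation from \<open>g\<close> to the triangle almost
  changes the sign of the pairing.
\<close>

lemma pairing_with_triangle_decay:
  assumes g: "g \<in> L2" "norm_L2 g = 1" and "L \<ge> 0"
    and mod: "\<And>h. norm_L2 (\<lambda>t. g (t + h) - cis (2 * pi * b * h) * g t) \<le> L * \<bar>h\<bar>"
  shows "cmod (\<integral>t. g t * triangle T t \<partial>lborel) \<le> (L * norm_L2 (triangle 0) + 2 + 2 * norm_L2 (triangle 0)) / (1 + \<bar>b\<bar>)"
proof -
  define \<nu> where "\<nu> = norm_L2 (triangle 0)"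
  define f where "f = triangle T"
  have f: "f \<in> L2" "norm_L2 f = \<nu>" by (simp_all add: f_def triangle_L2 \<nu>_def norm_triangle_eq[of T])
  have \<nu>: "\<nu> > 0" unfolding \<nu>_def by (rule norm_triangle_pos)
  define I where "I = (\<integral>t. g t * f t \<partial>lborel)"
  have triv: "cmod I \<le> \<nu>" using norm_integral_mult_le[OF g(1) f(1)] g(2) f(2) by (simp add: I_def)
  have "cmod I \<le> (L * \<nu> + 2 + 2 * \<nu>) / (1 + \<bar>b\<bar>)"
  proof (cases "\<bar>b\<bar> < 1")
    case True
    have "\<nu> * (1 + \<bar>b\<bar>) \<le> \<nu> * 2" using True \<nu> by (intro mult_left_mono) auto
    moreover have "0 \<le> L * \<nu>" using \<open>L \<ge> 0\<close> \<nu> by simp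
    ultimately have "\<nu> \<le> (L * \<nu> + 2 + 2 * \<nu>) / (1 + \<bar>b\<bar>)" by (simp add: pos_le_divide_eq)
    with triv show ?thesis by linarith
  next
    case False
    define h where "h = 1 / (2 * b)"
    have h: "\<bar>h\<bar> = 1 / (2 * \<bar>b\<bar>)" "\<bar>h\<bar> \<le> 1" using False by (auto simp: h_def field_simps abs_divide)
    have cis: "cis (2 * pi * b * h) = -1" using False by (simp add: h_def)
    have tg: "(\<lambda>t. g (t + h)) \<in> L2" and tf: "(\<lambda>t. f (t - h)) \<in> L2"
      using L2_translate[OF g(1), of h] L2_translate[OF f(1), of "-h"] by simp_all
    have "(\<integral>t. g (t + h) * f t \<partial>lborel) = (\<integral>t. g t * f (t - h) \<partial>lborel)"
      using lborel_integral_real_affine[of 1 "\<lambda>t. g t * f (t - h)" h] by (simp add: add.commute)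
    then have "2 * I = (\<integral>t. (g t + g (t + h)) * f t \<partial>lborel) + (\<integral>t. g t * (f t - f (t - h)) \<partial>lborel)"
      unfolding I_def using L2_mult_integrable[OF g(1) f(1)] L2_mult_integrable[OF tg f(1)] L2_mult_integrable[OF g(1) tf]
      by (simp add: distrib_right right_diff_distrib)
    then have "cmod (2 * I) \<le> cmod (\<integral>t. (g t + g (t + h)) * f t \<partial>lborel) + cmod (\<integral>t. g t * (f t - f (t - h)) \<partial>lborel)"
      by (simp only: norm_triangle_ineq)
    also have "\<dots> \<le> norm_L2 (\<lambda>t. g t + g (t + h)) * norm_L2 f + norm_L2 g * norm_L2 (\<lambda>t. f t - f (t - h))"
      by (intro add_mono norm_integral_mult_le L2_add L2_diff g(1) f(1) tg tf)
    also have "\<dots> \<le> (L * \<bar>h\<bar>) * \<nu> + 1 * (2 * \<bar>h\<bar>)"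
    proof (intro add_mono mult_mono)
      show "norm_L2 (\<lambda>t. g t + g (t + h)) \<le> L * \<bar>h\<bar>" using mod[of h] unfolding cis by (simp add: add.commute)
      show "norm_L2 (\<lambda>t. f t - f (t - h)) \<le> 2 * \<bar>h\<bar>" unfolding f_def by (rule triangle_translate_le[OF h(2)])
    qed (use g f \<open>L \<ge> 0\<close> in auto)
    also have "\<dots> = (L * \<nu> + 2) / (2 * \<bar>b\<bar>)" unfolding h(1) by (simp add: add_divide_distrib)
    finally have "2 * cmod I \<le> (L * \<nu> + 2) / (2 * \<bar>b\<bar>)" unfolding norm_mult norm_numeral .
    then have "cmod I \<le> (L * \<nu> + 2) / (2 * \<bar>b\<bar>)" using norm_ge_zero[of I] by linarith
    also have "\<dots> \<le> (L * \<nu> + 2 + 2 * \<nu>) / (1 + \<bar>b\<bar>)"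
      using False \<open>L \<ge> 0\<close> \<nu> by (intro frac_le) auto
    finally show ?thesis .
  qed
  then show ?thesis by (simp add: I_def f_def \<nu>_def)
qed

lemma pairing_with_triangle_small:
  assumes g: "g \<in> L2" and tail: "norm_L2 (\<lambda>t. (1 - indicator {-R..R} t) * g t) \<le> \<eta>"
  shows "cmod (\<integral>t. g t * triangle (R + 1) t \<partial>lborel) \<le> \<eta> * norm_L2 (triangle 0)"
proof -
  have L2: "(\<lambda>t. (1 - indicator {-R..R} t) * g t) \<in> L2"
  proof (rule L2_dominated[OF g, where C=1])
    have [measurable]: "g \<in> borel_measurable borel" using g by (rule L2_measurable)
    show "(\<lambda>t. (1 - indicator {-R..R} t) * g t) \<in> borel_measurable borel" by measurable
  qed (auto simp: indicator_def)
  have "g t * triangle (R + 1) t = ((1 - indicator {-R..R} t) * g t) * triangle (R + 1) t" for t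
    by (cases "t \<in> {-R..R}") (auto simp: triangle_def)
  then have "(\<integral>t. g t * triangle (R + 1) t \<partial>lborel)
      = (\<integral>t. ((1 - indicator {-R..R} t) * g t) * triangle (R + 1) t \<partial>lborel)"
    by (intro Bochner_Integration.integral_cong refl)
  also have "cmod \<dots> \<le> norm_L2 (\<lambda>t. (1 - indicator {-R..R} t) * g t) * norm_L2 (triangle (R + 1))"
    by (rule norm_integral_mult_le[OF L2 triangle_L2])
  also have "\<dots> \<le> \<eta> * norm_L2 (triangle 0)"
    unfolding norm_triangle_eq[of "R + 1"] using tail by (intro mult_right_mono) auto
  finally show ?thesis .
qed

section \<open>Localized systems are not bases\<close>

lemma geometric_less:
  fixes r :: real
  assumes "1 \<le> r" "r < 2"
  shows "\<exists>m::nat. C * r ^ m < 2 ^ m"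
proof (cases "C > 0")
  case True
  obtain m where "(r / 2) ^ m < 1 / C" using real_arch_pow_inv[of "1 / C" "r / 2"] assms True by auto
  then have "C * r ^ m < 2 ^ m" using True by (simp add: power_divide field_simps)
  then show ?thesis by blast
next
  case False
  then have "C * r ^ 0 < 2 ^ 0" by simp
  then show ?thesis by blast
qed

text \<open>
  Concentration of \<open>e n\<close> near the frequency \<open>b n\<close> is expressed through translations, in the form in
  which \<open>translate_close_to_modulation\<close> provides it.
\<close>

locale localized_schauder_basis = normalized_schauder_basis +
  fixes b :: "nat \<Rightarrow> real" and L :: real
  assumes L_nonneg: "L \<ge> 0"
    and tails: "\<And>\<eta>. \<eta> > 0 \<Longrightarrow> \<exists>R. \<forall>n. norm_L2 (\<lambda>t. (1 - indicator {-R..R} t) * e n t) \<le> \<eta>"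
    and mod: "\<And>n h. norm_L2 (\<lambda>t. e n (t + h) - cis (2 * pi * b n * h) * e n t) \<le> L * \<bar>h\<bar>"
begin

text \<open>
  If \<open>n\<close> is in the window, then \<open>e n\<close> is a combination of the \<open>2 * M\<close> functions \<open>f j\<close> up to an error on
  which \<open>coef _ n\<close> is at most \<open>1/2\<close>. As \<open>coef (e n) n = 1\<close>, some of the numbers
  \<open>coef (f j) n\<close> must be large. Summed over \<open>2 ^ m\<close> such \<open>n\<close>, they are bounded by a multiple
  of \<open>r ^ m\<close>, which is impossible for large \<open>m\<close>.
\<close>

lemma window_card_le:
  "\<exists>D. \<forall>k F. finite F \<and> (\<forall>n\<in>F. \<bar>b n - k\<bar> \<le> 1) \<longrightarrow> card F \<le> D"
proof -
  obtain B r where B: "B > 0" and r: "1 \<le> r" "r < 2"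
    and est: "\<And>k F f. f \<in> L2 \<Longrightarrow> finite F \<Longrightarrow> card F \<le> 2 ^ k \<Longrightarrow> (\<Sum>n\<in>F. cmod (coef f n)) \<le> B * r ^ k * norm_L2 f"
    using sum_cmod_coef_le by blast
  \<comment> \<open>Tail and discretization each contribute \<open>\<eta>\<close> to the error, on which the coefficient is then at most \<open>B * (2 * \<eta>) = 1 / 2\<close>.\<close>
  define \<eta> where "\<eta> = 1 / (4 * B)"
  have \<eta>: "\<eta> > 0" using B by (simp add: \<eta>_def)
  obtain R where R: "\<And>n. norm_L2 (\<lambda>t. (1 - indicator {-R..R} t) * e n t) \<le> \<eta>" using tails[OF \<eta>] by blast
  define \<delta> where "\<delta> = \<eta> / (2 * (L + 2 * pi))"
  have Lpi: "L + 2 * pi > 0" using L_nonneg pi_gt_zero by linarith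
  have \<delta>: "\<delta> > 0" "2 * (L + 2 * pi) * \<delta> = \<eta>" using \<eta> Lpi by (auto simp: \<delta>_def)
  obtain M :: nat where "R / \<delta> < real M" using reals_Archimedean2 by blast
  then have M: "R < real M * \<delta>" using \<delta> by (simp add: pos_divide_less_eq)
  define Js where "Js = {- int M..<int M}"
  obtain m where m: "4 * real M * B * r ^ m < 2 ^ m" using geometric_less[OF r] by blast
  have "card F < 2 ^ m" if F: "finite F" "\<And>n. n \<in> F \<Longrightarrow> \<bar>b n - k\<bar> \<le> 1" for k F
  proof (rule ccontr)
    assume "\<not> card F < 2 ^ m"
    then obtain F' where F': "F' \<subseteq> F" "card F' = 2 ^ m" by (metis not_less obtain_subset_with_card_n)
    have "finite F'" using F' F(1) finite_subset by blast
    define f where "f = (\<lambda>j t. cis (2 * pi * k * t) * indicator (cell \<delta> j) t)"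
    have f_L2: "f j \<in> L2" for j unfolding f_def by (intro L2_cis_mult cell_indicator_L2) simp
    have f_norm: "norm_L2 (f j) = sqrt \<delta>" for j
      using norm_cell_indicator[OF \<delta>(1), of j] by (simp add: f_def norm_L2_def norm_mult)
    have lower: "1 / 2 \<le> (\<Sum>j\<in>Js. 1 / sqrt \<delta> * cmod (coef (f j) n))" if "n \<in> F'" for n
    proof -
      have "n \<in> F" using that F'(1) by blast
      obtain a where a: "\<And>j. cmod (a j) \<le> 1 / sqrt \<delta>"
        "norm_L2 (\<lambda>t. e n t - (\<Sum>j\<in>Js. a j * f j t)) \<le> \<eta> + \<eta>"
        using window_approx[OF e_L2 norm_e L_nonneg F(2)[OF \<open>n \<in> F\<close>] \<delta>(1) mod R M]
        unfolding f_def Js_def \<delta>(2) by blast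
      have S_L2: "(\<lambda>t. \<Sum>j\<in>Js. a j * f j t) \<in> L2" by (intro L2_sum L2_cmult f_L2)
      define \<rho> where "\<rho> = (\<lambda>t. e n t - (\<Sum>j\<in>Js. a j * f j t))"
      have \<rho>: "\<rho> \<in> L2" unfolding \<rho>_def by (intro L2_diff S_L2 e_L2)
      have "cmod (coef \<rho> n) \<le> B * norm_L2 \<rho>" using est[OF \<rho>, of "{n}" 0] by simp
      also have "\<dots> \<le> B * (\<eta> + \<eta>)" using a(2) B unfolding \<rho>_def by (intro mult_left_mono) auto
      also have "\<dots> = 1 / 2" using B by (simp add: \<eta>_def)
      finally have "cmod (coef \<rho> n) \<le> 1 / 2" .
      moreover have "coef \<rho> n = 1 - (\<Sum>j\<in>Js. a j * coef (f j) n)"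
        unfolding \<rho>_def coef_diff[OF e_L2 S_L2] coef_e
        by (subst coef_sum) (auto simp: Js_def coef_cmult f_L2 L2_cmult)
      ultimately have "1 / 2 \<le> cmod (\<Sum>j\<in>Js. a j * coef (f j) n)"
        using norm_triangle_ineq2[of 1 "1 - (\<Sum>j\<in>Js. a j * coef (f j) n)"] by simp
      also have "\<dots> \<le> (\<Sum>j\<in>Js. cmod (a j * coef (f j) n))" by (rule norm_sum)
      also have "\<dots> \<le> (\<Sum>j\<in>Js. 1 / sqrt \<delta> * cmod (coef (f j) n))"
        unfolding norm_mult by (intro sum_mono mult_right_mono a) simp
      finally show ?thesis .
    qed
    have "2 ^ m / 2 = (\<Sum>n\<in>F'. 1 / 2 :: real)" using F' by simp
    also have "\<dots> \<le> (\<Sum>n\<in>F'. \<Sum>j\<in>Js. 1 / sqrt \<delta> * cmod (coef (f j) n))" by (intro sum_mono lower)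
    also have "\<dots> = (\<Sum>j\<in>Js. 1 / sqrt \<delta> * (\<Sum>n\<in>F'. cmod (coef (f j) n)))"
      by (subst sum.swap) (simp add: sum_distrib_left)
    also have "\<dots> \<le> (\<Sum>j\<in>Js. 1 / sqrt \<delta> * (B * r ^ m * sqrt \<delta>))"
      using \<delta>(1) est[OF f_L2 \<open>finite F'\<close>, of m] F'(2) f_norm by (intro sum_mono mult_left_mono) auto
    also have "\<dots> = 2 * real M * B * r ^ m" using \<delta>(1) by (simp add: Js_def)
    finally show False using m by simp
  qed
  then show ?thesis by (intro exI[of _ "2 ^ m"]) (auto intro: less_imp_le)
qed

text \<open>
  The interval is covered by \<open>O(2 ^ j)\<close> windows with integer centres.
\<close>

lemma frequency_ball_card_le:
  "\<exists>d::nat. \<forall>j F. finite F \<and> (\<forall>n\<in>F. 1 + \<bar>b n\<bar> < 2 ^ j) \<longrightarrow> card F \<le> 2 ^ (j + d)"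
proof -
  obtain D where D0: "\<forall>k F. finite F \<and> (\<forall>n\<in>F. \<bar>b n - k\<bar> \<le> 1) \<longrightarrow> card F \<le> D"
    using window_card_le by (rule exE)
  have D: "card F \<le> D" if "finite F" "\<And>n. n \<in> F \<Longrightarrow> \<bar>b n - k\<bar> \<le> 1" for k F
    by (rule D0[rule_format, of F k]) (use that in auto)
  obtain d :: nat where d: "3 * D \<le> 2 ^ d" using less_exp[of "3 * D"] less_imp_le by blast
  have "card F \<le> 2 ^ (j + d)" if F: "finite F" "\<And>n. n \<in> F \<Longrightarrow> 1 + \<bar>b n\<bar> < 2 ^ j" for j F
  proof -
    define K :: "int set" where "K = {- (2 ^ j)..2 ^ j}"
    define Fk where "Fk = (\<lambda>k::int. {n \<in> F. \<lfloor>b n\<rfloor> = k})"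
    have "F \<subseteq> (\<Union>k\<in>K. Fk k)"
    proof
      fix n assume n: "n \<in> F"
      have "\<lfloor>b n\<rfloor> \<in> K"
      proof -
        have "real_of_int \<lfloor>b n\<rfloor> \<le> 2 ^ j" "- (2 ^ j) \<le> real_of_int \<lfloor>b n\<rfloor>"
          using F(2)[OF n] of_int_floor_le[of "b n"] floor_correct[of "b n"] by linarith+
        then have "real_of_int \<lfloor>b n\<rfloor> \<le> real_of_int (2 ^ j)" "real_of_int (- (2 ^ j)) \<le> real_of_int \<lfloor>b n\<rfloor>"
          by simp_all
        then show ?thesis unfolding K_def of_int_le_iff by simp
      qed
      then show "n \<in> (\<Union>k\<in>K. Fk k)" using n by (auto simp: Fk_def)
    qed
    then have "card F \<le> card (\<Union>k\<in>K. Fk k)" using F(1) by (intro card_mono) (auto simp: K_def Fk_def)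
    also have "\<dots> \<le> (\<Sum>k\<in>K. card (Fk k))" by (rule card_UN_le) (simp add: K_def)
    also have "\<dots> \<le> (\<Sum>k\<in>K. D)"
    proof (rule sum_mono)
      fix k assume "k \<in> K"
      show "card (Fk k) \<le> D"
      proof (rule D[of _ "real_of_int k"])
        show "finite (Fk k)" using F(1) by (simp add: Fk_def)
        show "\<bar>b n - real_of_int k\<bar> \<le> 1" if "n \<in> Fk k" for n
          using that floor_correct[of "b n"] by (auto simp: Fk_def)
      qed
    qed
    also have "\<dots> = card K * D" by simp
    also have "card K \<le> 3 * 2 ^ j"
    proof -
      have "card K = nat (2 * 2 ^ j + 1)" by (simp add: K_def)
      also have "\<dots> \<le> nat (3 * 2 ^ j)" by (intro nat_mono) simp
      also have "\<dots> = 3 * 2 ^ j" by (simp add: nat_mult_distrib nat_power_eq)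
      finally show ?thesis .
    qed
    also have "3 * 2 ^ j * D \<le> 2 ^ (j + d)" using d by (simp add: power_add mult_ac)
    finally show ?thesis by simp
  qed
  then show ?thesis by blast
qed

text \<open>
  The expansion of a triangle \<open>f\<close> at distance \<open>R + 1\<close> from the origin is tested against \<open>f\<close> itself. The
  indices are grouped by the dyadic size \<open>lev n\<close> of \<open>1 + \<bar>b n\<bar>\<close>. First \<open>J\<close> is chosen so that the
  levels above \<open>J\<close> contribute at most \<open>\<nu>\<^sup>2 / 4\<close> for every \<open>R\<close>; then \<open>R\<close> is chosen so large that the
  other levels contribute at most \<open>\<nu>\<^sup>2 / 4\<close>. But the total must be \<open>\<nu>\<^sup>2 = \<parallel>f\<parallel>\<^sup>2\<close>.
\<close>

theorem not_uniformly_localized: False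
proof -
  obtain B r where B: "B > 0" and r: "1 \<le> r" "r < 2"
    and est: "\<And>k F f. f \<in> L2 \<Longrightarrow> finite F \<Longrightarrow> card F \<le> 2 ^ k \<Longrightarrow> (\<Sum>n\<in>F. cmod (coef f n)) \<le> B * r ^ k * norm_L2 f"
    using sum_cmod_coef_le by blast
  obtain d :: nat where
    d0: "\<forall>j F. finite F \<and> (\<forall>n\<in>F. 1 + \<bar>b n\<bar> < 2 ^ j) \<longrightarrow> card F \<le> 2 ^ (j + d)"
    using frequency_ball_card_le by (rule exE)
  have d: "card F \<le> 2 ^ (j + d)" if "finite F" "\<And>n. n \<in> F \<Longrightarrow> 1 + \<bar>b n\<bar> < 2 ^ j" for j F
    by (rule d0[rule_format, of F j]) (use that in auto)
  define \<nu> where "\<nu> = norm_L2 (triangle 0)"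
  have \<nu>: "\<nu> > 0" unfolding \<nu>_def by (rule norm_triangle_pos)
  define C where "C = L * \<nu> + 2 + 2 * \<nu>"
  have C: "C > 0" using L_nonneg \<nu> by (simp add: C_def add_nonneg_pos)
  define q where "q = r / 2"
  have q: "0 < q" "q < 1" using r by (auto simp: q_def)
  \<comment> \<open>The shell \<open>lev n = j\<close> contributes at most \<open>Q * q ^ j\<close>.\<close>
  define Q where "Q = 2 * B * C * \<nu> * r ^ d"
  have Q: "Q > 0" using B C \<nu> r by (simp add: Q_def)
  obtain J where "q ^ J < \<nu>\<^sup>2 / 4 * (1 - q) / Q"
    using real_arch_pow_inv[of "\<nu>\<^sup>2 / 4 * (1 - q) / Q" q] q Q \<nu> by auto
  then have J: "Q * (q ^ J / (1 - q)) < \<nu>\<^sup>2 / 4" using q Q by (simp add: field_simps)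
  \<comment> \<open>Up to level \<open>J\<close> there are at most \<open>2 ^ (J + d)\<close> indices, which contribute \<open>B * r ^ (J + d) * \<nu> * (\<eta> * \<nu>)\<close>.\<close>
  define \<eta> where "\<eta> = 1 / (4 * B * r ^ (J + d))"
  have \<eta>: "\<eta> > 0" using B r by (simp add: \<eta>_def)
  obtain R where R: "\<And>n. norm_L2 (\<lambda>t. (1 - indicator {-R..R} t) * e n t) \<le> \<eta>" using tails[OF \<eta>] by blast
  define f where "f = triangle (R + 1)"
  have f: "f \<in> L2" "norm_L2 f = \<nu>" unfolding f_def \<nu>_def by (rule triangle_L2, rule norm_triangle_eq)
  define I where "I = (\<lambda>n. \<integral>t. e n t * f t \<partial>lborel)"
  have I_small: "cmod (I n) \<le> \<eta> * \<nu>" for n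
    unfolding I_def f_def \<nu>_def by (rule pairing_with_triangle_small[OF e_L2 R])
  have I_decay: "cmod (I n) \<le> C / (1 + \<bar>b n\<bar>)" for n
    unfolding I_def f_def \<nu>_def C_def by (rule pairing_with_triangle_decay[OF e_L2 norm_e L_nonneg mod])
  \<comment> \<open>For \<open>lev n > 0\<close>, the level satisfies \<open>2 ^ (lev n - 1) \<le> 1 + \<bar>b n\<bar> < 2 ^ lev n\<close>; hence the factor 2 in \<open>lev_decay\<close>.\<close>
  define lev where "lev = (\<lambda>n. LEAST j. 1 + \<bar>b n\<bar> < 2 ^ j)"
  have lev: "1 + \<bar>b n\<bar> < 2 ^ lev n" for n
  proof -
    obtain j where "1 + \<bar>b n\<bar> < 2 ^ j" using real_arch_pow[of 2 "1 + \<bar>b n\<bar>"] by auto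
    then show ?thesis unfolding lev_def by (rule LeastI)
  qed
  have lev_decay: "cmod (I n) \<le> 2 * C / 2 ^ lev n" for n
  proof (cases "lev n")
    case 0
    then show ?thesis using lev[of n] by simp
  next
    case (Suc i)
    then have "\<not> 1 + \<bar>b n\<bar> < 2 ^ i" using not_less_Least[of i "\<lambda>j. 1 + \<bar>b n\<bar> < 2 ^ j"] by (simp add: lev_def)
    then have "C / (1 + \<bar>b n\<bar>) \<le> C / 2 ^ i" using C by (intro divide_left_mono) auto
    also have "\<dots> = 2 * C / 2 ^ lev n" by (simp add: Suc)
    finally show ?thesis using I_decay[of n] by linarith
  qed
  have low: "(\<Sum>n\<in>F. cmod (coef f n * I n)) \<le> \<nu>\<^sup>2 / 4" if F: "finite F" "\<And>n. n \<in> F \<Longrightarrow> lev n \<le> J" for F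
  proof -
    have "(\<Sum>n\<in>F. cmod (coef f n * I n)) \<le> (\<Sum>n\<in>F. cmod (coef f n) * (\<eta> * \<nu>))"
      unfolding norm_mult by (intro sum_mono mult_left_mono I_small) simp
    also have "\<dots> = (\<Sum>n\<in>F. cmod (coef f n)) * (\<eta> * \<nu>)" by (simp add: sum_distrib_right)
    also have "\<dots> \<le> (B * r ^ (J + d) * \<nu>) * (\<eta> * \<nu>)"
    proof (rule mult_right_mono)
      have "card F \<le> 2 ^ (J + d)"
      proof (rule d[OF F(1)])
        fix n assume "n \<in> F"
        have "(2::real) ^ lev n \<le> 2 ^ J" using F(2)[OF \<open>n \<in> F\<close>] by (intro power_increasing) auto
        then show "1 + \<bar>b n\<bar> < 2 ^ J" using lev[of n] by linarith
      qed
      then show "(\<Sum>n\<in>F. cmod (coef f n)) \<le> B * r ^ (J + d) * \<nu>" using est[OF f(1) F(1)] f(2) by simp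
    qed (use \<eta> \<nu> in auto)
    also have "\<dots> = \<nu>\<^sup>2 / 4" using B r by (simp add: \<eta>_def power2_eq_square)
    finally show ?thesis .
  qed
  have shell: "(\<Sum>n\<in>F. cmod (coef f n * I n)) \<le> Q * q ^ j" if F: "finite F" "\<And>n. n \<in> F \<Longrightarrow> lev n = j" for F j
  proof -
    have "(\<Sum>n\<in>F. cmod (coef f n * I n)) \<le> (\<Sum>n\<in>F. cmod (coef f n) * (2 * C / 2 ^ j))"
      unfolding norm_mult using lev_decay F(2) by (intro sum_mono mult_left_mono) auto
    also have "\<dots> = (\<Sum>n\<in>F. cmod (coef f n)) * (2 * C / 2 ^ j)" by (simp only: sum_distrib_right)
    also have "\<dots> \<le> (B * r ^ (j + d) * \<nu>) * (2 * C / 2 ^ j)"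
    proof (rule mult_right_mono)
      have "card F \<le> 2 ^ (j + d)"
        using lev F(2) by (intro d[OF F(1)]) metis
      then show "(\<Sum>n\<in>F. cmod (coef f n)) \<le> B * r ^ (j + d) * \<nu>" using est[OF f(1) F(1)] f(2) by simp
    qed (use C in simp)
    also have "\<dots> = Q * q ^ j" by (simp add: Q_def q_def power_add power_divide)
    finally show ?thesis .
  qed
  have high: "(\<Sum>n\<in>F. cmod (coef f n * I n)) \<le> \<nu>\<^sup>2 / 4" if F: "finite F" "\<And>n. n \<in> F \<Longrightarrow> lev n > J" for F
  proof -
    define H where "H = Max (insert J (lev ` F)) + 1"
    have "lev ` F \<subseteq> {J..<H}"
    proof
      fix j assume "j \<in> lev ` F"
      then have "j \<le> Max (insert J (lev ` F))" "J \<le> j" using F by (auto intro!: Max_ge less_imp_le)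
      then show "j \<in> {J..<H}" by (simp add: H_def)
    qed
    then have "(\<Sum>n\<in>F. cmod (coef f n * I n)) = (\<Sum>j\<in>{J..<H}. \<Sum>n\<in>{n\<in>F. lev n = j}. cmod (coef f n * I n))"
      by (intro sum.group[symmetric] F(1)) simp_all
    also have "\<dots> \<le> (\<Sum>j\<in>{J..<H}. Q * q ^ j)" using F(1) by (intro sum_mono shell) auto
    also have "\<dots> \<le> Q * (q ^ J / (1 - q))"
    proof -
      have JH: "J \<le> H" using F(1) by (simp add: H_def le_SucI)
      have "(\<Sum>j\<in>{J..<H}. q ^ j) = (q ^ J - q ^ H) / (1 - q)"
      proof -
        have "(q - 1) * (\<Sum>j\<in>{J..<H}. q ^ j) = (\<Sum>j\<in>{J..<H}. q ^ Suc j - q ^ j)"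
          by (simp add: sum_distrib_left left_diff_distrib)
        also have "\<dots> = q ^ H - q ^ J" using JH by (rule sum_Suc_diff')
        finally show ?thesis using q by (simp add: field_simps)
      qed
      also have "\<dots> \<le> q ^ J / (1 - q)" using q by (intro divide_right_mono) auto
      finally show ?thesis
        unfolding sum_distrib_left[symmetric] using Q by (intro mult_left_mono) auto
    qed
    finally show ?thesis using J by linarith
  qed
  have bound: "cmod (\<Sum>n<N. coef f n * I n) \<le> \<nu>\<^sup>2 / 2" for N
  proof -
    have "cmod (\<Sum>n<N. coef f n * I n) \<le> (\<Sum>n<N. cmod (coef f n * I n))" by (rule norm_sum)
    also have "\<dots> = (\<Sum>n\<in>{n\<in>{..<N}. lev n \<le> J}. cmod (coef f n * I n)) + (\<Sum>n\<in>{n\<in>{..<N}. lev n > J}. cmod (coef f n * I n))"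
      by (subst sum.union_disjoint[symmetric]) (auto intro!: sum.cong)
    also have "\<dots> \<le> \<nu>\<^sup>2 / 4 + \<nu>\<^sup>2 / 4" by (intro add_mono low high) auto
    finally show ?thesis by simp
  qed
  have ff: "(\<integral>t. f t * f t \<partial>lborel) = complex_of_real (\<nu>\<^sup>2)"
  proof -
    have "f t * f t = complex_of_real ((cmod (f t))\<^sup>2)" for t
      by (simp add: f_def triangle_def power2_eq_square flip: of_real_mult)
    then have "(\<integral>t. f t * f t \<partial>lborel) = complex_of_real (\<integral>t. (cmod (f t))\<^sup>2 \<partial>lborel)"
      by (simp only: integral_complex_of_real)
    then show ?thesis using f(2) norm_L2_power2[of f] by simp
  qed
  have "\<nu>\<^sup>2 \<le> \<nu>\<^sup>2 / 2 + norm_L2 (\<lambda>t. f t - partial_sum N f t) * \<nu>" for N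
  proof -
    have eq: "(\<integral>t. partial_sum N f t * f t \<partial>lborel) = (\<Sum>n<N. coef f n * I n)"
      unfolding partial_sum_def sum_distrib_right I_def mult.assoc
      using L2_mult_integrable[OF e_L2 f(1)] by (subst Bochner_Integration.integral_sum) auto
    have "cmod (\<integral>t. (f t - partial_sum N f t) * f t \<partial>lborel) \<le> norm_L2 (\<lambda>t. f t - partial_sum N f t) * \<nu>"
      using norm_integral_mult_le[OF L2_diff[OF f(1) partial_sum_L2[of N f]] f(1)] unfolding f(2) .
    moreover have "(\<integral>t. (f t - partial_sum N f t) * f t \<partial>lborel) = complex_of_real (\<nu>\<^sup>2) - (\<Sum>n<N. coef f n * I n)"
      unfolding left_diff_distrib using L2_mult_integrable[OF f(1) f(1)] L2_mult_integrable[OF partial_sum_L2 f(1)]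
      by (simp add: ff eq del: of_real_power)
    ultimately show ?thesis
      using norm_triangle_ineq2[of "complex_of_real (\<nu>\<^sup>2)" "\<Sum>n<N. coef f n * I n"] bound[of N]
      unfolding norm_of_real by simp
  qed
  moreover have "(\<lambda>N. \<nu>\<^sup>2 / 2 + norm_L2 (\<lambda>t. f t - partial_sum N f t) * \<nu>) \<longlonglongrightarrow> \<nu>\<^sup>2 / 2 + 0 * \<nu>"
    by (intro tendsto_intros partial_sum_tendsto f)
  ultimately have "\<nu>\<^sup>2 \<le> \<nu>\<^sup>2 / 2 + 0 * \<nu>" by (intro LIMSEQ_le_const[where a="\<nu>\<^sup>2"]) auto
  then show False using \<nu> by simp
qed

end

theorem corollary4p3:
  fixes A p :: real and e :: "nat \<Rightarrow> real \<Rightarrow> complex"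
  assumes "A > 0" and "p > 1"
    and "\<And>n. e n \<in> L2"
    and "\<And>n. norm_L2 (e n) = 1"
    and "\<And>n. \<bar>p_mean p (e n)\<bar> \<le> A"
    and "\<And>n. \<bar>p_dispersion p (e n)\<bar> \<le> ereal A"
    and "\<And>n. \<bar>p_dispersion 2 (fourier_L2 (e n))\<bar> \<le> ereal A"
  shows "\<not> schauder_basis_L2 e"
proof
  assume "schauder_basis_L2 e"
  then interpret normalized_schauder_basis e using assms(4) by unfold_locales
  have "\<exists>b. p_moment 2 (fourier_L2 (e n)) b \<le> ennreal ((A + 1)\<^sup>2)" for n
  proof -
    have "A\<^sup>2 < (A + 1)\<^sup>2" using assms(1) by (intro power_strict_mono) auto
    then have "ennreal (A\<^sup>2) < ennreal ((A + 1)\<^sup>2)" by (simp add: ennreal_less_iff)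
    with INF_p_moment_le(2)[OF assms(7)[of n]]
    have "(INF b. p_moment 2 (fourier_L2 (e n)) b) < ennreal ((A + 1)\<^sup>2)" by (rule le_less_trans)
    then show ?thesis unfolding INF_less_iff by (auto intro: less_imp_le)
  qed
  then obtain b where b: "\<And>n. p_moment 2 (fourier_L2 (e n)) (b n) \<le> ennreal ((A + 1)\<^sup>2)" by metis
  interpret localized_schauder_basis e b "2 * pi * (A + 1)"
  proof unfold_locales
    show "0 \<le> 2 * pi * (A + 1)" using assms(1) by simp
    show "norm_L2 (\<lambda>t. e n (t + h) - cis (2 * pi * b n * h) * e n t) \<le> 2 * pi * (A + 1) * \<bar>h\<bar>" for n h
      using assms(1) by (intro translate_close_to_modulation[OF assms(3) b]) simp
  next
    fix \<eta> :: real assume "\<eta> > 0"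
    \<comment> \<open>The tail beyond \<open>A + S\<close> is at most \<open>sqrt (A\<^sup>2 / S) \<le> \<eta>\<close>.\<close>
    define S where "S = max 1 (A\<^sup>2 / \<eta>\<^sup>2)"
    have "A\<^sup>2 / \<eta>\<^sup>2 \<le> S" "S > 0" by (auto simp: S_def)
    then have "A\<^sup>2 / S \<le> \<eta>\<^sup>2" using \<open>\<eta> > 0\<close> by (simp add: pos_divide_le_eq mult.commute)
    then have "sqrt (A\<^sup>2 / S) \<le> \<eta>" using \<open>\<eta> > 0\<close> by (intro real_le_lsqrt) (auto simp: S_def)
    moreover have "norm_L2 (\<lambda>t. (1 - indicator {-(A + S)..A + S} t) * e n t) \<le> sqrt (A\<^sup>2 / S)" for n
      by (rule time_tail_le[OF assms(2,3,4,5,6)]) (simp add: S_def)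
    ultimately show "\<exists>R. \<forall>n. norm_L2 (\<lambda>t. (1 - indicator {-R..R} t) * e n t) \<le> \<eta>"
      by (intro exI[of _ "A + S"]) (auto intro: order_trans)
  qed
  show False by (rule not_uniformly_localized)
qed

end
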